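(* Let $n\ge 1$. Assume that there exists a $\delta$-constant deformation $(F_s)$ of a cuspidal singular point $z_0$ such that the general fiber has among its singularities $n$ (distinct) cuspidal singular points $z_1,\dots,z_n$. Let $S_0,S_1,\dots,S_n$ be the semigroups of the singular points $z_0,z_1,\dots,z_n$, respectively. Then for any integer $m\ge 0$ and any nonnegative integers $m_1,\dots,m_n$ such that $m_1+\dots+m_n=m$, we have \[ \#\big(S_0\cap[0,m)\big)\le\sum_{j=1}^n\#\big(S_j\cap[0,m_j)\big). \]
   Context: **Cuspidal singularities and semigroups.** A cuspidal (unibranched) plane curve singularity is a point $z$ on a complex curve $C\subset\mathbb{C}^2$ such that $C$ is smooth at all points sufficiently close to but different from $z$, and such that for small $r>0$ the link $C\cap\partial B(z,r)$ is connected, i.e. a knot; here $B(z,r)\subset\mathbb{C}^2$ is the ball of radius $r$ centred at $z$. Let $\gamma=(\phi,\psi)\colon V\to C$, with $V$ a neighbourhood of $0\in\mathbb{C}$, be a local analytic parametrization of $C$ near $z=(a,b)$ that is a homeomorphism onto a neighbourhood of $z$ in $C$, with $\gamma(0)=z$. The semigroup of the singularity is \[ S=\{\operatorname{ord}_{t=0} f(\phi(t)-a,\psi(t)-b) : f\in\mathbb{C}[[x,y]]\}\setminus\{\infty\}\subset\mathbb{Z}_{\ge 0}. \] **Deformations.** Let $F\colon\mathbb{C}^2\to\mathbb{C}$ be a polynomial such that $(F^{-1}(0),z_0)$ is a cuspidal singularity and $\nabla F\ne 0$ at all points sufficiently close to but different from $z_0$. A deformation of this singularity is an analytic family of polynomials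 $F_s\colon\mathbb{C}^2\to\mathbb{C}$, $s$ in the unit disk $D\subset\mathbb{C}$ (the coefficients are analytic functions of $s$), with $F_0=F$ and such that each $F_s^{-1}(0)$ is an algebraic curve with isolated singularities. Fix a small $r>0$ such that $L_0=F_0^{-1}(0)\cap\partial B(z_0,r)$ is the link of the singularity and $F_0^{-1}(0)\cap B(z_0,r)$ is a cone over $L_0$. Choose $\rho>0$ such that for $|s|<\rho$ the intersection $F_s^{-1}(0)\cap\partial B(z_0,r)$ is isotopic to $L_0$. The genus of a (possibly singular) curve is the genus of its normalization $\Sigma$, where for a compact surface with boundary $2b_0(\Sigma)-2g(\Sigma)=\chi(\Sigma)+b_0(\partial\Sigma)$. The deformation is called $\delta$-constant if there is $\rho'\in(0,\rho)$ such that for all $|s|<\rho'$ the curve $F_s^{-1}(0)\cap B(z_0,r)$ has genus $0$. **General fiber.** The general fiber is $F_s^{-1}(0)\cap B(z_0,r)$ for $s\neq 0$ with $|s|$ sufficiently small; the hypothesis means that for all such $s$ this curve has among its singular points cuspidal singular points $z_1,\dots,z_n$ (depending on $s$) with semigroups $S_1,\dots,S_n$ not depending on $s$. *)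

theory Defs
  imports
    "HOL-Computational_Algebra.Computational_Algebra"
    "HOL-Complex_Analysis.Complex_Analysis"
    "HOL-Homology.Homology"
begin

text \<open>The complex plane is \<open>complex \<times> complex\<close>, whose metric in the library is the Euclidean
  one, so \<open>cball\<close> and \<open>sphere\<close> are round. A plane curve is handled as a set of points.\<close>

section \<open>Bivariate polynomials\<close>

text \<open>A polynomial in \<open>x, y\<close> is a polynomial in \<open>y\<close> with coefficients in \<open>\<complex>[x]\<close>: the coefficient
  of \<open>x^i y^j\<close> is \<open>coeff (coeff P j) i\<close>.\<close>

type_synonym bipoly = "complex poly poly"

definition eval2 :: "bipoly \<Rightarrow> complex \<times> complex \<Rightarrow> complex" where
  "eval2 P z = poly (poly P [:snd z:]) (fst z)"

definition zero_set :: "bipoly \<Rightarrow> (complex \<times> complex) set" where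
  "zero_set P = {z. eval2 P z = 0}"

definition gradient :: "bipoly \<Rightarrow> complex \<times> complex \<Rightarrow> complex \<times> complex" where
  "gradient P z = (eval2 (map_poly pderiv P) z, eval2 (pderiv P) z)"

definition algebraic_curve :: "(complex \<times> complex) set \<Rightarrow> bool" where
  "algebraic_curve C \<longleftrightarrow> (\<exists>P. (\<nexists>c. P = [:[:c:]:]) \<and> C = zero_set P)"


section \<open>Local parametrizations, smooth and cuspidal points\<close>

definition local_param ::
  "(complex \<times> complex) set \<Rightarrow> complex \<times> complex \<Rightarrow> complex set \<Rightarrow> (complex \<Rightarrow> complex \<times> complex) \<Rightarrow> bool"
where
  "local_param C z V \<gamma> \<longleftrightarrow>
     open V \<and> 0 \<in> V \<and> \<gamma> 0 = z \<and>
     (fst \<circ> \<gamma>) holomorphic_on V \<and> (snd \<circ> \<gamma>) holomorphic_on V \<and>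
     openin (top_of_set C) (\<gamma> ` V) \<and>
     (\<exists>g. homeomorphism V (\<gamma> ` V) \<gamma> g)"

text \<open>Smoothness of the set \<open>C\<close>, i.e. near \<open>z\<close> it is a one-dimensional complex submanifold;
  the equation of \<open>C\<close> plays no role.\<close>

definition smooth_point :: "(complex \<times> complex) set \<Rightarrow> complex \<times> complex \<Rightarrow> bool" where
  "smooth_point C z \<longleftrightarrow>
     (\<exists>V \<gamma>. local_param C z V \<gamma> \<and> (deriv (fst \<circ> \<gamma>) 0, deriv (snd \<circ> \<gamma>) 0) \<noteq> (0, 0))"

definition singular_points :: "(complex \<times> complex) set \<Rightarrow> (complex \<times> complex) set" where
  "singular_points C = {z \<in> C. \<not> smooth_point C z}"

definition is_knot :: "(complex \<times> complex) set \<Rightarrow> bool" where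
  "is_knot K \<longleftrightarrow> connected K \<and> K homeomorphic sphere (0::complex) 1"

definition cuspidal_point :: "(complex \<times> complex) set \<Rightarrow> complex \<times> complex \<Rightarrow> bool" where
  "cuspidal_point C z \<longleftrightarrow>
     z \<in> C \<and>
     (\<exists>e>0. \<forall>p\<in>C \<inter> ball z e - {z}. smooth_point C p) \<and>
     (\<exists>r0>0. \<forall>r. 0 < r \<and> r < r0 \<longrightarrow> is_knot (C \<inter> sphere z r))"


section \<open>The semigroup of a cuspidal point\<close>

text \<open>\<open>f(u, v)\<close> for \<open>f \<in> \<complex>[[x,y]]\<close> and \<open>u, v \<in> \<complex>[[t]]\<close> without constant term; the coefficient
  of \<open>x^i y^j\<close> in \<open>f\<close> is \<open>fps_nth (fps_nth f j) i\<close>. The order of \<open>u^i v^j\<close> is at least \<open>i + j\<close>, so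
  only \<open>i, j \<le> k\<close> contribute to the coefficient of \<open>t^k\<close>.\<close>

definition fps_subst2 :: "complex fps fps \<Rightarrow> complex fps \<Rightarrow> complex fps \<Rightarrow> complex fps" where
  "fps_subst2 f u v =
     Abs_fps (\<lambda>k. \<Sum>j\<le>k. \<Sum>i\<le>k. fps_nth (fps_nth f j) i * fps_nth (u ^ i * v ^ j) k)"

definition param_semigroup :: "(complex \<Rightarrow> complex \<times> complex) \<Rightarrow> nat set" where
  "param_semigroup \<gamma> =
     (let u = fps_expansion (\<lambda>t. fst (\<gamma> t) - fst (\<gamma> 0)) 0;
          v = fps_expansion (\<lambda>t. snd (\<gamma> t) - snd (\<gamma> 0)) 0
      in {subdegree (fps_subst2 f u v) | f. fps_subst2 f u v \<noteq> 0})"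

text \<open>The semigroup does not depend on the parametrization, hence a relation suffices.\<close>

definition has_semigroup ::
  "(complex \<times> complex) set \<Rightarrow> complex \<times> complex \<Rightarrow> nat set \<Rightarrow> bool" where
  "has_semigroup C z S \<longleftrightarrow> (\<exists>V \<gamma>. local_param C z V \<gamma> \<and> S = param_semigroup \<gamma>)"


section \<open>Deformations\<close>

definition deformation :: "(complex \<Rightarrow> bipoly) \<Rightarrow> bool" where
  "deformation F \<longleftrightarrow>
     (\<forall>i j. (\<lambda>s. Polynomial.coeff (Polynomial.coeff (F s) j) i) holomorphic_on ball 0 1) \<and>
     (\<forall>s\<in>ball 0 1. algebraic_curve (zero_set (F s)) \<and> discrete (singular_points (zero_set (F s))))"


section \<open>Links and small balls\<close>

definition isotopic_in ::
  "(complex \<times> complex) set \<Rightarrow> (complex \<times> complex) set \<Rightarrow> (complex \<times> complex) set \<Rightarrow> bool" where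
  "isotopic_in S K L \<longleftrightarrow>
     (\<exists>h. homotopic_with_canon (\<lambda>f. \<exists>g. homeomorphism S S f g) S S (\<lambda>x. x) h \<and> h ` K = L)"

definition rescale :: "complex \<times> complex \<Rightarrow> real \<Rightarrow> complex \<times> complex \<Rightarrow> complex \<times> complex" where
  "rescale z t p = z + t *\<^sub>R (p - z)"

definition straight_cone ::
  "complex \<times> complex \<Rightarrow> (complex \<times> complex) set \<Rightarrow> (complex \<times> complex) set" where
  "straight_cone z L = {rescale z t p | t p. t \<in> {0..1} \<and> p \<in> L}"

text \<open>The radius \<open>r\<close> is small with respect to \<open>(C, z)\<close>: no further singular point lies in the
  closed ball, \<open>C \<inter> sphere z r\<close> is the link of the point (it is a knot whose isotopy type is that
  of the rescaled sections by all smaller spheres), and the pair (ball, curve) is the cone over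
  the pair (sphere, link). All sufficiently small \<open>r\<close> have these properties.\<close>

definition small_radius :: "(complex \<times> complex) set \<Rightarrow> complex \<times> complex \<Rightarrow> real \<Rightarrow> bool" where
  "small_radius C z r \<longleftrightarrow>
     0 < r \<and>
     (\<forall>p\<in>C \<inter> cball z r - {z}. smooth_point C p) \<and>
     is_knot (C \<inter> sphere z r) \<and>
     (\<forall>r'. 0 < r' \<and> r' \<le> r \<longrightarrow>
        isotopic_in (sphere z r) (C \<inter> sphere z r) (rescale z (r / r') ` (C \<inter> sphere z r'))) \<and>
     (\<exists>h g. homeomorphism (cball z r) (cball z r) h g \<and> h z = z \<and> (\<forall>x\<in>sphere z r. h x = x) \<and>
        h ` straight_cone z (C \<inter> sphere z r) = C \<inter> cball z r)"


section \<open>Genus\<close>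

text \<open>Rank of an abelian group: the largest size of a finite set independent over the integers.
  It is only used for groups of finite rank; for infinite rank the value is meaningless.\<close>

definition int_independent :: "('g, 'm) monoid_scheme \<Rightarrow> 'g set \<Rightarrow> bool" where
  "int_independent G B \<longleftrightarrow>
     B \<subseteq> carrier G \<and>
     (\<forall>c :: 'g \<Rightarrow> int. finprod G (\<lambda>x. x [^]\<^bsub>G\<^esub> c x) B = \<one>\<^bsub>G\<^esub> \<longrightarrow> (\<forall>x\<in>B. c x = 0))"

definition group_rank :: "('g, 'm) monoid_scheme \<Rightarrow> nat" where
  "group_rank G = Sup {card B | B. finite B \<and> int_independent G B}"

definition betti :: "int \<Rightarrow> 'a topology \<Rightarrow> nat" where
  "betti p X = group_rank (homology_group p X)"

text \<open>Euler characteristic of a space of dimension at most two.\<close>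

definition surface_euler_char :: "'a topology \<Rightarrow> int" where
  "surface_euler_char X = int (betti 0 X) - int (betti 1 X) + int (betti 2 X)"

definition compact_surface :: "'a topology \<Rightarrow> bool" where
  "compact_surface X \<longleftrightarrow>
     compact_space X \<and> Hausdorff_space X \<and>
     (\<forall>p\<in>topspace X. \<exists>U H. openin X U \<and> p \<in> U \<and>
        openin (top_of_set {w::complex. 0 \<le> Im w}) H \<and>
        subtopology X U homeomorphic_space top_of_set H)"

text \<open>By invariance of domain, the boundary of a surface consists of the points without a
  neighbourhood homeomorphic to an open set of the plane.\<close>

definition surface_boundary :: "'a topology \<Rightarrow> 'a set" where
  "surface_boundary X =
     {p \<in> topspace X. \<not> (\<exists>U H. openin X U \<and> p \<in> U \<and> open (H :: complex set) \<and>
        subtopology X U homeomorphic_space top_of_set H)}"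

definition surface_has_genus :: "'a topology \<Rightarrow> nat \<Rightarrow> bool" where
  "surface_has_genus X g \<longleftrightarrow>
     compact_surface X \<and>
     2 * int (betti 0 X) - 2 * int g
       = surface_euler_char X + int (betti 0 (subtopology X (surface_boundary X)))"

text \<open>Normalization \<open>\<nu> : N \<rightarrow> C\<close> of a plane curve: a finite proper surjective holomorphic map from
  a (possibly disconnected) Riemann surface, injective over the smooth part of \<open>C\<close>. No atlas is
  recorded: the topological charts \<open>c\<close> for which \<open>\<nu> \<circ> c\<close> is holomorphic are automatically
  compatible, because \<open>\<nu> \<circ> c\<close> is locally biholomorphic onto \<open>C\<close> off a discrete set and the
  change of charts is continuous.\<close>

definition normalization ::
  "(complex \<times> complex) set \<Rightarrow> 'a topology \<Rightarrow> ('a \<Rightarrow> complex \<times> complex) \<Rightarrow> bool" where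
  "normalization C N \<nu> \<longleftrightarrow>
     Hausdorff_space N \<and>
     continuous_map N (top_of_set C) \<nu> \<and> proper_map N (top_of_set C) \<nu> \<and>
     \<nu> ` topspace N = C \<and>
     (\<forall>z\<in>C. finite {p \<in> topspace N. \<nu> p = z}) \<and>
     inj_on \<nu> {p \<in> topspace N. smooth_point C (\<nu> p)} \<and>
     (\<forall>p\<in>topspace N. \<exists>U V c. openin N U \<and> p \<in> U \<and> open V \<and>
        homeomorphic_map (top_of_set V) (subtopology N U) c \<and>
        (fst \<circ> \<nu> \<circ> c) holomorphic_on V \<and> (snd \<circ> \<nu> \<circ> c) holomorphic_on V)"

text \<open>Genus of \<open>C \<inter> cball z r\<close>. Its normalization is the part of the normalization of \<open>C\<close> lying
  over the ball. As \<open>\<nu>\<close> has finite fibres, the points of \<open>N\<close> may be taken in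
  \<open>(\<complex> \<times> \<complex>) \<times> \<nat>\<close>; the topology of \<open>N\<close> is unrelated to that of this type.\<close>

definition ball_part_has_genus ::
  "(complex \<times> complex) set \<Rightarrow> complex \<times> complex \<Rightarrow> real \<Rightarrow> nat \<Rightarrow> bool" where
  "ball_part_has_genus C z r g \<longleftrightarrow>
     (\<exists>(N :: ((complex \<times> complex) \<times> nat) topology) \<nu>. normalization C N \<nu> \<and>
        surface_has_genus (subtopology N {p \<in> topspace N. \<nu> p \<in> cball z r}) g)"

definition delta_constant ::
  "(complex \<Rightarrow> bipoly) \<Rightarrow> complex \<times> complex \<Rightarrow> real \<Rightarrow> real \<Rightarrow> bool" where
  "delta_constant F z r \<rho> \<longleftrightarrow>
     (\<exists>\<rho>'. 0 < \<rho>' \<and> \<rho>' < \<rho> \<and>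
        (\<forall>s. cmod s < \<rho>' \<longrightarrow> ball_part_has_genus (zero_set (F s)) z r 0))"

end

theory Submission
  imports Defs
begin

text \<open>Suppose \<open>S\<^sub>0 \<inter> [0, m)\<close> has more elements than the sets \<open>S\<^sub>j \<inter> [0, m\<^sub>j)\<close> together. For each
  \<open>\<tau> \<in> S\<^sub>0 \<inter> [0, m)\<close> take a polynomial of order \<open>\<tau>\<close> on the branch at \<open>z\<^sub>0\<close>. By linear algebra, for
  small \<open>s \<noteq> 0\<close> some nontrivial combination \<open>f\<^sub>s\<close> of these has order at least \<open>m\<^sub>j\<close> on the branch at
  every \<open>z\<^sub>j\<close>. A limit \<open>f\<close> of normalized \<open>f\<^sub>s\<close> as \<open>s \<rightarrow> 0\<close> is again a nontrivial combination, so it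
  has order less than \<open>m\<close> at \<open>z\<^sub>0\<close>. But the \<open>z\<^sub>j\<close> tend to \<open>z\<^sub>0\<close>, and intersection multiplicity with
  the curves \<open>F\<^sub>s = 0\<close> is upper semicontinuous, so the order of \<open>f\<close> at \<open>z\<^sub>0\<close> is at least \<open>\<Sum> m\<^sub>j = m\<close>.

  Intersection multiplicity is measured by \<open>N\<^sub>s(x) = \<Prod> f\<^sub>s(x, w)\<close>, the product over the roots \<open>w\<close> near
  \<open>z\<^sub>0\<close> of \<open>F\<^sub>s(x, -)\<close>. It is holomorphic in \<open>x\<close> and continuous in \<open>s\<close>, because the power sums of the
  values \<open>f\<^sub>s(x, w)\<close> are contour integrals and determine the product by Newton's identities.\<close>


section \<open>Bivariate polynomials as coefficient arrays\<close>

text \<open>At \<open>z\<^sub>j\<close> only \<open>card (S\<^sub>j \<inter> [0, m\<^sub>j))\<close>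
  linear conditions are needed, not \<open>m\<^sub>j\<close>: the order of a polynomial along a
  branch lies in the semigroup, so once the coefficients of index in \<open>S\<^sub>j\<close> below
  \<open>m\<^sub>j\<close> vanish, the order is at least \<open>m\<^sub>j\<close>. Polynomials
  suffice in place of power series because only orders below \<open>m\<close> have to be realised,
  and truncation at degree \<open>m\<close> does not change coefficients up to \<open>t^m\<close>.
  Together with a common degree bound for all \<open>F\<^sub>s\<close>, every limit becomes a limit
  of finitely many coefficients. The obstacle is that the branches at the \<open>z\<^sub>j\<close>
  come with no uniformity in \<open>s\<close>: their domains and the constants in their order
  estimates may degenerate as \<open>s\<close> tends to 0. Only the number of zeros of
  \<open>N\<^sub>s\<close> is carried to the limit, by a Schwarz estimate whose constants depend on
  a fixed box around \<open>z\<^sub>0\<close> alone. In the limit \<open>N\<^sub>0\<close> must not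
  vanish to higher order than \<open>f\<close>; for this the roots over \<open>x\<close> must be
  simple, which is where the nonvanishing gradient of \<open>F\<^sub>0\<close> enters. The same
  nonvanishing keeps singular points of \<open>F\<^sub>s = 0\<close> from accumulating anywhere but
  at \<open>z\<^sub>0\<close>.\<close>

definition bieval :: "nat \<Rightarrow> (nat \<Rightarrow> nat \<Rightarrow> complex) \<Rightarrow> complex \<Rightarrow> complex \<Rightarrow> complex" where
  "bieval D A x y = (\<Sum>i\<le>D. \<Sum>j\<le>D. A i j * x ^ i * y ^ j)"

abbreviation bieval_at where
  "bieval_at D A p \<equiv> bieval D A (fst p) (snd p)"

text \<open>With the degree bound \<open>D\<close> fixed, only finitely many coefficients enter
  \<open>bieval D\<close>, so coefficientwise convergence amounts to uniform convergence on bounded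
  sets.\<close>

abbreviation coeffs_tendsto :: "(nat \<Rightarrow> nat \<Rightarrow> nat \<Rightarrow> complex) \<Rightarrow> (nat \<Rightarrow> nat \<Rightarrow> complex) \<Rightarrow> bool" where
  "coeffs_tendsto A A' \<equiv> \<forall>i j. (\<lambda>n. A n i j) \<longlonglongrightarrow> A' i j"

text \<open>The array of the partial derivative in \<open>x\<close>. The guard \<open>i < D\<close>
  is essential: \<open>bieval D\<close> ignores \<open>A (Suc D) j\<close>, so its derivative must
  not see that coefficient.\<close>

definition bdx :: "nat \<Rightarrow> (nat \<Rightarrow> nat \<Rightarrow> complex) \<Rightarrow> nat \<Rightarrow> nat \<Rightarrow> complex" where
  "bdx D A i j = (if i < D then of_nat (Suc i) * A (Suc i) j else 0)"

definition bdy :: "nat \<Rightarrow> (nat \<Rightarrow> nat \<Rightarrow> complex) \<Rightarrow> nat \<Rightarrow> nat \<Rightarrow> complex" where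
  "bdy D A i j = (if j < D then of_nat (Suc j) * A i (Suc j) else 0)"

lemma bieval_swap: "bieval D (\<lambda>i j. A j i) y x = bieval D A x y"
  unfolding bieval_def by (subst sum.swap) (simp add: mult_ac)

lemma bdx_swap: "bdx D (\<lambda>i j. A j i) = (\<lambda>i j. bdy D A j i)"
  by (simp add: bdx_def bdy_def fun_eq_iff)

lemma bdy_swap: "bdy D (\<lambda>i j. A j i) = (\<lambda>i j. bdx D A j i)"
  by (simp add: bdx_def bdy_def fun_eq_iff)

lemma has_field_derivative_sum_power:
  fixes a :: "nat \<Rightarrow> complex"
  shows "((\<lambda>y. \<Sum>j\<le>D. a j * y ^ j) has_field_derivative
    (\<Sum>j\<le>D. (if j < D then of_nat (Suc j) * a (Suc j) else 0) * y ^ j)) (at y within S)"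
proof (cases D)
  case (Suc d)
  have "((\<lambda>y. \<Sum>j\<le>D. a j * y ^ j) has_field_derivative
      (\<Sum>j\<le>D. a j * (of_nat j * y ^ (j - 1)))) (at y within S)"
    by (auto intro!: derivative_eq_intros sum.cong)
  also have "(\<Sum>j\<le>D. a j * (of_nat j * y ^ (j - 1))) = (\<Sum>j\<le>d. a (Suc j) * (of_nat (Suc j) * y ^ j))"
    unfolding Suc by (subst sum.atMost_Suc_shift) simp
  also have "\<dots> = (\<Sum>j\<le>D. (if j < D then of_nat (Suc j) * a (Suc j) else 0) * y ^ j)"
    unfolding Suc sum.atMost_Suc by (auto simp: less_Suc_eq_le intro!: sum.cong)
  finally show ?thesis .
qed simp

lemma bieval_alt: "bieval D A x y = (\<Sum>j\<le>D. (\<Sum>i\<le>D. A i j * x ^ i) * y ^ j)"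
  unfolding bieval_def by (subst sum.swap) (simp add: sum_distrib_right)

lemma has_field_derivative_bieval_y:
  "(bieval D A x has_field_derivative bieval D (bdy D A) x y) (at y within S)"
proof -
  have "(bieval D A x has_field_derivative
      (\<Sum>j\<le>D. (if j < D then of_nat (Suc j) * (\<Sum>i\<le>D. A i (Suc j) * x ^ i) else 0) * y ^ j)) (at y within S)"
    using has_field_derivative_sum_power[of "\<lambda>j. \<Sum>i\<le>D. A i j * x ^ i" D y S]
    by (simp add: bieval_alt[abs_def])
  also have "(\<Sum>j\<le>D. (if j < D then of_nat (Suc j) * (\<Sum>i\<le>D. A i (Suc j) * x ^ i) else 0) * y ^ j)
      = bieval D (bdy D A) x y"
    unfolding bieval_alt by (intro sum.cong refl) (auto simp: bdy_def sum_distrib_left mult_ac)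
  finally show ?thesis .
qed

lemma has_field_derivative_bieval_x:
  "((\<lambda>x. bieval D A x y) has_field_derivative bieval D (bdx D A) x y) (at x within S)"
proof -
  have "bieval D (\<lambda>i j. A j i) y = (\<lambda>x. bieval D A x y)" by (intro ext bieval_swap)
  moreover have "bieval D (bdy D (\<lambda>i j. A j i)) y x = bieval D (bdx D A) x y"
    unfolding bdy_swap[of D A] by (rule bieval_swap)
  ultimately show ?thesis
    using has_field_derivative_bieval_y[of D "\<lambda>i j. A j i" y x S] by simp
qed

lemma continuous_on_bieval [continuous_intros]:
  assumes "continuous_on S f" "continuous_on S g"
  shows "continuous_on S (\<lambda>z. bieval D A (f z) (g z))"
  unfolding bieval_def by (intro continuous_intros assms)

lemma holomorphic_on_bieval [holomorphic_intros]:
  assumes "f holomorphic_on S" "g holomorphic_on S"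
  shows "(\<lambda>z. bieval D A (f z) (g z)) holomorphic_on S"
  unfolding bieval_def by (intro holomorphic_intros assms)

lemma tendsto_bieval [tendsto_intros]:
  assumes "(f \<longlongrightarrow> x) F" "(g \<longlongrightarrow> y) F" "\<And>i j. ((\<lambda>k. A k i j) \<longlongrightarrow> A' i j) F"
  shows "((\<lambda>k. bieval D (A k) (f k) (g k)) \<longlongrightarrow> bieval D A' x y) F"
  unfolding bieval_def by (intro tendsto_intros assms)

lemma bieval_chain:
  assumes "(f has_field_derivative f') (at t)" "(g has_field_derivative g') (at t)"
  shows "((\<lambda>t. bieval D A (f t) (g t)) has_field_derivative
    (bieval D (bdx D A) (f t) (g t) * f' + bieval D (bdy D A) (f t) (g t) * g')) (at t)"
proof -
  have "((\<lambda>t. A i j * f t ^ i * g t ^ j) has_field_derivative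
    (A i j * (of_nat i * f t ^ (i - 1)) * g t ^ j) * f'
       + (A i j * f t ^ i * (of_nat j * g t ^ (j - 1))) * g') (at t)" for i j
    by (auto intro!: derivative_eq_intros assms simp: algebra_simps)
  then have *: "((\<lambda>t. bieval D A (f t) (g t)) has_field_derivative
    (\<Sum>i\<le>D. \<Sum>j\<le>D. (A i j * (of_nat i * f t ^ (i - 1)) * g t ^ j) * f'
       + (A i j * f t ^ i * (of_nat j * g t ^ (j - 1))) * g')) (at t)"
    unfolding bieval_def by (intro DERIV_sum)
  have mx: "((\<lambda>x. A i j * x ^ i * y ^ j) has_field_derivative A i j * (of_nat i * x ^ (i - 1)) * y ^ j) (at x)"
    for i j x y by (auto intro!: derivative_eq_intros)
  have my: "((\<lambda>y. A i j * x ^ i * y ^ j) has_field_derivative A i j * x ^ i * (of_nat j * y ^ (j - 1))) (at y)"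
    for i j x y by (auto intro!: derivative_eq_intros)
  \<comment> \<open>Both sides are derivatives of the same polynomial, so uniqueness of the
    derivative replaces a reindexing of the double sum.\<close>
  have x: "(\<Sum>i\<le>D. \<Sum>j\<le>D. A i j * (of_nat i * x ^ (i - 1)) * y ^ j) = bieval D (bdx D A) x y" for x y
  proof (rule DERIV_unique)
    show "((\<lambda>x. bieval D A x y) has_field_derivative
        (\<Sum>i\<le>D. \<Sum>j\<le>D. A i j * (of_nat i * x ^ (i - 1)) * y ^ j)) (at x)"
      unfolding bieval_def by (intro DERIV_sum mx)
  qed (rule has_field_derivative_bieval_x)
  have y: "(\<Sum>i\<le>D. \<Sum>j\<le>D. A i j * x ^ i * (of_nat j * y ^ (j - 1))) = bieval D (bdy D A) x y" for x y
  proof (rule DERIV_unique)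
    show "(bieval D A x has_field_derivative
        (\<Sum>i\<le>D. \<Sum>j\<le>D. A i j * x ^ i * (of_nat j * y ^ (j - 1)))) (at y)"
      unfolding bieval_def[abs_def] by (intro DERIV_sum my)
  qed (rule has_field_derivative_bieval_y)
  have "(\<Sum>i\<le>D. \<Sum>j\<le>D. (A i j * (of_nat i * f t ^ (i - 1)) * g t ^ j) * f'
       + (A i j * f t ^ i * (of_nat j * g t ^ (j - 1))) * g')
     = (\<Sum>i\<le>D. \<Sum>j\<le>D. A i j * (of_nat i * f t ^ (i - 1)) * g t ^ j) * f'
       + (\<Sum>i\<le>D. \<Sum>j\<le>D. A i j * f t ^ i * (of_nat j * g t ^ (j - 1))) * g'"
    by (simp add: sum.distrib sum_distrib_right)
  with * show ?thesis unfolding x y by simp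
qed

text \<open>The difference at any point of \<open>S\<close> is dominated by the sum of
  \<open>norm (A k i j - A' i j) * R ^ i * R ^ j\<close>, which tends to 0 and no longer involves
  the point.\<close>

lemma uniform_limit_bieval:
  assumes "\<And>i j. (\<lambda>k. A k i j) \<longlonglongrightarrow> A' i j"
    and "\<And>z. z \<in> S \<Longrightarrow> norm (f z) \<le> R" "\<And>z. z \<in> S \<Longrightarrow> norm (g z) \<le> R"
  shows "uniform_limit S (\<lambda>k z. bieval D (A k) (f z) (g z)) (\<lambda>z. bieval D A' (f z) (g z)) sequentially"
proof (rule uniform_limitI)
  fix e :: real assume "e > 0"
  have "(\<lambda>k. \<Sum>i\<le>D. \<Sum>j\<le>D. norm (A k i j - A' i j) * R ^ i * R ^ j)
      \<longlonglongrightarrow> (\<Sum>i\<le>D. \<Sum>j\<le>D. norm (A' i j - A' i j) * R ^ i * R ^ j)"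
    by (intro tendsto_intros assms)
  then have "\<forall>\<^sub>F k in sequentially. (\<Sum>i\<le>D. \<Sum>j\<le>D. norm (A k i j - A' i j) * R ^ i * R ^ j) < e"
    using \<open>e > 0\<close> by (intro order_tendstoD(2)) auto
  then show "\<forall>\<^sub>F k in sequentially. \<forall>z\<in>S. dist (bieval D (A k) (f z) (g z)) (bieval D A' (f z) (g z)) < e"
  proof eventually_elim
    case (elim k)
    show ?case
    proof
      fix z assume z: "z \<in> S"
      have "dist (bieval D (A k) (f z) (g z)) (bieval D A' (f z) (g z))
          = norm (\<Sum>i\<le>D. \<Sum>j\<le>D. (A k i j - A' i j) * f z ^ i * g z ^ j)"
        by (simp add: dist_norm bieval_def sum_subtractf algebra_simps)
      also have "\<dots> \<le> (\<Sum>i\<le>D. \<Sum>j\<le>D. norm ((A k i j - A' i j) * f z ^ i * g z ^ j))"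
        by (intro order_trans[OF norm_sum] sum_mono norm_sum)
      also have "\<dots> \<le> (\<Sum>i\<le>D. \<Sum>j\<le>D. norm (A k i j - A' i j) * R ^ i * R ^ j)"
        using assms(2,3)[OF z]
          order_trans[OF norm_ge_zero assms(2)[OF z]]
        by (intro sum_mono) (auto simp: norm_mult norm_power intro!: mult_mono power_mono)
      finally show "dist (bieval D (A k) (f z) (g z)) (bieval D A' (f z) (g z)) < e"
        using elim by simp
    qed
  qed
qed

section \<open>Products over the roots of a fibre\<close>

text \<open>Newton's identities, as the logarithmic derivative of \<open>\<Prod> (1 - g\<^sub>w X)\<close>.\<close>

lemma fps_deriv_prod_linear:
  fixes g :: "'a \<Rightarrow> complex" and \<mu> :: "'a \<Rightarrow> nat"
  assumes "finite Z"
  shows "fps_deriv (\<Prod>w\<in>Z. (1 - fps_const (g w) * fps_X) ^ \<mu> w)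
    = - (\<Prod>w\<in>Z. (1 - fps_const (g w) * fps_X) ^ \<mu> w) * Abs_fps (\<lambda>k. \<Sum>w\<in>Z. of_nat (\<mu> w) * g w ^ Suc k)"
  using assms
proof induction
  case empty
  show ?case by (simp add: fps_eq_iff)
next
  case (insert w Z)
  \<comment> \<open>\<open>G\<close> is the geometric series of \<open>g w / (1 - g w X)\<close>,
    and \<open>Q\<close> is the generating function of the power sums of exponent at least
    1.\<close>
  define G where "G = Abs_fps (\<lambda>k. g w ^ Suc k)"
  define E where "E = (\<Prod>w\<in>Z. (1 - fps_const (g w) * fps_X) ^ \<mu> w)"
  define Q where "Q = Abs_fps (\<lambda>k. \<Sum>w\<in>Z. of_nat (\<mu> w) * g w ^ Suc k)"
  define L where "L = 1 - fps_const (g w) * fps_X"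
  have LG: "L * G = fps_const (g w)"
  proof (rule fps_ext)
    fix n show "fps_nth (L * G) n = fps_nth (fps_const (g w)) n"
      by (cases n) (simp_all add: L_def G_def algebra_simps fps_mult_fps_X_deriv_shift mult.assoc
          fps_X_mult_nth)
  qed
  have dL: "fps_deriv (L ^ k) = - (L ^ k) * (of_nat k * G)" for k
  proof (cases k)
    case (Suc l)
    have "fps_deriv L = - fps_const (g w)" by (simp add: L_def)
    then have "fps_deriv (L ^ k) = - (of_nat k * L ^ l * fps_const (g w))"
      unfolding Suc fps_deriv_power fps_of_nat by (simp only: diff_Suc_1 mult_ac mult_minus_right mult_minus_left)
    also have "\<dots> = - (L ^ k) * (of_nat k * G)"
      unfolding LG[symmetric] Suc by (simp add: mult_ac)
    finally show ?thesis .
  qed simp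
  have Q': "Abs_fps (\<lambda>k. \<Sum>w\<in>insert w Z. of_nat (\<mu> w) * g w ^ Suc k) = of_nat (\<mu> w) * G + Q"
    using insert by (simp add: fps_eq_iff Q_def G_def fps_of_nat[symmetric] del: fps_of_nat)
  have P': "(\<Prod>w\<in>insert w Z. (1 - fps_const (g w) * fps_X) ^ \<mu> w) = L ^ \<mu> w * E"
    using insert by (simp add: E_def L_def)
  have IH: "fps_deriv E = - E * Q" using insert.IH by (simp add: E_def Q_def)
  show ?case unfolding P' Q' fps_deriv_mult dL IH by (simp add: algebra_simps)
qed

text \<open>Coefficient \<open>k\<close> of the logarithmic derivative identity, solved for the
  coefficient of index \<open>Suc k\<close>: all coefficients are determined recursively by the
  power sums.\<close>

lemma fps_nth_prod_linear_rec:
  fixes g :: "'a \<Rightarrow> complex" and \<mu> :: "'a \<Rightarrow> nat"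
  assumes "finite Z"
  defines "E \<equiv> \<Prod>w\<in>Z. (1 - fps_const (g w) * fps_X) ^ \<mu> w"
  shows "fps_nth E (Suc k) =
    - (\<Sum>i\<le>k. fps_nth E i * (\<Sum>w\<in>Z. of_nat (\<mu> w) * g w ^ (Suc k - i))) / of_nat (Suc k)"
proof -
  have "of_nat (Suc k) * fps_nth E (Suc k) = fps_nth (fps_deriv E) k" by simp
  also have "fps_deriv E = - (E * Abs_fps (\<lambda>k. \<Sum>w\<in>Z. of_nat (\<mu> w) * g w ^ Suc k))"
    using fps_deriv_prod_linear[OF assms(1)] unfolding E_def by simp
  also have "fps_nth \<dots> k = - (\<Sum>i\<le>k. fps_nth E i * (\<Sum>w\<in>Z. of_nat (\<mu> w) * g w ^ (Suc k - i)))"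
  proof -
    have "Suc (k - i) = Suc k - i" if "i \<le> k" for i using that by simp
    then show ?thesis unfolding fps_neg_nth fps_mult_nth atMost_atLeast0
      by (intro arg_cong[of _ _ uminus] sum.cong refl) (simp del: power_Suc)
  qed
  finally show ?thesis by (simp add: field_simps del: of_nat_Suc)
qed

text \<open>The factors are multiplied one by one; the induction carries along that all coefficients
  above the current degree vanish, so each factor multiplies the top coefficient by
  \<open>- g w\<close>.\<close>

lemma fps_nth_prod_linear_top:
  fixes g :: "'a \<Rightarrow> complex" and \<mu> :: "'a \<Rightarrow> nat"
  assumes "finite Z"
  shows "fps_nth (\<Prod>w\<in>Z. (1 - fps_const (g w) * fps_X) ^ \<mu> w) (\<Sum>w\<in>Z. \<mu> w)
    = (-1) ^ (\<Sum>w\<in>Z. \<mu> w) * (\<Prod>w\<in>Z. g w ^ \<mu> w)"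
proof -
  have step: "(\<forall>k>Suc P. fps_nth (E * (1 - fps_const c * fps_X)) k = 0) \<and>
      fps_nth (E * (1 - fps_const c * fps_X)) (Suc P) = - c * v"
    if "(\<forall>k>P. fps_nth E k = 0) \<and> fps_nth E P = v" for E :: "complex fps" and P c v
  proof -
    have "fps_nth (E * (1 - fps_const c * fps_X)) (Suc k) = fps_nth E (Suc k) - c * fps_nth E k" for k
      by (simp add: right_diff_distrib mult.assoc[symmetric] mult.commute[of E "fps_const c"])
    note nth = this
    show ?thesis
    proof (intro conjI allI impI)
      fix k assume "k > Suc P"
      then obtain l where "k = Suc l" "l > P" by (cases k) auto
      then show "fps_nth (E * (1 - fps_const c * fps_X)) k = 0" using that nth[of l] by simp
    qed (use that nth[of P] in simp)
  qed
  have pow: "(\<forall>k>P + n. fps_nth (E * (1 - fps_const c * fps_X) ^ n) k = 0) \<and>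
      fps_nth (E * (1 - fps_const c * fps_X) ^ n) (P + n) = (- c) ^ n * v"
    if "(\<forall>k>P. fps_nth E k = 0) \<and> fps_nth E P = v" for E :: "complex fps" and P c v n
  proof (induction n)
    case (Suc n)
    from step[OF Suc, of c] show ?case by (simp add: mult_ac)
  qed (use that in simp)
  have "(\<forall>k>(\<Sum>w\<in>Z. \<mu> w). fps_nth (\<Prod>w\<in>Z. (1 - fps_const (g w) * fps_X) ^ \<mu> w) k = 0) \<and>
     fps_nth (\<Prod>w\<in>Z. (1 - fps_const (g w) * fps_X) ^ \<mu> w) (\<Sum>w\<in>Z. \<mu> w)
    = (-1) ^ (\<Sum>w\<in>Z. \<mu> w) * (\<Prod>w\<in>Z. g w ^ \<mu> w)"
    using assms
  proof induction
    case (insert w Z)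
    have "(- g w) ^ \<mu> w = (-1) ^ \<mu> w * g w ^ \<mu> w" by (rule power_minus)
    have "(\<Prod>w\<in>insert w Z. (1 - fps_const (g w) * fps_X) ^ \<mu> w)
        = (\<Prod>w\<in>Z. (1 - fps_const (g w) * fps_X) ^ \<mu> w) * (1 - fps_const (g w) * fps_X) ^ \<mu> w"
      "(\<Sum>w\<in>insert w Z. \<mu> w) = (\<Sum>w\<in>Z. \<mu> w) + \<mu> w"
      "(-1) ^ (\<Sum>w\<in>insert w Z. \<mu> w) * (\<Prod>w\<in>insert w Z. g w ^ \<mu> w)
        = (- g w) ^ \<mu> w * ((-1) ^ (\<Sum>w\<in>Z. \<mu> w) * (\<Prod>w\<in>Z. g w ^ \<mu> w))"
      using insert.hyps by (simp_all add: power_add mult.commute add.commute \<open>(- g w) ^ \<mu> w = _\<close>)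
    with pow[OF insert.IH, of "\<mu> w" "g w"] show ?case by presburger
  qed simp
  then show ?thesis by simp
qed

section \<open>Multiplicities of fibre roots, and power sums as contour integrals\<close>

definition fibre_roots :: "nat \<Rightarrow> (nat \<Rightarrow> nat \<Rightarrow> complex) \<Rightarrow> complex \<Rightarrow> real \<Rightarrow> complex \<Rightarrow> complex set" where
  "fibre_roots D A b e x = {w \<in> ball b e. bieval D A x w = 0}"

definition fibre_mult :: "nat \<Rightarrow> (nat \<Rightarrow> nat \<Rightarrow> complex) \<Rightarrow> complex \<Rightarrow> complex \<Rightarrow> nat" where
  "fibre_mult D A x w = nat (zorder (bieval D A x) w)"

definition power_sum where
  "power_sum D A b e h x = (\<Sum>w\<in>fibre_roots D A b e x. of_nat (fibre_mult D A x w) * h w :: complex)"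

text \<open>The function \<open>N\<close> of the overview: the norm of \<open>B\<close> with respect
  to the projection of the curve of \<open>A\<close> to the \<open>x\<close>-axis, restricted to the
  roots in a disc.\<close>

definition fibre_norm where
  "fibre_norm D A B b e x = (\<Prod>w\<in>fibre_roots D A b e x. bieval D B x w ^ fibre_mult D A x w)"

lemma finite_bieval_zeros:
  assumes "bieval D A x y \<noteq> 0"
  shows "finite {w. bieval D A x w = 0}"
proof -
  define p where "p = (\<Sum>j\<le>D. Polynomial.monom (\<Sum>i\<le>D. A i j * x ^ i) j)"
  have p: "poly p w = bieval D A x w" for w
    by (simp add: p_def bieval_alt poly_sum poly_monom)
  with assms have "p \<noteq> 0" by force
  then show ?thesis using poly_roots_finite[of p] by (simp add: p)
qed

lemma not_eventually_bieval_zero: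
  assumes "bieval D A x y \<noteq> 0"
  shows "\<exists>\<^sub>F w in at w0. bieval D A x w \<noteq> 0"
proof -
  have "\<forall>\<^sub>F w in at w0. w \<in> - ({w. bieval D A x w = 0} - {w0}) - {w0}"
    using finite_bieval_zeros[OF assms] by (intro eventually_at_in_open) (auto intro!: open_Compl finite_imp_closed simp del: Compl_Diff_eq)
  then have "\<forall>\<^sub>F w in at w0. bieval D A x w \<noteq> 0"
    by (auto elim: eventually_mono)
  then show ?thesis by (simp add: eventually_frequently)
qed

lemma fibre_mult_eq:
  assumes "bieval D A x y \<noteq> 0"
  shows "zorder (bieval D A x) w = int (fibre_mult D A x w)"
    and "bieval D A x w = 0 \<Longrightarrow> fibre_mult D A x w > 0"
proof -
  have hol: "bieval D A x holomorphic_on UNIV" by (intro holomorphic_intros)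
  have "bieval D A x analytic_on {w}" using hol analytic_on_holomorphic by blast
  then have *: "zorder (bieval D A x) w \<ge> 0" "(bieval D A x w = 0) = (0 < zorder (bieval D A x) w)"
    using zorder_ge_0[of "bieval D A x" w] zorder_pos_iff[of "bieval D A x" UNIV w] hol
      not_eventually_bieval_zero[OF assms, of w]
    by auto
  then show "zorder (bieval D A x) w = int (fibre_mult D A x w)"
    and "bieval D A x w = 0 \<Longrightarrow> fibre_mult D A x w > 0"
    by (auto simp: fibre_mult_def)
qed

text \<open>Near the root the fibre polynomial is \<open>g u * (u - w) ^ m\<close> with
  \<open>g w \<noteq> 0\<close>; its derivative at \<open>w\<close> is \<open>g w\<close> for
  \<open>m = 1\<close> and 0 for larger \<open>m\<close>.\<close>

lemma fibre_mult_eq_1_iff: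
  assumes "bieval D A x y \<noteq> 0" "bieval D A x w = 0"
  shows "fibre_mult D A x w = 1 \<longleftrightarrow> bieval D (bdy D A) x w \<noteq> 0"
proof -
  have hol: "bieval D A x holomorphic_on UNIV" by (intro holomorphic_intros)
  have d: "deriv (bieval D A x) w = bieval D (bdy D A) x w"
    by (intro DERIV_imp_deriv has_field_derivative_bieval_y)
  define m where "m = fibre_mult D A x w"
  have z: "zorder (bieval D A x) w = int m" using fibre_mult_eq(1)[OF assms(1)] by (simp add: m_def)
  have "\<exists>w\<in>UNIV. bieval D A x w \<noteq> 0" using assms(1) by auto
  from zorder_exist_zero[OF hol open_UNIV connected_UNIV UNIV_I this, of w] assms
  obtain g r where g: "r > 0" "g holomorphic_on cball w r"
    "\<And>u. u \<in> cball w r \<Longrightarrow> bieval D A x u = g u * (u - w) ^ m \<and> g u \<noteq> 0" unfolding z by auto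
  have m0: "m > 0" using fibre_mult_eq(2)[OF assms] by (simp add: m_def)
  have "g field_differentiable at w"
    using g(1) holomorphic_on_subset[OF g(2) ball_subset_cball]
    by (intro holomorphic_on_imp_differentiable_at[of _ "ball w r"]) auto
  then obtain g' where g': "(g has_field_derivative g') (at w)" by (auto simp: field_differentiable_def)
  have "((\<lambda>u. g u * (u - w) ^ m) has_field_derivative
      g' * (w - w) ^ m + of_nat m * (w - w) ^ (m - 1) * g w) (at w)"
    by (auto intro!: derivative_eq_intros g')
  moreover have "\<forall>\<^sub>F u in nhds w. bieval D A x u = g u * (u - w) ^ m"
    using g(1,3) by (intro eventually_nhds_in_open[of "ball w r", THEN eventually_mono]) auto
  ultimately have "deriv (bieval D A x) w = g' * (w - w) ^ m + of_nat m * (w - w) ^ (m - 1) * g w"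
    by (intro DERIV_imp_deriv) (subst DERIV_cong_ev[OF refl _ refl], assumption+)
  also have "\<dots> = (if m = 1 then g w else 0)" using m0 by (auto simp: power_0_left)
  finally have "(bieval D (bdy D A) x w \<noteq> 0) = (m = 1)" using g(1) g(3)[of w] by (simp add: d)
  then show ?thesis by (simp add: m_def)
qed

text \<open>The argument principle with weight \<open>h\<close>. It sums over all zeros in the
  plane; there are none on the circle, and those outside the disc have winding number 0.\<close>

lemma contour_integral_power_sum:
  assumes "e > 0" and nz: "\<And>y. y \<in> sphere b e \<Longrightarrow> bieval D A x y \<noteq> 0" and h: "h holomorphic_on UNIV"
  shows "contour_integral (circlepath b e) (\<lambda>y. bieval D (bdy D A) x y * h y / bieval D A x y)
    = 2 * pi * \<i> * power_sum D A b e h x"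
proof -
  have "b + of_real e \<in> sphere b e" using \<open>e > 0\<close> by (simp add: dist_norm)
  note nz0 = nz[OF this]
  define f where "f = bieval D A x"
  have deriv_f: "deriv f = bieval D (bdy D A) x"
    unfolding f_def by (intro ext DERIV_imp_deriv has_field_derivative_bieval_y)
  have fin: "finite {w. f w = 0}" using finite_bieval_zeros[OF nz0] by (simp add: f_def)
  have "contour_integral (circlepath b e) (\<lambda>y. deriv f y * h y / f y) = 2 * pi * \<i> *
      (\<Sum>p\<in>{w\<in>UNIV. f w = 0 \<or> w \<in> {}}. winding_number (circlepath b e) p * h p * zorder f p)"
    using nz fin h \<open>e > 0\<close>
    by (intro argument_principle) (auto simp: f_def intro!: holomorphic_intros)
  also have "(\<Sum>p\<in>{w\<in>UNIV. f w = 0 \<or> w \<in> {}}. winding_number (circlepath b e) p * h p * zorder f p)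
      = (\<Sum>p\<in>fibre_roots D A b e x. winding_number (circlepath b e) p * h p * zorder f p)"
  proof (rule sum.mono_neutral_right)
    show "\<forall>i\<in>{w \<in> UNIV. f w = 0 \<or> w \<in> {}} - fibre_roots D A b e x.
       winding_number (circlepath b e) i * h i * zorder f i = 0"
    proof
      fix w assume "w \<in> {w \<in> UNIV. f w = 0 \<or> w \<in> {}} - fibre_roots D A b e x"
      then have "w \<notin> cball b e" using nz[of w] by (auto simp: fibre_roots_def f_def)
      then have "winding_number (circlepath b e) w = 0"
        using \<open>e > 0\<close> by (intro winding_number_zero_outside[of _ "cball b e"]) auto
      then show "winding_number (circlepath b e) w * h w * zorder f w = 0" by simp
    qed
  qed (use fin in \<open>auto simp: fibre_roots_def f_def\<close>)
  also have "\<dots> = power_sum D A b e h x"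
    unfolding power_sum_def
    using fibre_mult_eq(1)[OF nz0] \<open>e > 0\<close>
    by (intro sum.cong refl) (auto simp: fibre_roots_def f_def winding_number_circlepath dist_norm norm_minus_commute)
  finally show ?thesis unfolding deriv_f by (simp add: f_def)
qed


lemma power_sum_eq_integral:
  assumes "e > 0" and "\<forall>y\<in>sphere b e. bieval D A x y \<noteq> 0" and "h holomorphic_on UNIV"
  shows "power_sum D A b e h x = 1 / (2 * pi * \<i>) *
    contour_integral (circlepath b e) (\<lambda>y. bieval D (bdy D A) x y * h y / bieval D A x y)"
  using contour_integral_power_sum[of e b D A x h] assms by simp

text \<open>Single roots need not depend holomorphically on \<open>x\<close>, but the symmetric
  expression is an integral over a circle that stays the same for all \<open>x\<close> and avoids
  the curve, so it can be differentiated under the integral sign.\<close>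

lemma holomorphic_on_power_sum:
  assumes e: "e > 0"
    and nz: "\<forall>x\<in>ball a d. \<forall>y\<in>sphere b e. bieval D A x y \<noteq> 0"
  shows "(\<lambda>x. power_sum D A b e (\<lambda>y. bieval D B x y ^ k) x) holomorphic_on ball a d"
proof -
  define c where "c = circlepath b e"
  define v where "v t = 2 * pi * \<i> * e * exp (2 * pi * \<i> * of_real t)" for t :: real
  have c: "c t \<in> sphere b e" for t
    using e by (simp add: c_def circlepath dist_norm norm_mult)
  have cont_c: "continuous_on S (\<lambda>z. c (f z))" if "continuous_on S f" for S :: "'c::topological_space set" and f
    unfolding c_def circlepath by (intro continuous_intros that)
  have cont_v: "continuous_on S (\<lambda>z. v (f z))" if "continuous_on S f" for S :: "'c::topological_space set" and f
    unfolding v_def by (intro continuous_intros that)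
  define f where "f x t = bieval D (bdy D A) x (c t) * bieval D B x (c t) ^ k / bieval D A x (c t) * v t" for x t
  \<comment> \<open>The derivative of \<open>f x t\<close> in \<open>x\<close>, by the quotient
    rule; its denominator is nonzero because \<open>c t\<close> lies on the circle.\<close>
  define fx where "fx x t = ((bieval D (bdx D (bdy D A)) x (c t) * bieval D B x (c t) ^ k
      + bieval D (bdy D A) x (c t) * (of_nat k * bieval D B x (c t) ^ (k - 1) * bieval D (bdx D B) x (c t)))
        * bieval D A x (c t)
      - bieval D (bdy D A) x (c t) * bieval D B x (c t) ^ k * bieval D (bdx D A) x (c t))
      / (bieval D A x (c t) * bieval D A x (c t)) * v t" for x t
  have hol: "(\<lambda>x. integral (cbox 0 1) (f x)) holomorphic_on ball a d"
  proof (rule leibniz_rule_holomorphic)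
    fix x t assume "x \<in> ball a d"
    then have "bieval D A x (c t) \<noteq> 0" using nz c by blast
    then show "((\<lambda>x. f x t) has_field_derivative fx x t) (at x within ball a d)"
      unfolding f_def fx_def
      by (auto intro!: derivative_eq_intros has_field_derivative_bieval_x simp: algebra_simps)
  next
    fix x assume "x \<in> ball a d"
    then have "bieval D A x (c t) \<noteq> 0" for t using nz c by blast
    then show "f x integrable_on cbox 0 1"
      unfolding f_def by (intro integrable_continuous continuous_intros cont_c cont_v) auto
  next
    show "continuous_on (ball a d \<times> cbox 0 1) (\<lambda>(x, t). fx x t)"
      unfolding fx_def case_prod_unfold using nz c
      by (intro continuous_intros cont_c cont_v) auto
  qed simp
  have "power_sum D A b e (\<lambda>y. bieval D B x y ^ k) x = 1 / (2 * pi * \<i>) * integral (cbox 0 1) (f x)"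
    if "x \<in> ball a d" for x
  proof -
    have "power_sum D A b e (\<lambda>y. bieval D B x y ^ k) x = 1 / (2 * pi * \<i>) *
      contour_integral (circlepath b e) (\<lambda>y. bieval D (bdy D A) x y * bieval D B x y ^ k / bieval D A x y)"
      using nz that e by (intro power_sum_eq_integral holomorphic_intros) auto
    also have "contour_integral (circlepath b e)
        (\<lambda>y. bieval D (bdy D A) x y * bieval D B x y ^ k / bieval D A x y) = integral (cbox 0 1) (f x)"
      unfolding contour_integral_integral f_def c_def v_def
      by (simp add: vector_derivative_circlepath)
    finally show ?thesis .
  qed
  moreover have "(\<lambda>x. 1 / (2 * pi * \<i>) * integral (cbox 0 1) (f x)) holomorphic_on ball a d"
    by (intro holomorphic_on_mult holomorphic_on_const hol)
  ultimately show ?thesis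
    by (rule holomorphic_transform[rotated, OF sym])
qed

lemma uniform_limit_power:
  fixes f :: "'a \<Rightarrow> 'b \<Rightarrow> complex"
  assumes "uniform_limit S f l F" "bounded (l ` S)"
  shows "uniform_limit S (\<lambda>n x. f n x ^ k) (\<lambda>x. l x ^ k) F"
proof (induction k)
  case (Suc k)
  have "bounded ((\<lambda>x. l x ^ k) ` S)"
  proof -
    from assms(2) obtain M where "\<And>x. x \<in> S \<Longrightarrow> norm (l x) \<le> M" by (auto simp: bounded_iff)
    then have "norm (l x ^ k) \<le> M ^ k" if "x \<in> S" for x
      using that by (auto simp: norm_power intro: power_mono)
    then show ?thesis by (auto simp: bounded_iff)
  qed
  then show ?case using uniform_lim_mult[OF assms(1) Suc assms(2)] by simp
qed (auto intro: uniform_limit_const)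

text \<open>The limit polynomial attains a positive minimum of its norm on the compact set, and
  uniform convergence preserves half of it. The common bound \<open>c\<close> is what allows passing
  to limits in quotients.\<close>

lemma eventually_bieval_nonzero:
  assumes A: "coeffs_tendsto A A'"
    and nz: "\<And>z. z \<in> S \<Longrightarrow> bieval D A' (f z) (g z) \<noteq> 0"
    and S: "compact S" "continuous_on S f" "continuous_on S g"
  shows "\<exists>c>0. (\<forall>z\<in>S. c \<le> norm (bieval D A' (f z) (g z))) \<and>
    (\<forall>\<^sub>F n in sequentially. \<forall>z\<in>S. c \<le> norm (bieval D (A n) (f z) (g z)))"
proof (cases "S = {}")
  case False
  obtain z0 where z0: "z0 \<in> S" "\<And>z. z \<in> S \<Longrightarrow> norm (bieval D A' (f z0) (g z0)) \<le> norm (bieval D A' (f z) (g z))"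
  proof -
    have "continuous_on S (\<lambda>z. norm (bieval D A' (f z) (g z)))" by (intro continuous_intros S)
    from continuous_attains_inf[OF S(1) False this] that show thesis by blast
  qed
  define c where "c = norm (bieval D A' (f z0) (g z0))"
  have "c > 0" using nz[OF z0(1)] by (simp add: c_def)
  obtain R1 where R1: "\<And>z. z \<in> S \<Longrightarrow> norm (f z) \<le> R1"
    using compact_imp_bounded[OF compact_continuous_image[OF S(2,1)]] by (auto simp: bounded_iff)
  obtain R2 where R2: "\<And>z. z \<in> S \<Longrightarrow> norm (g z) \<le> R2"
    using compact_imp_bounded[OF compact_continuous_image[OF S(3,1)]] by (auto simp: bounded_iff)
  have "uniform_limit S (\<lambda>n z. bieval D (A n) (f z) (g z)) (\<lambda>z. bieval D A' (f z) (g z)) sequentially"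
    using R1 R2 A by (intro uniform_limit_bieval[where R = "max R1 R2"]) (auto simp: le_max_iff_disj)
  then have "\<forall>\<^sub>F n in sequentially. \<forall>z\<in>S. dist (bieval D (A n) (f z) (g z)) (bieval D A' (f z) (g z)) < c / 2"
    using \<open>c > 0\<close> by (intro uniform_limitD) auto
  then have "\<forall>\<^sub>F n in sequentially. \<forall>z\<in>S. c / 2 \<le> norm (bieval D (A n) (f z) (g z))"
  proof eventually_elim
    case (elim n)
    show ?case
    proof
      fix z assume z: "z \<in> S"
      have "c \<le> norm (bieval D A' (f z) (g z))" using z0(2)[OF z] by (simp add: c_def)
      moreover have "norm (bieval D (A n) (f z) (g z) - bieval D A' (f z) (g z)) < c / 2"
        using elim z by (auto simp: dist_norm)
      ultimately show "c / 2 \<le> norm (bieval D (A n) (f z) (g z))"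
        using norm_triangle_ineq3[of "bieval D (A n) (f z) (g z)" "bieval D A' (f z) (g z)"] by linarith
    qed
  qed
  moreover have "\<forall>z\<in>S. c / 2 \<le> norm (bieval D A' (f z) (g z))"
    using z0(2) \<open>c > 0\<close> unfolding c_def by (smt (verit) field_sum_of_halves)
  ultimately show ?thesis using \<open>c > 0\<close> half_gt_zero by blast
qed (auto intro: exI[of _ 1])

text \<open>The integrands of the contour integrals converge uniformly on the circle, the
  denominators being bounded away from 0 there.\<close>

lemma tendsto_power_sum:
  assumes e: "e > 0"
    and A: "coeffs_tendsto A A'" and B: "coeffs_tendsto B B'"
    and nz: "\<forall>y\<in>sphere b e. bieval D A' x y \<noteq> 0"
  shows "(\<lambda>n. power_sum D (A n) b e (\<lambda>y. bieval D (B n) x y ^ k) x)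
    \<longlonglongrightarrow> power_sum D A' b e (\<lambda>y. bieval D B' x y ^ k) x"
proof -
  let ?S = "sphere b e"
  obtain c where c: "c > 0" "\<And>y. y \<in> ?S \<Longrightarrow> c \<le> norm (bieval D A' x y)"
    and ev: "\<forall>\<^sub>F n in sequentially. \<forall>y\<in>?S. c \<le> norm (bieval D (A n) x y)"
    using eventually_bieval_nonzero[OF A, where S = ?S and f = "\<lambda>_. x" and g = "\<lambda>y. y" and D = D] nz by auto
  have ev0: "\<forall>\<^sub>F n in sequentially. \<forall>y\<in>?S. bieval D (A n) x y \<noteq> 0"
    using ev by eventually_elim (use c(1) in force)
  have bdd: "bounded ((\<lambda>y. bieval D C x y) ` ?S)" for C
    by (intro compact_imp_bounded compact_continuous_image continuous_intros) auto
  have R: "norm y \<le> max (norm x) (norm b + e)" if "y \<in> ?S" for y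
    using that norm_triangle_ineq2[of y b] by (auto simp: dist_norm norm_minus_commute)
  have U: "uniform_limit ?S (\<lambda>n y. bieval D (C n) x y) (\<lambda>y. bieval D C' x y) sequentially"
    if "coeffs_tendsto C C'" for C C'
    using R that by (intro uniform_limit_bieval[where R = "max (norm x) (norm b + e)"]) auto
  have dA: "\<forall>i j. (\<lambda>n. bdy D (A n) i j) \<longlonglongrightarrow> bdy D A' i j"
    using A unfolding bdy_def by (auto intro!: tendsto_intros)
  have bdp: "bounded ((\<lambda>y. bieval D B' x y ^ k) ` ?S)" "bounded ((\<lambda>y. bieval D (bdy D A') x y * bieval D B' x y ^ k) ` ?S)"
    by (intro compact_imp_bounded compact_continuous_image continuous_intros; simp)+
  have "uniform_limit ?S (\<lambda>n y. bieval D (bdy D (A n)) x y * bieval D (B n) x y ^ k / bieval D (A n) x y)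
      (\<lambda>y. bieval D (bdy D A') x y * bieval D B' x y ^ k / bieval D A' x y) sequentially"
    by (intro uniform_lim_divide[where b = c] uniform_lim_mult uniform_limit_power U A B dA bdd bdp c)
  then have "(\<lambda>n. contour_integral (circlepath b e)
        (\<lambda>y. bieval D (bdy D (A n)) x y * bieval D (B n) x y ^ k / bieval D (A n) x y))
     \<longlonglongrightarrow> contour_integral (circlepath b e)
        (\<lambda>y. bieval D (bdy D A') x y * bieval D B' x y ^ k / bieval D A' x y)"
  proof (rule contour_integral_uniform_limit_circlepath(2)[rotated])
    show "\<forall>\<^sub>F n in sequentially. (\<lambda>y. bieval D (bdy D (A n)) x y * bieval D (B n) x y ^ k / bieval D (A n) x y)
        contour_integrable_on circlepath b e"
      using ev0
    proof eventually_elim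
      case (elim n)
      then show ?case using e
        by (intro contour_integrable_continuous_circlepath continuous_intros) auto
    qed
  qed (use e in auto)
  then have "(\<lambda>n. 1 / (2 * pi * \<i>) * contour_integral (circlepath b e)
        (\<lambda>y. bieval D (bdy D (A n)) x y * bieval D (B n) x y ^ k / bieval D (A n) x y))
     \<longlonglongrightarrow> power_sum D A' b e (\<lambda>y. bieval D B' x y ^ k) x"
    using nz e by (subst power_sum_eq_integral) (auto intro!: tendsto_intros holomorphic_intros)
  moreover have "\<forall>\<^sub>F n in sequentially. 1 / (2 * pi * \<i>) * contour_integral (circlepath b e)
        (\<lambda>y. bieval D (bdy D (A n)) x y * bieval D (B n) x y ^ k / bieval D (A n) x y)
      = power_sum D (A n) b e (\<lambda>y. bieval D (B n) x y ^ k) x"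
    using ev0
  proof eventually_elim
    case (elim n)
    then show ?case by (intro power_sum_eq_integral[symmetric] holomorphic_intros e)
  qed
  ultimately show ?thesis by (rule Lim_transform_eventually)
qed

section \<open>From power sums to the norm: dependence on \<open>x\<close> and on the
  coefficients\<close>

definition fibre_degree where
  "fibre_degree D A b e x = (\<Sum>w\<in>fibre_roots D A b e x. fibre_mult D A x w)"

text \<open>The reversed characteristic polynomial of the values of \<open>B\<close> on the fibre.
  Kept as a power series, it yields its coefficients one after another from Newton's recursion, and
  its top coefficient is the norm up to sign.\<close>

definition fibre_fps where
  "fibre_fps D A B b e x = (\<Prod>w\<in>fibre_roots D A b e x. (1 - fps_const (bieval D B x w) * fps_X) ^ fibre_mult D A x w)"

lemma finite_fibre_roots:
  assumes "e > 0" "\<forall>y\<in>sphere b e. bieval D A x y \<noteq> 0"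
  shows "finite (fibre_roots D A b e x)"
proof -
  have "b + of_real e \<in> sphere b e" using \<open>e > 0\<close> by (simp add: dist_norm)
  with assms(2) have "bieval D A x (b + of_real e) \<noteq> 0" by blast
  from finite_bieval_zeros[OF this] show ?thesis
    by (rule finite_subset[rotated]) (auto simp: fibre_roots_def)
qed

text \<open>The root count is the zeroth power sum, whatever \<open>B\<close> is. The exponent
  \<open>0\<close> is written out so that the results on power sums of \<open>B\<close> apply
  literally.\<close>

lemma fibre_degree_eq: "of_nat (fibre_degree D A b e x) = power_sum D A b e (\<lambda>y. bieval D B x y ^ 0) x"
  by (simp add: fibre_degree_def power_sum_def)

lemma fibre_norm_eq:
  assumes "e > 0" "\<forall>y\<in>sphere b e. bieval D A x y \<noteq> 0"
  shows "fibre_norm D A B b e x = (-1) ^ fibre_degree D A b e x * fps_nth (fibre_fps D A B b e x) (fibre_degree D A b e x)"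
  using fps_nth_prod_linear_top[OF finite_fibre_roots[OF assms], where g = "bieval D B x" and \<mu> = "fibre_mult D A x"]
  by (simp add: fibre_norm_def fibre_degree_def fibre_fps_def mult.assoc[symmetric] flip: power_mult_distrib)

lemma fibre_fps_nth_0: "fps_nth (fibre_fps D A B b e x) 0 = 1"
proof -
  have "fps_nth (\<Prod>w\<in>Z. (1 - fps_const (g w) * fps_X) ^ \<mu> w) 0 = (1::complex)" for Z g \<mu>
    by (induction Z rule: infinite_finite_induct) (simp_all add: fps_nth_power_0)
  then show ?thesis by (simp add: fibre_fps_def)
qed

lemma fibre_fps_nth_Suc:
  assumes "e > 0" "\<forall>y\<in>sphere b e. bieval D A x y \<noteq> 0"
  shows "fps_nth (fibre_fps D A B b e x) (Suc k) =
    - (\<Sum>i\<le>k. fps_nth (fibre_fps D A B b e x) i *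
         power_sum D A b e (\<lambda>y. bieval D B x y ^ (Suc k - i)) x) / of_nat (Suc k)"
  unfolding fibre_fps_def power_sum_def
  by (rule fps_nth_prod_linear_rec[OF finite_fibre_roots[OF assms]])

text \<open>Strong induction along Newton's recursion: each coefficient is a polynomial in earlier
  ones and in power sums.\<close>

lemma holomorphic_on_fibre_fps_nth:
  assumes e: "e > 0"
    and nz: "\<forall>x\<in>ball a d. \<forall>y\<in>sphere b e. bieval D A x y \<noteq> 0"
  shows "(\<lambda>x. fps_nth (fibre_fps D A B b e x) k) holomorphic_on ball a d"
proof (induction k rule: less_induct)
  case (less k)
  show ?case
  proof (cases k)
    case (Suc l)
    have "(\<lambda>x. - (\<Sum>i\<le>l. fps_nth (fibre_fps D A B b e x) i *
         power_sum D A b e (\<lambda>y. bieval D B x y ^ (Suc l - i)) x) / of_nat (Suc l)) holomorphic_on ball a d"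
      using less Suc by (intro holomorphic_intros holomorphic_on_power_sum e nz) (auto simp del: of_nat_Suc)
    then show ?thesis unfolding Suc
    proof (rule holomorphic_transform)
      fix x assume "x \<in> ball a d"
      with nz have "\<forall>y\<in>sphere b e. bieval D A x y \<noteq> 0" by blast
      from fibre_fps_nth_Suc[OF e this, of B l]
      show "- (\<Sum>i\<le>l. fps_nth (fibre_fps D A B b e x) i *
         power_sum D A b e (\<lambda>y. bieval D B x y ^ (Suc l - i)) x) / of_nat (Suc l)
        = fps_nth (fibre_fps D A B b e x) (Suc l)" by (rule sym)
    qed
  qed (simp add: fibre_fps_nth_0)
qed

text \<open>The same induction with limits. The recursion for the approximating curves is valid only
  where they miss the circle, hence eventually.\<close>

lemma tendsto_fibre_fps_nth:
  assumes e: "e > 0"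
    and A: "coeffs_tendsto A A'" and B: "coeffs_tendsto B B'"
    and nz: "\<forall>y\<in>sphere b e. bieval D A' x y \<noteq> 0"
    and nz': "\<forall>\<^sub>F n in sequentially. \<forall>y\<in>sphere b e. bieval D (A n) x y \<noteq> 0"
  shows "(\<lambda>n. fps_nth (fibre_fps D (A n) (B n) b e x) k) \<longlonglongrightarrow> fps_nth (fibre_fps D A' B' b e x) k"
proof (induction k rule: less_induct)
  case (less k)
  show ?case
  proof (cases k)
    case (Suc l)
    have "(\<lambda>n. - (\<Sum>i\<le>l. fps_nth (fibre_fps D (A n) (B n) b e x) i *
         power_sum D (A n) b e (\<lambda>y. bieval D (B n) x y ^ (Suc l - i)) x) / of_nat (Suc l))
       \<longlonglongrightarrow> - (\<Sum>i\<le>l. fps_nth (fibre_fps D A' B' b e x) i *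
         power_sum D A' b e (\<lambda>y. bieval D B' x y ^ (Suc l - i)) x) / of_nat (Suc l)"
      using less Suc by (intro tendsto_intros tendsto_power_sum e nz A B) (auto simp del: of_nat_Suc)
    moreover have "\<forall>\<^sub>F n in sequentially. - (\<Sum>i\<le>l. fps_nth (fibre_fps D (A n) (B n) b e x) i *
         power_sum D (A n) b e (\<lambda>y. bieval D (B n) x y ^ (Suc l - i)) x) / of_nat (Suc l)
       = fps_nth (fibre_fps D (A n) (B n) b e x) (Suc l)"
      using nz' by eventually_elim (rule fibre_fps_nth_Suc[OF e, symmetric])
    ultimately show ?thesis unfolding Suc fibre_fps_nth_Suc[OF e nz]
      by (rule Lim_transform_eventually)
  qed (simp add: fibre_fps_nth_0)
qed

text \<open>The root count is continuous in \<open>x\<close>, being a power sum, and distinct values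
  of it differ by at least 1; on a connected set it is constant.\<close>

lemma fibre_degree_constant:
  assumes e: "e > 0"
    and nz: "\<forall>x\<in>ball a d. \<forall>y\<in>sphere b e. bieval D A x y \<noteq> 0"
    and "x \<in> ball a d" "x' \<in> ball a d"
  shows "fibre_degree D A b e x = fibre_degree D A b e x'"
proof -
  have "(\<lambda>x. of_nat (fibre_degree D A b e x) :: complex) holomorphic_on ball a d"
    unfolding fibre_degree_eq[of D A b e _ A] by (intro holomorphic_on_power_sum e nz)
  then have "continuous_on (ball a d) (\<lambda>x. of_nat (fibre_degree D A b e x) :: complex)"
    by (rule holomorphic_on_imp_continuous_on)
  moreover have "\<exists>e>0. \<forall>y. y \<in> ball a d \<and> of_nat (fibre_degree D A b e' y) \<noteq> (of_nat (fibre_degree D A b e' x) :: complex) \<longrightarrow>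
      e \<le> norm (of_nat (fibre_degree D A b e' y) - (of_nat (fibre_degree D A b e' x) :: complex))" for x e'
  proof (rule exI[of _ 1], intro conjI allI impI)
    fix y assume y: "y \<in> ball a d \<and> of_nat (fibre_degree D A b e' y) \<noteq> (of_nat (fibre_degree D A b e' x) :: complex)"
    have "of_nat m - of_nat n = (of_int (int m - int n) :: complex)" for m n by simp
    then have "norm (of_nat m - of_nat n :: complex) = real_of_int \<bar>int m - int n\<bar>" for m n
      by (metis norm_of_int of_int_abs)
    then show "1 \<le> norm (of_nat (fibre_degree D A b e' y) - (of_nat (fibre_degree D A b e' x) :: complex))"
      using y by simp linarith
  qed simp
  ultimately have "(\<lambda>x. of_nat (fibre_degree D A b e x) :: complex) constant_on ball a d"
    by (intro continuous_discrete_range_constant) auto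
  then obtain c where "\<And>x. x \<in> ball a d \<Longrightarrow> of_nat (fibre_degree D A b e x) = (c :: complex)"
    unfolding constant_on_def by blast
  with assms(3,4) have "of_nat (fibre_degree D A b e x) = (of_nat (fibre_degree D A b e x') :: complex)" by metis
  then show ?thesis by (simp only: of_nat_eq_iff)
qed

text \<open>A convergent sequence of integers is eventually equal to its limit.\<close>

lemma tendsto_fibre_degree:
  assumes e: "e > 0"
    and A: "coeffs_tendsto A A'"
    and nz: "\<forall>y\<in>sphere b e. bieval D A' x y \<noteq> 0"
  shows "\<forall>\<^sub>F n in sequentially. fibre_degree D (A n) b e x = fibre_degree D A' b e x"
proof -
  have "(\<lambda>n. of_nat (fibre_degree D (A n) b e x) :: complex) \<longlonglongrightarrow> of_nat (fibre_degree D A' b e x)"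
    unfolding fibre_degree_eq[of D _ b e x A'] 
    using tendsto_power_sum[OF e A _ nz, of "\<lambda>_. A'" A' 0] by simp
  then have "(\<lambda>n. real (fibre_degree D (A n) b e x)) \<longlonglongrightarrow> real (fibre_degree D A' b e x)"
    by (auto dest: tendsto_Re)
  then have "\<forall>\<^sub>F n in sequentially. dist (real (fibre_degree D (A n) b e x)) (real (fibre_degree D A' b e x)) < 1"
    by (rule tendstoD) simp
  then show ?thesis by eventually_elim (auto simp: dist_real_def)
qed

text \<open>Since the root count is constant on the disc, the norm is, up to a fixed sign, the
  coefficient of one fixed index \<open>P\<close>.\<close>

lemma holomorphic_on_fibre_norm:
  assumes e: "e > 0"
    and nz: "\<forall>x\<in>ball a d. \<forall>y\<in>sphere b e. bieval D A x y \<noteq> 0"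
  shows "fibre_norm D A B b e holomorphic_on ball a d"
proof (cases "d > 0")
  case True
  define P where "P = fibre_degree D A b e a"
  have "(\<lambda>x. (-1) ^ P * fps_nth (fibre_fps D A B b e x) P) holomorphic_on ball a d"
    by (intro holomorphic_intros holomorphic_on_fibre_fps_nth e nz)
  then show ?thesis
  proof (rule holomorphic_transform)
    fix x assume "x \<in> ball a d"
    then have "fibre_degree D A b e x = P"
      unfolding P_def by (intro fibre_degree_constant[OF e nz]) (use True in auto)
    then show "(-1) ^ P * fps_nth (fibre_fps D A B b e x) P = fibre_norm D A B b e x"
      using fibre_norm_eq[OF e, of b D A x B] nz \<open>x \<in> ball a d\<close> by simp
  qed
qed (simp add: ball_empty holomorphic_on_def)

lemma tendsto_fibre_norm:
  assumes e: "e > 0"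
    and A: "coeffs_tendsto A A'" and B: "coeffs_tendsto B B'"
    and nz: "\<forall>y\<in>sphere b e. bieval D A' x y \<noteq> 0"
    and nz': "\<forall>\<^sub>F n in sequentially. \<forall>y\<in>sphere b e. bieval D (A n) x y \<noteq> 0"
  shows "(\<lambda>n. fibre_norm D (A n) (B n) b e x) \<longlonglongrightarrow> fibre_norm D A' B' b e x"
proof -
  define P where "P = fibre_degree D A' b e x"
  have "(\<lambda>n. (-1) ^ P * fps_nth (fibre_fps D (A n) (B n) b e x) P) \<longlonglongrightarrow> fibre_norm D A' B' b e x"
    unfolding fibre_norm_eq[OF e nz] P_def[symmetric]
    by (intro tendsto_intros tendsto_fibre_fps_nth[OF e A B nz nz'])
  moreover have "\<forall>\<^sub>F n in sequentially. (-1) ^ P * fps_nth (fibre_fps D (A n) (B n) b e x) P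
      = fibre_norm D (A n) (B n) b e x"
    using nz' tendsto_fibre_degree[OF e A nz]
    by eventually_elim (simp add: fibre_norm_eq[OF e] P_def)
  ultimately show ?thesis by (rule Lim_transform_eventually)
qed

text \<open>All values of \<open>B\<close> on the disc have norm at most 1, so dropping the roots
  outside \<open>W\<close> and lowering the multiplicities on \<open>W\<close> to 1 can only enlarge
  the product. With \<open>W\<close> empty this gives the bound 1.\<close>

lemma fibre_norm_bound:
  assumes "e > 0" "\<forall>y\<in>sphere b e. bieval D A x y \<noteq> 0"
    and "\<And>y. y \<in> ball b e \<Longrightarrow> norm (bieval D B x y) \<le> 1"
    and W: "W \<subseteq> fibre_roots D A b e x"
  shows "norm (fibre_norm D A B b e x) \<le> (\<Prod>w\<in>W. norm (bieval D B x w))"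
proof -
  note fin = finite_fibre_roots[OF assms(1,2)]
  have "b + of_real e \<in> sphere b e" using \<open>e > 0\<close> by (simp add: dist_norm)
  with assms(2) have nz0: "bieval D A x (b + of_real e) \<noteq> 0" by blast
  have "norm (fibre_norm D A B b e x) = (\<Prod>w\<in>fibre_roots D A b e x. norm (bieval D B x w) ^ fibre_mult D A x w)"
    by (simp add: fibre_norm_def norm_power flip: prod_norm)
  also have "\<dots> \<le> (\<Prod>w\<in>fibre_roots D A b e x. if w \<in> W then norm (bieval D B x w) else 1)"
  proof (intro prod_mono conjI)
    fix w assume w: "w \<in> fibre_roots D A b e x"
    then have le: "norm (bieval D B x w) \<le> 1" and pos: "fibre_mult D A x w > 0"
      using assms(3) fibre_mult_eq(2)[OF nz0] by (auto simp: fibre_roots_def)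
    show "norm (bieval D B x w) ^ fibre_mult D A x w \<le> (if w \<in> W then norm (bieval D B x w) else 1)"
      using power_decreasing[of 1 "fibre_mult D A x w" "norm (bieval D B x w)"] pos le
      by (auto intro: power_le_one)
  qed auto
  also have "\<dots> = (\<Prod>w\<in>W. norm (bieval D B x w))"
    using fin W by (subst prod.inter_restrict[symmetric]) (auto intro!: prod.cong)
  finally show ?thesis .
qed


section \<open>Zeros of bounded holomorphic functions\<close>

text \<open>Zeros are given as growth bounds and divided out one point at a time. The factors of the
  other points do not vanish at \<open>\<xi>\<close>, so the quotient by the power of
  \<open>x - \<xi>\<close> stays bounded near \<open>\<xi>\<close> and extends by Riemann's
  theorem.\<close>

lemma holomorphic_divide_out_zeros:
  assumes "finite X" "X \<subseteq> U" "open U" and f: "f holomorphic_on U"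
    and "\<And>\<xi>. \<xi> \<in> X \<Longrightarrow> \<exists>C. \<forall>\<^sub>F x in at \<xi>. norm (f x) \<le> C * norm (x - \<xi>) ^ M \<xi>"
  shows "\<exists>h. h holomorphic_on U \<and> (\<forall>x\<in>U. f x = (\<Prod>\<xi>\<in>X. (x - \<xi>) ^ M \<xi>) * h x)"
  using assms(1,2,5)
proof induction
  case empty
  show ?case using f by (intro exI[of _ f]) auto
next
  case (insert \<xi> X)
  then obtain h where h: "h holomorphic_on U" "\<And>x. x \<in> U \<Longrightarrow> f x = (\<Prod>\<xi>\<in>X. (x - \<xi>) ^ M \<xi>) * h x"
    by auto
  define P where "P x = (\<Prod>\<xi>\<in>X. (x - \<xi>) ^ M \<xi>)" for x
  have P\<xi>: "P \<xi> \<noteq> 0" using insert.hyps by (auto simp: P_def)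
  have "\<xi> \<in> U" using insert.prems by auto
  obtain C where C: "\<forall>\<^sub>F x in at \<xi>. norm (f x) \<le> C * norm (x - \<xi>) ^ M \<xi>" using insert.prems by blast
  have contP: "isCont P \<xi>" unfolding P_def by (intro continuous_intros)
  then have "\<forall>\<^sub>F x in at \<xi>. dist (P x) (P \<xi>) < norm (P \<xi>) / 2"
    using P\<xi> by (intro tendstoD) (auto simp: isCont_def)
  moreover have U: "\<forall>\<^sub>F x in at \<xi>. x \<in> U - {\<xi>}"
    using \<open>open U\<close> \<open>\<xi> \<in> U\<close> by (rule eventually_at_in_open)
  ultimately have "\<forall>\<^sub>F x in at \<xi>. norm (h x / (x - \<xi>) ^ M \<xi>) \<le> 2 * C / norm (P \<xi>)"
    using C
  proof eventually_elim
    case (elim x)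
    have "norm (P \<xi>) / 2 \<le> norm (P x)"
      using elim(1) norm_triangle_ineq3[of "P x" "P \<xi>"] by (auto simp: dist_norm)
    then have "norm (P \<xi>) / 2 * norm (h x) \<le> norm (P x) * norm (h x)"
      by (intro mult_right_mono) auto
    also have "\<dots> = norm (f x)" using h(2)[of x] elim by (simp add: norm_mult P_def)
    also have "\<dots> \<le> C * norm (x - \<xi>) ^ M \<xi>" by (rule elim)
    finally have "norm (h x) * norm (P \<xi>) \<le> 2 * C * norm (x - \<xi>) ^ M \<xi>" by (simp add: mult_ac)
    then show ?case using P\<xi> elim by (simp add: norm_divide norm_power field_simps)
  qed
  moreover have "(\<lambda>x. h x / (x - \<xi>) ^ M \<xi>) holomorphic_on U - {\<xi>}"
    using h(1) by (intro holomorphic_intros) (auto intro: holomorphic_on_subset)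
  ultimately obtain g where g: "g holomorphic_on U" "\<forall>x\<in>U - {\<xi>}. g x = h x / (x - \<xi>) ^ M \<xi>"
    using holomorphic_on_extend_bounded[of "\<lambda>x. h x / (x - \<xi>) ^ M \<xi>" U \<xi>] \<open>open U\<close> \<open>\<xi> \<in> U\<close>
    by (auto simp: interior_open)
  \<comment> \<open>The extension is known to be the quotient only off \<open>\<xi>\<close>; at
    \<open>\<xi>\<close> the factorization follows by continuity.\<close>
  have eq: "h x = (x - \<xi>) ^ M \<xi> * g x" if "x \<in> U" for x
  proof (cases "x = \<xi>")
    case True
    have "((\<lambda>x. (x - \<xi>) ^ M \<xi> * g x) \<longlongrightarrow> (\<xi> - \<xi>) ^ M \<xi> * g \<xi>) (at \<xi>)"
      using g(1) \<open>open U\<close> \<open>\<xi> \<in> U\<close>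
      by (intro tendsto_intros) (auto simp: isCont_def[symmetric] continuous_on_eq_continuous_at
          dest: holomorphic_on_imp_continuous_on)
    moreover have "\<forall>\<^sub>F x in at \<xi>. (x - \<xi>) ^ M \<xi> * g x = h x"
      using U by eventually_elim (use g(2) in auto)
    ultimately have "(h \<longlongrightarrow> (\<xi> - \<xi>) ^ M \<xi> * g \<xi>) (at \<xi>)" by (rule Lim_transform_eventually)
    moreover have "(h \<longlongrightarrow> h \<xi>) (at \<xi>)"
      using h(1) \<open>open U\<close> \<open>\<xi> \<in> U\<close>
      by (auto simp: isCont_def[symmetric] continuous_on_eq_continuous_at dest: holomorphic_on_imp_continuous_on)
    ultimately show ?thesis using True tendsto_unique[OF trivial_limit_at] by blast
  qed (use g that in auto)
  show ?case
    using insert.hyps h(2) eq g(1) by (intro exI[of _ g]) (auto simp: mult_ac)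
qed

text \<open>Schwarz's lemma with several zeros: the maximum principle on the disc of radius
  \<open>d / 2\<close> bounds the quotient of \<open>f\<close> by its zero factors. The result
  involves neither the constants in the growth bounds nor the position of the zeros within the
  quarter disc, beyond the factors themselves.\<close>

lemma schwarz_bound:
  assumes "finite X" and X: "X \<subseteq> ball a (d / 4)" and f: "f holomorphic_on ball a d"
    and le1: "\<And>x. x \<in> ball a d \<Longrightarrow> norm (f x) \<le> 1"
    and "\<And>\<xi>. \<xi> \<in> X \<Longrightarrow> \<exists>C. \<forall>\<^sub>F x in at \<xi>. norm (f x) \<le> C * norm (x - \<xi>) ^ M \<xi>"
    and x: "x \<in> ball a (d / 2)"
  shows "norm (f x) \<le> (\<Prod>\<xi>\<in>X. (4 / d * norm (x - \<xi>)) ^ M \<xi>)"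
proof -
  have "d > 0" using x zero_le_dist[of a x] unfolding mem_ball by linarith
  have "X \<subseteq> ball a d" using X \<open>d > 0\<close> by (auto simp: subset_iff)
  then have "\<exists>h. h holomorphic_on ball a d \<and> (\<forall>x\<in>ball a d. f x = (\<Prod>\<xi>\<in>X. (x - \<xi>) ^ M \<xi>) * h x)"
    by (rule holomorphic_divide_out_zeros[OF \<open>finite X\<close> _ open_ball f]) (rule assms(5))
  then obtain h where h: "h holomorphic_on ball a d"
      "\<And>x. x \<in> ball a d \<Longrightarrow> f x = (\<Prod>\<xi>\<in>X. (x - \<xi>) ^ M \<xi>) * h x"
    by blast
  have "norm (h x) \<le> (\<Prod>\<xi>\<in>X. (4 / d) ^ M \<xi>)"
  proof (rule maximum_modulus_frontier[where S = "cball a (d / 2)" and f = h and \<xi> = x])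
    have sub: "cball a (d / 2) \<subseteq> ball a d" using \<open>d > 0\<close> by auto
    show "h holomorphic_on interior (cball a (d / 2))"
      by (rule holomorphic_on_subset[OF h(1)]) (use sub in auto)
    show "continuous_on (closure (cball a (d / 2))) h"
      using continuous_on_subset[OF holomorphic_on_imp_continuous_on[OF h(1)] sub] by simp
    show "x \<in> cball a (d / 2)" using x by auto
    fix y assume "y \<in> frontier (cball a (d / 2))"
    then have y: "dist a y = d / 2" using \<open>d > 0\<close> by (auto simp: frontier_cball)
    \<comment> \<open>A point at distance \<open>d / 2\<close> from \<open>a\<close> is at least
      \<open>d / 2 - d / 4 = d / 4\<close> away from every zero; this is the origin of the factor
      \<open>4 / d\<close>.\<close>
    have ge: "(\<Prod>\<xi>\<in>X. (d / 4) ^ M \<xi>) \<le> norm (\<Prod>\<xi>\<in>X. (y - \<xi>) ^ M \<xi>)"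
      unfolding prod_norm[symmetric]
    proof (intro prod_mono conjI)
      fix \<xi> assume "\<xi> \<in> X"
      then have "dist a \<xi> < d / 4" using X by auto
      moreover have "dist a y \<le> dist a \<xi> + dist \<xi> y" by (rule dist_triangle)
      ultimately have "d / 4 \<le> norm (y - \<xi>)" using y by (simp add: dist_norm norm_minus_commute)
      then show "(d / 4) ^ M \<xi> \<le> norm ((y - \<xi>) ^ M \<xi>)"
        using \<open>d > 0\<close> by (auto simp: norm_power intro!: power_mono)
    qed (use \<open>d > 0\<close> in auto)
    have yd: "y \<in> ball a d" using y \<open>d > 0\<close> by auto
    have "(\<Prod>\<xi>\<in>X. (d / 4) ^ M \<xi>) * norm (h y) \<le> norm (\<Prod>\<xi>\<in>X. (y - \<xi>) ^ M \<xi>) * norm (h y)"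
      using ge by (intro mult_right_mono) auto
    also have "\<dots> = norm (f y)" using h(2)[OF yd] by (simp add: norm_mult)
    also have "\<dots> \<le> 1" using le1 yd by auto
    finally have *: "(\<Prod>\<xi>\<in>X. (d / 4) ^ M \<xi>) * norm (h y) \<le> 1" .
    have "(\<Prod>\<xi>\<in>X. (4 / d) ^ M \<xi>) * (\<Prod>\<xi>\<in>X. (d / 4) ^ M \<xi>) = 1"
      unfolding prod.distrib[symmetric] power_mult_distrib[symmetric] using \<open>d > 0\<close> by simp
    then have "norm (h y) = (\<Prod>\<xi>\<in>X. (4 / d) ^ M \<xi>) * ((\<Prod>\<xi>\<in>X. (d / 4) ^ M \<xi>) * norm (h y))"
      by (simp only: mult.assoc[symmetric] mult_1)
    also have "\<dots> \<le> (\<Prod>\<xi>\<in>X. (4 / d) ^ M \<xi>) * 1"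
      using * \<open>d > 0\<close> by (intro mult_left_mono prod_nonneg) auto
    finally show "norm (h y) \<le> (\<Prod>\<xi>\<in>X. (4 / d) ^ M \<xi>)" by simp
  qed auto
  then have "norm (\<Prod>\<xi>\<in>X. (x - \<xi>) ^ M \<xi>) * norm (h x) \<le> norm (\<Prod>\<xi>\<in>X. (x - \<xi>) ^ M \<xi>) * (\<Prod>\<xi>\<in>X. (4 / d) ^ M \<xi>)"
    by (intro mult_left_mono) auto
  moreover have "x \<in> ball a d" using x \<open>d > 0\<close> by auto
  moreover have "(\<Prod>\<xi>\<in>X. (4 / d * norm (x - \<xi>)) ^ M \<xi>)
      = norm (\<Prod>\<xi>\<in>X. (x - \<xi>) ^ M \<xi>) * (\<Prod>\<xi>\<in>X. (4 / d) ^ M \<xi>)"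
    by (simp only: power_mult_distrib prod.distrib norm_power prod_norm[symmetric] mult.commute)
  ultimately show ?thesis using h(2)[of x] by (simp only: norm_mult)
qed

lemma holomorphic_linear_bound:
  assumes "f holomorphic_on S" "open S" "0 \<in> S" "f 0 = 0"
  shows "\<exists>c>0. \<forall>\<^sub>F w in nhds 0. norm (f w :: complex) \<le> c * norm w"
proof -
  from assms obtain f' where "(f has_field_derivative f') (at 0)"
    using holomorphic_derivI by blast
  then have "((\<lambda>w. f w / w) \<longlongrightarrow> f') (at 0)" using assms(4) by (simp add: has_field_derivative_iff)
  then have "\<forall>\<^sub>F w in at 0. dist (f w / w) f' < 1" by (rule tendstoD) simp
  then have "\<forall>\<^sub>F w in at 0. norm (f w) \<le> (norm f' + 1) * norm w"
    unfolding eventually_at_filter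
  proof eventually_elim
    case (elim w)
    show ?case
    proof (intro impI)
      assume "w \<noteq> 0"
      then have "norm (f w / w) \<le> norm f' + 1"
        using elim norm_triangle_ineq2[of "f w / w" f'] by (auto simp: dist_norm)
      then show "norm (f w) \<le> (norm f' + 1) * norm w" using \<open>w \<noteq> 0\<close> by (simp add: norm_divide field_simps)
    qed
  qed
  then have "\<forall>\<^sub>F w in nhds 0. norm (f w) \<le> (norm f' + 1) * norm w"
    unfolding eventually_at_filter by eventually_elim (use assms(4) in auto)
  then show ?thesis by (intro exI[of _ "norm f' + 1"]) (simp add: add_nonneg_pos)
qed

section \<open>Puiseux parametrizations\<close>

text \<open>A Puiseux parametrization: the first coordinate is a pure power, so the points of the
  branch over \<open>x\<close> are indexed by the \<open>p\<close>-th roots of \<open>x - a\<close>.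
  Injectivity makes these points distinct, and openness of the image in \<open>C\<close> says that
  no other branch passes through \<open>(a, b)\<close>.\<close>

definition branch :: "(complex \<times> complex) set \<Rightarrow> complex \<Rightarrow> complex \<Rightarrow> nat \<Rightarrow> real \<Rightarrow> (complex \<Rightarrow> complex) \<Rightarrow> bool" where
  "branch C a b p \<eta> \<psi> \<longleftrightarrow> p > 0 \<and> \<eta> > 0 \<and> \<psi> holomorphic_on ball 0 \<eta> \<and> \<psi> 0 = b \<and>
     inj_on (\<lambda>\<sigma>. (a + \<sigma> ^ p, \<psi> \<sigma>)) (ball 0 \<eta>) \<and>
     (\<forall>\<eta>'. 0 < \<eta>' \<and> \<eta>' \<le> \<eta> \<longrightarrow> openin (top_of_set C) ((\<lambda>\<sigma>. (a + \<sigma> ^ p, \<psi> \<sigma>)) ` ball 0 \<eta>'))"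

text \<open>The first coordinate minus \<open>a\<close> has a holomorphic \<open>p\<close>-th root
  with a simple zero, whose local inverse \<open>\<theta>\<close> is the change of parameter. The
  two-sided comparison of \<open>\<theta> \<sigma>\<close> with \<open>\<sigma>\<close> serves to
  carry order estimates over to the new parameter.\<close>

lemma local_param_imp_branch:
  assumes lp: "local_param C (a, b) V \<gamma>" and nonconst: "\<not> (\<forall>\<^sub>F t in nhds 0. fst (\<gamma> t) = a)"
  obtains p \<eta> \<psi> \<theta> c where "branch C a b p \<eta> \<psi>" "c > 0"
    "\<And>\<sigma>. \<sigma> \<in> ball 0 \<eta> \<Longrightarrow> \<theta> \<sigma> \<in> V \<and> \<gamma> (\<theta> \<sigma>) = (a + \<sigma> ^ p, \<psi> \<sigma>)"
    "\<And>\<sigma>. \<sigma> \<in> ball 0 \<eta> \<Longrightarrow> norm (\<theta> \<sigma>) \<le> c * norm \<sigma> \<and> norm \<sigma> \<le> c * norm (\<theta> \<sigma>)"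
    "deriv (fst \<circ> \<gamma>) 0 \<noteq> 0 \<Longrightarrow> p = 1"
    "continuous_on (ball 0 \<eta>) \<theta>"
proof -
  define \<phi> where "\<phi> = fst \<circ> \<gamma>"
  have V: "open V" "0 \<in> V" "\<gamma> 0 = (a, b)" "\<phi> holomorphic_on V" "(snd \<circ> \<gamma>) holomorphic_on V"
    "openin (top_of_set C) (\<gamma> ` V)" and "\<exists>g. homeomorphism V (\<gamma> ` V) \<gamma> g"
    using lp by (auto simp: local_param_def \<phi>_def)
  then obtain \<gamma>' where hom: "homeomorphism V (\<gamma> ` V) \<gamma> \<gamma>'" by blast
  have \<phi>0: "\<phi> 0 = a" using V(3) by (simp add: \<phi>_def)
  obtain \<rho> where \<rho>: "\<rho> > 0" "ball 0 \<rho> \<subseteq> V" using V(1,2) openE by blast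
  have hol\<phi>: "\<phi> holomorphic_on ball 0 \<rho>" using V(4) \<rho>(2) holomorphic_on_subset by blast
  have "\<exists>n>0. (deriv ^^ n) \<phi> 0 \<noteq> 0"
  proof (rule ccontr)
    assume "\<not> ?thesis"
    then have "\<And>n. 0 < n \<Longrightarrow> (deriv ^^ n) \<phi> 0 = 0" by blast
    then have eq: "fst (\<gamma> w) = a" if "w \<in> ball 0 \<rho>" for w
      using holomorphic_fun_eq_const_on_connected[OF hol\<phi> open_ball connected_ball _ _ that, of 0] \<rho>(1) \<phi>0
      by (simp add: \<phi>_def)
    have "\<forall>\<^sub>F t in nhds 0. t \<in> ball 0 \<rho>"
      by (rule eventually_nhds_in_open) (use \<rho>(1) in auto)
    then have "\<forall>\<^sub>F t in nhds 0. fst (\<gamma> t) = a" by (rule eventually_mono) (rule eq)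
    then show False using nonconst by simp
  qed
  define p where "p = (LEAST n. n > 0 \<and> (deriv ^^ n) \<phi> 0 \<noteq> 0)"
  have p: "p > 0" "(deriv ^^ p) \<phi> 0 \<noteq> 0" and pmin: "\<And>i. 0 < i \<Longrightarrow> i < p \<Longrightarrow> (deriv ^^ i) \<phi> 0 = 0"
    using LeastI_ex[OF \<open>\<exists>n>0. (deriv ^^ n) \<phi> 0 \<noteq> 0\<close>] not_less_Least[of _ "\<lambda>n. n > 0 \<and> (deriv ^^ n) \<phi> 0 \<noteq> 0"]
    unfolding p_def by blast+
  have in\<rho>: "(0::complex) \<in> ball 0 \<rho>" using \<rho>(1) by simp
  obtain g r where r: "0 < r" and g: "g holomorphic_on ball 0 r"
      "\<And>w. w \<in> ball 0 r \<Longrightarrow> \<phi> w - \<phi> 0 = ((w - 0) * g w) ^ p" "\<And>w. w \<in> ball 0 r \<Longrightarrow> g w \<noteq> 0"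
    by (rule holomorphic_factor_order_of_zero_strong[OF hol\<phi> open_ball in\<rho> p pmin]) (assumption | rule that)+
  define r1 where "r1 = min r \<rho>"
  \<comment> \<open>\<open>\<tau>\<close> is a \<open>p\<close>-th root of \<open>\<phi> - a\<close>
    near 0, and its derivative at 0 is \<open>g 0\<close>, which is nonzero; hence it is locally
    invertible.\<close>
  define \<tau> where "\<tau> w = w * g w" for w
  have r1: "r1 > 0" "ball 0 r1 \<subseteq> ball (0::complex) r" "ball 0 r1 \<subseteq> V"
    using r \<rho> by (auto simp: r1_def)
  have hol\<tau>: "\<tau> holomorphic_on ball 0 r1"
    unfolding \<tau>_def by (intro holomorphic_intros holomorphic_on_subset[OF g(1) r1(2)])
  have \<tau>p: "\<phi> w = a + \<tau> w ^ p" if "w \<in> ball 0 r1" for w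
    using g(2)[OF subsetD[OF r1(2) that]] by (simp add: \<tau>_def \<phi>0 algebra_simps)
  have "deriv \<tau> 0 = g 0"
  proof (rule DERIV_imp_deriv)
    obtain g' where "(g has_field_derivative g') (at 0)" using g(1) r holomorphic_derivI[of g "ball 0 r" 0] by auto
    then show "(\<tau> has_field_derivative g 0) (at 0)"
      unfolding \<tau>_def by (auto intro!: derivative_eq_intros)
  qed
  then have dnz: "deriv \<tau> 0 \<noteq> 0" using g(3)[of 0] r by simp
  have in1: "0 \<in> ball (0::complex) r1" using r1(1) by simp
  obtain r2 where r2: "r2 > 0" "ball 0 r2 \<subseteq> ball (0::complex) r1" "open (\<tau> ` ball 0 r2)" "inj_on \<tau> (ball 0 r2)"
    by (rule has_complex_derivative_locally_invertible[OF hol\<tau> in1 open_ball dnz])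
  have hol\<tau>2: "\<tau> holomorphic_on ball 0 r2" using hol\<tau> r2(2) holomorphic_on_subset by blast
  obtain \<theta> where \<theta>: "\<theta> holomorphic_on (\<tau> ` ball 0 r2)" "\<And>z. z \<in> ball 0 r2 \<Longrightarrow> \<theta> (\<tau> z) = z"
    by (rule holomorphic_has_inverse[OF hol\<tau>2 open_ball r2(4)]) (rule that)
  have \<tau>0: "\<tau> 0 = 0" by (simp add: \<tau>_def)
  have in0: "0 \<in> \<tau> ` ball 0 r2" using r2(1) \<tau>0 by (intro image_eqI[of _ _ 0]) auto
  have \<theta>0: "\<theta> 0 = 0" using \<theta>(2)[of 0] r2(1) \<tau>0 by simp
  \<comment> \<open>Linear bounds for \<open>\<theta>\<close> and for its inverse
    \<open>\<tau>\<close>, both vanishing at 0, give the two directions of the comparison.\<close>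
  obtain c1 where c1: "c1 > 0" "\<forall>\<^sub>F w in nhds 0. norm (\<theta> w) \<le> c1 * norm w"
    using holomorphic_linear_bound[OF \<theta>(1) r2(3) in0 \<theta>0] by blast
  obtain c2 where c2: "c2 > 0" "\<forall>\<^sub>F w in nhds 0. norm (\<tau> w) \<le> c2 * norm w"
    using holomorphic_linear_bound[OF hol\<tau> open_ball in1 \<tau>0] by blast
  have "isCont \<theta> 0"
    using holomorphic_on_imp_continuous_on[OF \<theta>(1)] r2(3) in0 continuous_on_eq_continuous_at by blast
  then have "filterlim \<theta> (nhds 0) (nhds 0)"
    using \<theta>0 by (metis isCont_def tendsto_at_iff_tendsto_nhds)
  from filterlim_iff[THEN iffD1, OF this, rule_format, OF c2(2)]
  have "\<forall>\<^sub>F w in nhds 0. norm (\<tau> (\<theta> w)) \<le> c2 * norm (\<theta> w)" .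
  with c1(2) eventually_nhds_in_open[OF r2(3) in0]
  have "\<forall>\<^sub>F w in nhds 0. w \<in> \<tau> ` ball 0 r2 \<and> norm (\<theta> w) \<le> c1 * norm w \<and> norm (\<tau> (\<theta> w)) \<le> c2 * norm (\<theta> w)"
    by eventually_elim auto
  then obtain \<eta> where \<eta>: "\<eta> > 0" "\<And>w. w \<in> ball 0 \<eta> \<Longrightarrow> w \<in> \<tau> ` ball 0 r2 \<and>
      norm (\<theta> w) \<le> c1 * norm w \<and> norm (\<tau> (\<theta> w)) \<le> c2 * norm (\<theta> w)"
    unfolding eventually_nhds_metric by (metis dist_commute mem_ball)
  define c where "c = max c1 c2"
  have \<theta>in: "\<theta> w \<in> ball 0 r2" "\<tau> (\<theta> w) = w" if "w \<in> ball 0 \<eta>" for w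
    using \<eta>(2)[OF that] \<theta>(2) by auto
  have \<theta>V: "\<theta> w \<in> V" if "w \<in> ball 0 \<eta>" for w using \<theta>in[OF that] r2(2) r1(3) by blast
  define \<psi> where "\<psi> = snd \<circ> \<gamma> \<circ> \<theta>"
  have \<gamma>\<theta>: "\<gamma> (\<theta> w) = (a + w ^ p, \<psi> w)" if "w \<in> ball 0 \<eta>" for w
    using \<tau>p[of "\<theta> w"] \<theta>in[OF that] r2(2) by (auto simp: \<psi>_def \<phi>_def prod_eq_iff)
  have hol\<theta>: "\<theta> holomorphic_on ball 0 \<eta>"
    by (rule holomorphic_on_subset[OF \<theta>(1)]) (use \<eta>(2) in auto)
  have inj\<theta>: "inj_on \<theta> (ball 0 \<eta>)" by (rule inj_onI) (metis \<theta>in(2))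
  have inj\<gamma>: "inj_on \<gamma> V" using hom by (metis homeomorphism_apply1 inj_onI)
  have "branch C a b p \<eta> \<psi>"
    unfolding branch_def
  proof (intro conjI allI impI)
    show "\<psi> holomorphic_on ball 0 \<eta>"
      unfolding \<psi>_def using \<theta>V by (intro holomorphic_on_compose_gen[OF hol\<theta> V(5)]) auto
    show "\<psi> 0 = b" by (simp add: \<psi>_def \<theta>0 V(3))
    show "inj_on (\<lambda>\<sigma>. (a + \<sigma> ^ p, \<psi> \<sigma>)) (ball 0 \<eta>)"
    proof (rule inj_onI)
      fix s t assume st: "s \<in> ball 0 \<eta>" "t \<in> ball 0 \<eta>" "(a + s ^ p, \<psi> s) = (a + t ^ p, \<psi> t)"
      then have "\<gamma> (\<theta> s) = \<gamma> (\<theta> t)" by (simp add: \<gamma>\<theta>)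
      then have "\<theta> s = \<theta> t" using inj\<gamma> \<theta>V st by (meson inj_onD)
      then show "s = t" using inj\<theta> st by (meson inj_onD)
    qed
    fix \<eta>' :: real assume \<eta>': "0 < \<eta>' \<and> \<eta>' \<le> \<eta>"
    then have sub: "ball 0 \<eta>' \<subseteq> ball (0::complex) \<eta>" by auto
    have "open (\<theta> ` ball 0 \<eta>')"
      by (rule open_mapping_thm3) (use holomorphic_on_subset[OF hol\<theta> sub] inj_on_subset[OF inj\<theta> sub] in auto)
    moreover have "\<theta> ` ball 0 \<eta>' \<subseteq> V" using \<theta>V sub by auto
    ultimately have "openin (top_of_set V) (\<theta> ` ball 0 \<eta>')" by (simp add: openin_open_eq V(1))
    then have "openin (top_of_set (\<gamma> ` V)) (\<gamma> ` \<theta> ` ball 0 \<eta>')"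
      by (rule homeomorphism_imp_open_map[OF hom])
    then have "openin (top_of_set C) (\<gamma> ` \<theta> ` ball 0 \<eta>')" using V(6) openin_trans by blast
    moreover have "\<gamma> ` \<theta> ` ball 0 \<eta>' = (\<lambda>\<sigma>. (a + \<sigma> ^ p, \<psi> \<sigma>)) ` ball 0 \<eta>'"
      unfolding image_image using sub by (intro image_cong refl \<gamma>\<theta>) auto
    ultimately show "openin (top_of_set C) ((\<lambda>\<sigma>. (a + \<sigma> ^ p, \<psi> \<sigma>)) ` ball 0 \<eta>')" by simp
  qed (use p \<eta>(1) in auto)
  moreover have "c > 0" using c1 by (simp add: c_def)
  moreover have "norm (\<theta> \<sigma>) \<le> c * norm \<sigma> \<and> norm \<sigma> \<le> c * norm (\<theta> \<sigma>)" if "\<sigma> \<in> ball 0 \<eta>" for \<sigma>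
  proof -
    have "c1 * norm \<sigma> \<le> c * norm \<sigma>" "c2 * norm (\<theta> \<sigma>) \<le> c * norm (\<theta> \<sigma>)"
      by (auto simp: c_def intro!: mult_right_mono)
    then show ?thesis using \<eta>(2)[OF that] \<theta>in(2)[OF that] by auto
  qed
  moreover have "p = 1" if "deriv (fst \<circ> \<gamma>) 0 \<noteq> 0"
    using pmin[of 1] that p(1) by (force simp: \<phi>_def)
  moreover have "continuous_on (ball 0 \<eta>) \<theta>" using hol\<theta> by (rule holomorphic_on_imp_continuous_on)
  ultimately show thesis using that[of p \<eta> \<psi> c \<theta>] \<theta>V \<gamma>\<theta> by blast
qed


definition bizeros :: "nat \<Rightarrow> (nat \<Rightarrow> nat \<Rightarrow> complex) \<Rightarrow> (complex \<times> complex) set" where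
  "bizeros D A = {z. bieval_at D A z = 0}"

lemma branch_in:
  assumes "branch C a b p \<eta> \<psi>" "\<sigma> \<in> ball 0 \<eta>"
  shows "(a + \<sigma> ^ p, \<psi> \<sigma>) \<in> C"
proof -
  have "openin (top_of_set C) ((\<lambda>\<sigma>. (a + \<sigma> ^ p, \<psi> \<sigma>)) ` ball 0 \<eta>)"
    using assms(1) by (auto simp: branch_def)
  from openin_imp_subset[OF this] show ?thesis using assms(2) by blast
qed

section \<open>Semicontinuity of intersection multiplicity\<close>

text \<open>The box in which roots are counted: inside it the curve consists of the branch alone,
  and the curve misses the part of the boundary where \<open>y\<close> lies on the circle, so no
  root can leave through it.\<close>

lemma branch_isolating_box:
  assumes br: "branch (bizeros D A) a b p \<eta> \<psi>" and U: "open U" "(a, b) \<in> U"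
  obtains d e where "d > 0" "e > 0" "cball a d \<times> cball b e \<subseteq> U"
    "\<And>x y. x \<in> cball a d \<Longrightarrow> y \<in> sphere b e \<Longrightarrow> bieval D A x y \<noteq> 0"
    "\<And>x y. x \<in> cball a d \<Longrightarrow> y \<in> cball b e \<Longrightarrow> bieval D A x y = 0 \<Longrightarrow>
       \<exists>\<sigma>\<in>ball 0 \<eta>. x = a + \<sigma> ^ p \<and> y = \<psi> \<sigma>"
proof -
  from br have p: "p > 0" "\<eta> > 0" "\<psi> 0 = b" and
    op: "openin (top_of_set (bizeros D A)) ((\<lambda>\<sigma>. (a + \<sigma> ^ p, \<psi> \<sigma>)) ` ball 0 \<eta>)"
    by (auto simp: branch_def)
  then obtain T where T: "open T" "(\<lambda>\<sigma>. (a + \<sigma> ^ p, \<psi> \<sigma>)) ` ball 0 \<eta> = bizeros D A \<inter> T"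
    by (auto simp: openin_open)
  have "(a, b) \<in> (\<lambda>\<sigma>. (a + \<sigma> ^ p, \<psi> \<sigma>)) ` ball 0 \<eta>"
    using p by (intro image_eqI[of _ _ 0]) auto
  then have "(a, b) \<in> T \<inter> U" using T U by auto
  then obtain X Y where XY: "open X" "open Y" "a \<in> X" "b \<in> Y" "X \<times> Y \<subseteq> T \<inter> U"
    using open_prod_elim[OF open_Int[OF T(1) U(1)]] by (metis SigmaD1 SigmaD2)
  obtain e where e: "e > 0" "cball b e \<subseteq> Y" using XY open_contains_cball by blast
  obtain d1 where d1: "d1 > 0" "cball a d1 \<subseteq> X" using XY open_contains_cball by blast
  have roots: "\<exists>\<sigma>\<in>ball 0 \<eta>. x = a + \<sigma> ^ p \<and> y = \<psi> \<sigma>"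
    if "x \<in> cball a d1" "y \<in> cball b e" "bieval D A x y = 0" for x y
  proof -
    have "(x, y) \<in> bizeros D A \<inter> T" using that d1 e XY(5) by (auto simp: bizeros_def subset_iff)
    then show ?thesis unfolding T(2)[symmetric] by auto
  qed
  \<comment> \<open>Over \<open>x = a\<close> the equation \<open>\<sigma> ^ p = 0\<close> leaves
    only \<open>y = b\<close>. The tube lemma then spreads the avoidance of the circle to nearby
    \<open>x\<close>.\<close>
  have "bieval D A a y \<noteq> 0" if "y \<in> sphere b e" for y
  proof
    assume "bieval D A a y = 0"
    moreover have "a \<in> cball a d1" "y \<in> cball b e" using that d1 by auto
    ultimately have "\<exists>\<sigma>\<in>ball 0 \<eta>. a = a + \<sigma> ^ p \<and> y = \<psi> \<sigma>" using roots by blast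
    then have "y = b" using p by auto
    then show False using that e by auto
  qed
  moreover have "open {z. bieval_at D A z \<noteq> 0}"
    by (intro open_Collect_neq continuous_intros)
  ultimately obtain X0 where X0: "a \<in> X0" "open X0" "X0 \<times> sphere b e \<subseteq> {z. bieval_at D A z \<noteq> 0}"
    using Elementary_Topology.tube_lemma[of "sphere b e" "{z. bieval_at D A z \<noteq> 0}" a] by force
  obtain d2 where d2: "d2 > 0" "cball a d2 \<subseteq> X0" using X0 open_contains_cball by blast
  show thesis
  proof (rule that[of "min d1 d2" e])
    show "cball a (min d1 d2) \<times> cball b e \<subseteq> U" using d1 e XY(5) by fastforce
    show "bieval D A x y \<noteq> 0" if "x \<in> cball a (min d1 d2)" "y \<in> sphere b e" for x y
      using that d2 X0(3) by fastforce
  qed (use d1 d2 e roots in auto)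
qed

text \<open>All \<open>p\<close>-th roots of \<open>x - a\<close> have the same modulus, so they are
  smaller than \<open>\<delta>\<close> as soon as \<open>x\<close> is within
  \<open>\<delta> ^ p\<close> of \<open>a\<close>.\<close>

lemma eventually_all_roots:
  fixes a :: complex
  assumes "p > 0" "\<forall>\<^sub>F \<sigma> in nhds 0. P \<sigma>"
  shows "\<forall>\<^sub>F x in nhds a. \<forall>\<sigma>. \<sigma> ^ p = x - a \<longrightarrow> P \<sigma>"
proof -
  from assms(2) obtain \<delta> where \<delta>: "\<delta> > 0" "\<And>\<sigma>. norm \<sigma> < \<delta> \<Longrightarrow> P \<sigma>"
    by (auto simp: eventually_nhds_metric)
  have "\<forall>\<^sub>F x in nhds a. x \<in> ball a (\<delta> ^ p)"
    by (rule eventually_nhds_in_open) (use \<delta> in auto)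
  then show ?thesis
  proof eventually_elim
    case (elim x)
    show ?case
    proof (intro allI impI \<delta>(2))
      fix \<sigma> assume "\<sigma> ^ p = x - a"
      then have "norm \<sigma> ^ p = norm (x - a)" by (metis norm_power)
      also have "\<dots> < \<delta> ^ p" using elim by (simp add: dist_norm norm_minus_commute)
      finally show "norm \<sigma> < \<delta>" using \<delta>(1) power_less_imp_less_base by fastforce
    qed
  qed
qed

text \<open>There are \<open>p\<close> roots, each of modulus \<open>norm x\<close> to the power
  \<open>1 / p\<close>. So order \<open>m\<close> in the parameter of a branch becomes order
  \<open>m\<close> in \<open>x\<close> after multiplying over its \<open>p\<close> points.\<close>

lemma prod_norm_roots:
  fixes x :: complex
  assumes "p > 0" "x \<noteq> 0"
  shows "(\<Prod>\<sigma>\<in>{\<sigma>. \<sigma> ^ p = x}. norm \<sigma> ^ m) = norm x ^ m"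
proof -
  have "norm \<sigma> = root p (norm x)" if "\<sigma> ^ p = x" for \<sigma>
    using that assms(1) by (metis norm_ge_zero norm_power real_root_power_cancel)
  then have "(\<Prod>\<sigma>\<in>{\<sigma>. \<sigma> ^ p = x}. norm \<sigma> ^ m) = (\<Prod>\<sigma>\<in>{\<sigma>. \<sigma> ^ p = x}. root p (norm x) ^ m)"
    by (intro prod.cong) auto
  also have "\<dots> = (root p (norm x) ^ m) ^ p" using card_nth_roots[OF assms(2,1)] by simp
  also have "\<dots> = (root p (norm x) ^ p) ^ m" by (simp add: mult.commute flip: power_mult)
  finally show ?thesis using assms(1) by (simp add: real_root_pow_pos2)
qed

text \<open>Each branch contributes \<open>p j\<close> different roots over \<open>x\<close>, and
  the product of \<open>B\<close> over them is of size \<open>norm (x - \<xi>) ^ m j\<close>.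
  Several branches may lie over the same \<open>\<xi>\<close>; their roots are disjoint, so the
  orders add up.\<close>

lemma fibre_norm_upper:
  assumes e: "e > 0" and nz: "\<forall>x\<in>ball a d. \<forall>y\<in>sphere b e. bieval D A x y \<noteq> 0"
    and le1: "\<And>x y. x \<in> ball a d \<Longrightarrow> y \<in> ball b e \<Longrightarrow> norm (bieval D B x y) \<le> 1"
    and \<xi>: "\<xi> \<in> ball a d" and J: "finite J" "inj_on w J" "\<And>j. j \<in> J \<Longrightarrow> w j \<in> ball b e"
    and br: "\<And>j. j \<in> J \<Longrightarrow> branch (bizeros D A) \<xi> (w j) (p j) (\<eta> j) (\<psi> j)"
    and ord: "\<And>j. j \<in> J \<Longrightarrow> \<forall>\<^sub>F \<sigma> in nhds 0. norm (bieval D B (\<xi> + \<sigma> ^ p j) (\<psi> j \<sigma>)) \<le> C j * norm \<sigma> ^ m j"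
  shows "\<exists>K. \<forall>\<^sub>F x in at \<xi>. norm (fibre_norm D A B b e x) \<le> K * norm (x - \<xi>) ^ (\<Sum>j\<in>J. m j)"
proof -
  have fin: "finite (w ` J)" using J by simp
  obtain r where r: "r > 0" "\<And>i j. i \<in> J \<Longrightarrow> j \<in> J \<Longrightarrow> i \<noteq> j \<Longrightarrow> ball (w i) r \<inter> ball (w j) r = {}"
  proof -
    have "\<exists>r>0. \<forall>u\<in>w ` J. u \<noteq> v \<longrightarrow> r \<le> dist v u" for v
      using finite_set_avoid[OF fin, of v] by auto
    then obtain R where R: "\<And>v. R v > 0" "\<And>u v. u \<in> w ` J \<Longrightarrow> u \<noteq> v \<Longrightarrow> R v \<le> dist v u" by metis
    \<comment> \<open>Half of the smallest separation of the centres, so that the balls of radius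
      \<open>r\<close> are disjoint; the element 1 is inserted to cover an empty
      \<open>J\<close>.\<close>
    define r where "r = Min (insert 1 (R ` w ` J)) / 2"
    have rpos: "r > 0" using fin R(1) by (simp add: r_def)
    have rle: "2 * r \<le> R v" if "v \<in> w ` J" for v
      using fin that by (simp add: r_def)
    have "ball (w i) r \<inter> ball (w j) r = {}" if "i \<in> J" "j \<in> J" "i \<noteq> j" for i j
    proof -
      have "w i \<noteq> w j" using J(2) that by (meson inj_onD)
      then have "2 * r \<le> dist (w i) (w j)" using rle[of "w i"] R(2)[of "w j" "w i"] that by auto
      then show ?thesis by (intro disjoint_ballI) auto
    qed
    then show thesis using that rpos by blast
  qed
  define R where "R j x = {\<sigma>. \<sigma> ^ p j = x - \<xi>}" for j x
  have pj: "p j > 0" "\<eta> j > 0" "\<psi> j 0 = w j" "\<psi> j holomorphic_on ball 0 (\<eta> j)"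
    "inj_on (\<lambda>\<sigma>. (\<xi> + \<sigma> ^ p j, \<psi> j \<sigma>)) (ball 0 (\<eta> j))" if "j \<in> J" for j
    using br[OF that] by (auto simp: branch_def)
  have ev: "\<forall>\<^sub>F \<sigma> in nhds 0. \<sigma> \<in> ball 0 (\<eta> j) \<and> \<psi> j \<sigma> \<in> ball b e \<inter> ball (w j) r \<and>
      norm (bieval D B (\<xi> + \<sigma> ^ p j) (\<psi> j \<sigma>)) \<le> C j * norm \<sigma> ^ m j" if "j \<in> J" for j
  proof -
    have "isCont (\<psi> j) 0"
      using holomorphic_on_imp_continuous_on[OF pj(4)[OF that]] pj(2)[OF that]
      by (simp add: continuous_on_eq_continuous_at)
    then have "filterlim (\<psi> j) (nhds (w j)) (nhds 0)"
      using pj(3)[OF that] by (metis isCont_def tendsto_at_iff_tendsto_nhds)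
    moreover have "\<forall>\<^sub>F v in nhds (w j). v \<in> ball b e \<inter> ball (w j) r"
      using J(3)[OF that] r(1) by (intro eventually_nhds_in_open) auto
    ultimately have "\<forall>\<^sub>F \<sigma> in nhds 0. \<psi> j \<sigma> \<in> ball b e \<inter> ball (w j) r"
      by (auto simp: filterlim_iff)
    moreover have "\<forall>\<^sub>F \<sigma> in nhds 0. \<sigma> \<in> ball 0 (\<eta> j)"
      using pj(2)[OF that] by (intro eventually_nhds_in_open) auto
    ultimately show ?thesis using ord[OF that] by eventually_elim auto
  qed
  have "\<forall>\<^sub>F x in nhds \<xi>. \<forall>j\<in>J. \<forall>\<sigma>. \<sigma> ^ p j = x - \<xi> \<longrightarrow> \<sigma> \<in> ball 0 (\<eta> j) \<and> \<psi> j \<sigma> \<in> ball b e \<inter> ball (w j) r \<and>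
      norm (bieval D B (\<xi> + \<sigma> ^ p j) (\<psi> j \<sigma>)) \<le> C j * norm \<sigma> ^ m j"
    using J(1) pj(1) ev by (intro eventually_ball_finite ballI eventually_all_roots) auto
  then have "\<forall>\<^sub>F x in at \<xi>. \<forall>j\<in>J. \<forall>\<sigma>\<in>R j x. \<sigma> \<in> ball 0 (\<eta> j) \<and> \<psi> j \<sigma> \<in> ball b e \<inter> ball (w j) r \<and>
      norm (bieval D B x (\<psi> j \<sigma>)) \<le> C j * norm \<sigma> ^ m j"
    unfolding eventually_at_filter by eventually_elim (auto simp: R_def)
  moreover have "\<forall>\<^sub>F x in at \<xi>. x \<in> ball a d - {\<xi>}" using \<xi> by (intro eventually_at_in_open) auto
  ultimately have "\<forall>\<^sub>F x in at \<xi>. norm (fibre_norm D A B b e x)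
      \<le> (\<Prod>j\<in>J. C j ^ p j) * norm (x - \<xi>) ^ (\<Sum>j\<in>J. m j)"
  proof eventually_elim
    case (elim x)
    have x: "x \<in> ball a d" "x - \<xi> \<noteq> 0" using elim by auto
    have E: "\<sigma> \<in> ball 0 (\<eta> j)" "\<psi> j \<sigma> \<in> ball b e" "\<psi> j \<sigma> \<in> ball (w j) r"
      "norm (bieval D B x (\<psi> j \<sigma>)) \<le> C j * norm \<sigma> ^ m j" if "j \<in> J" "\<sigma> \<in> R j x" for j \<sigma>
      using elim(1) that by blast+
    have cardR: "card (R j x) = p j" "finite (R j x)" if "j \<in> J" for j
      using card_nth_roots[OF x(2) pj(1)[OF that]] finite_nth_roots[OF pj(1)[OF that]] by (auto simp: R_def)
    \<comment> \<open>Parameters in \<open>R j x\<close> share their first coordinate, so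
      injectivity of the branch reduces to injectivity of \<open>\<psi> j\<close>.\<close>
    have inj: "inj_on (\<psi> j) (R j x)" if "j \<in> J" for j
    proof (rule inj_onI)
      fix s t assume st: "s \<in> R j x" "t \<in> R j x" "\<psi> j s = \<psi> j t"
      then have "(\<xi> + s ^ p j, \<psi> j s) = (\<xi> + t ^ p j, \<psi> j t)" by (simp add: R_def)
      then show "s = t" using pj(5)[OF that] E(1)[OF that] st by (meson inj_onD)
    qed
    have disj: "\<forall>i\<in>J. \<forall>j\<in>J. i \<noteq> j \<longrightarrow> \<psi> i ` R i x \<inter> \<psi> j ` R j x = {}"
    proof (intro ballI impI)
      fix i j assume ij: "i \<in> J" "j \<in> J" "i \<noteq> j"
      have "\<psi> i ` R i x \<subseteq> ball (w i) r" "\<psi> j ` R j x \<subseteq> ball (w j) r" using E(3) ij by auto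
      then show "\<psi> i ` R i x \<inter> \<psi> j ` R j x = {}" using r(2)[OF ij] by blast
    qed
    have sub: "(\<Union>j\<in>J. \<psi> j ` R j x) \<subseteq> fibre_roots D A b e x"
    proof safe
      fix j \<sigma> assume j: "j \<in> J" "\<sigma> \<in> R j x"
      have "(\<xi> + \<sigma> ^ p j, \<psi> j \<sigma>) \<in> bizeros D A" by (rule branch_in[OF br[OF j(1)] E(1)[OF j]])
      then have "bieval D A x (\<psi> j \<sigma>) = 0" using j by (simp add: bizeros_def R_def)
      then show "\<psi> j \<sigma> \<in> fibre_roots D A b e x" using E(2)[OF j] by (simp add: fibre_roots_def)
    qed
    have "norm (fibre_norm D A B b e x) \<le> (\<Prod>v\<in>(\<Union>j\<in>J. \<psi> j ` R j x). norm (bieval D B x v))"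
      using nz le1 x by (intro fibre_norm_bound[OF e _ _ sub]) auto
    also have "\<dots> = (\<Prod>j\<in>J. \<Prod>v\<in>\<psi> j ` R j x. norm (bieval D B x v))"
      by (rule prod.UNION_disjoint) (use J(1) cardR disj in auto)
    also have "\<dots> = (\<Prod>j\<in>J. \<Prod>\<sigma>\<in>R j x. norm (bieval D B x (\<psi> j \<sigma>)))"
      by (rule prod.cong[OF refl]) (simp add: prod.reindex[OF inj])
    also have "\<dots> \<le> (\<Prod>j\<in>J. \<Prod>\<sigma>\<in>R j x. C j * norm \<sigma> ^ m j)"
      by (intro prod_mono conjI prod_nonneg ballI) (use E(4) in auto)
    also have "\<dots> = (\<Prod>j\<in>J. C j ^ p j * norm (x - \<xi>) ^ m j)"
      by (rule prod.cong[OF refl]) (simp add: prod.distrib cardR prod_norm_roots[OF pj(1) x(2), folded R_def])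
    also have "\<dots> = (\<Prod>j\<in>J. C j ^ p j) * norm (x - \<xi>) ^ (\<Sum>j\<in>J. m j)"
      by (simp add: prod.distrib power_sum)
    finally show ?case .
  qed
  then show ?thesis by blast
qed

text \<open>Where the derivative in \<open>y\<close> is nonzero all roots have multiplicity 1, so
  the norm is a plain product over points of the branch and cannot be smaller than what the order of
  \<open>B\<close> on the branch permits.\<close>

lemma fibre_norm_lower:
  assumes e: "e > 0" and d: "d > 0" and nz: "\<forall>x\<in>ball a d. \<forall>y\<in>sphere b e. bieval D A x y \<noteq> 0"
    and roots: "\<And>x y. x \<in> ball a d \<Longrightarrow> y \<in> ball b e \<Longrightarrow> bieval D A x y = 0 \<Longrightarrow>
       \<exists>\<sigma>\<in>ball 0 \<eta>. x = a + \<sigma> ^ p \<and> y = \<psi> \<sigma>" and p: "p > 0"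
    and inj: "inj_on (\<lambda>\<sigma>. (a + \<sigma> ^ p, \<psi> \<sigma>)) (ball 0 \<eta>)"
    and simple: "\<forall>\<^sub>F \<sigma> in at 0. bieval D (bdy D A) (a + \<sigma> ^ p) (\<psi> \<sigma>) \<noteq> 0"
    and ord: "c > 0" "\<forall>\<^sub>F \<sigma> in nhds 0. c * norm \<sigma> ^ m \<le> norm (bieval D B (a + \<sigma> ^ p) (\<psi> \<sigma>))"
  shows "\<exists>K>0. \<forall>\<^sub>F x in at a. K * norm (x - a) ^ m \<le> norm (fibre_norm D A B b e x)"
proof -
  \<comment> \<open>Capping the constant at 1 makes every factor
    \<open>c' * norm \<sigma> ^ m\<close> at most 1 for small \<open>\<sigma>\<close>, which is used
    when factors are added to a product.\<close>
  define c' where "c' = min c 1"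
  have c': "c' > 0" "c' \<le> 1" "c' \<le> c" using ord by (auto simp: c'_def)
  define R where "R x = {\<sigma>. \<sigma> ^ p = x - a}" for x
  have "\<forall>\<^sub>F \<sigma> in nhds (0::complex). \<sigma> \<in> ball 0 1"
    by (rule eventually_nhds_in_open) auto
  with simple[unfolded eventually_at_filter] ord(2)
  have "\<forall>\<^sub>F \<sigma> in nhds 0. norm \<sigma> \<le> 1 \<and> (\<sigma> \<noteq> 0 \<longrightarrow> bieval D (bdy D A) (a + \<sigma> ^ p) (\<psi> \<sigma>) \<noteq> 0) \<and>
      c' * norm \<sigma> ^ m \<le> norm (bieval D B (a + \<sigma> ^ p) (\<psi> \<sigma>))"
  proof eventually_elim
    case (elim \<sigma>)
    have "c' * norm \<sigma> ^ m \<le> c * norm \<sigma> ^ m" using c' by (intro mult_right_mono) auto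
    then show ?case using elim by auto
  qed
  from eventually_all_roots[OF p this, of a]
  have "\<forall>\<^sub>F x in at a. \<forall>\<sigma>\<in>R x. norm \<sigma> \<le> 1 \<and> bieval D (bdy D A) x (\<psi> \<sigma>) \<noteq> 0 \<and>
      c' * norm \<sigma> ^ m \<le> norm (bieval D B x (\<psi> \<sigma>))"
    unfolding eventually_at_filter
  proof eventually_elim
    case (elim x)
    show ?case
    proof (intro impI ballI)
      fix \<sigma> assume "x \<noteq> a" "\<sigma> \<in> R x"
      then have "\<sigma> \<noteq> 0" "\<sigma> ^ p = x - a" "a + \<sigma> ^ p = x" using p by (auto simp: R_def power_0_left)
      then show "norm \<sigma> \<le> 1 \<and> bieval D (bdy D A) x (\<psi> \<sigma>) \<noteq> 0 \<and>
        c' * norm \<sigma> ^ m \<le> norm (bieval D B x (\<psi> \<sigma>))" using elim by metis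
    qed
  qed
  moreover have "\<forall>\<^sub>F x in at a. x \<in> ball a d - {a}" using d by (intro eventually_at_in_open) auto
  ultimately have "\<forall>\<^sub>F x in at a. c' ^ p * norm (x - a) ^ m \<le> norm (fibre_norm D A B b e x)"
  proof eventually_elim
    case (elim x)
    have x: "x \<in> ball a d" "x - a \<noteq> 0" using elim by auto
    have nzx: "\<forall>y\<in>sphere b e. bieval D A x y \<noteq> 0" using nz x by blast
    have "b + of_real e \<in> sphere b e" using e by (simp add: dist_norm)
    then have nz0: "bieval D A x (b + of_real e) \<noteq> 0" using nzx by blast
    have cardR: "card (R x) = p" "finite (R x)"
      using card_nth_roots[OF x(2) p] finite_nth_roots[OF p] by (auto simp: R_def)
    \<comment> \<open>The parameters that actually give roots counted by the norm. Filling up from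
      \<open>R'\<close> to all \<open>p\<close> roots of \<open>x - a\<close> inserts factors at
      most 1, so the product only decreases.\<close>
    define R' where "R' = {\<sigma>\<in>R x. \<sigma> \<in> ball 0 \<eta> \<and> \<psi> \<sigma> \<in> fibre_roots D A b e x}"
    have R': "R' \<subseteq> R x" "finite R'" using cardR(2) by (auto simp: R'_def)
    have im: "\<psi> ` R' = fibre_roots D A b e x"
    proof safe
      fix y assume y: "y \<in> fibre_roots D A b e x"
      then obtain \<sigma> where "\<sigma> \<in> ball 0 \<eta>" "x = a + \<sigma> ^ p" "y = \<psi> \<sigma>"
        using roots[OF x(1), of y] by (auto simp: fibre_roots_def)
      then show "y \<in> \<psi> ` R'" using y by (auto simp: R'_def R_def)
    qed (auto simp: R'_def)
    have inj': "inj_on \<psi> R'"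
    proof (rule inj_onI)
      fix s t assume st: "s \<in> R'" "t \<in> R'" "\<psi> s = \<psi> t"
      then have "(a + s ^ p, \<psi> s) = (a + t ^ p, \<psi> t)" by (simp add: R'_def R_def)
      moreover have "s \<in> ball 0 \<eta>" "t \<in> ball 0 \<eta>" using st by (auto simp: R'_def)
      ultimately show "s = t" using inj by (meson inj_onD)
    qed
    have mult1: "fibre_mult D A x (\<psi> \<sigma>) = 1" if "\<sigma> \<in> R'" for \<sigma>
    proof -
      have "bieval D A x (\<psi> \<sigma>) = 0" using that by (auto simp: R'_def fibre_roots_def)
      moreover have "bieval D (bdy D A) x (\<psi> \<sigma>) \<noteq> 0" using that elim(1) by (auto simp: R'_def)
      ultimately show ?thesis using fibre_mult_eq_1_iff[OF nz0] by blast
    qed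
    have "(\<Prod>\<sigma>\<in>R x. c' * norm \<sigma> ^ m) \<le> (\<Prod>\<sigma>\<in>R'. c' * norm \<sigma> ^ m)"
    proof -
      have "(\<Prod>\<sigma>\<in>R x - R'. c' * norm \<sigma> ^ m) \<le> (\<Prod>\<sigma>\<in>R x - R'. 1)"
      proof (intro prod_mono conjI)
        fix \<sigma> assume "\<sigma> \<in> R x - R'"
        then have "norm \<sigma> ^ m \<le> 1" using elim(1) by (intro power_le_one) auto
        then show "c' * norm \<sigma> ^ m \<le> 1" using c' by (intro mult_le_one) auto
      qed (use c' in auto)
      then have "(\<Prod>\<sigma>\<in>R x - R'. c' * norm \<sigma> ^ m) * (\<Prod>\<sigma>\<in>R'. c' * norm \<sigma> ^ m) \<le> 1 * (\<Prod>\<sigma>\<in>R'. c' * norm \<sigma> ^ m)"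
        using c' by (intro mult_right_mono prod_nonneg) auto
      then show ?thesis unfolding prod.subset_diff[OF R'(1) cardR(2), of "\<lambda>\<sigma>. c' * norm \<sigma> ^ m"] by simp
    qed
    also have "\<dots> \<le> (\<Prod>\<sigma>\<in>R'. norm (bieval D B x (\<psi> \<sigma>)))"
      by (intro prod_mono conjI) (use elim(1) R'(1) c' in auto)
    also have "\<dots> = (\<Prod>\<sigma>\<in>R'. norm (bieval D B x (\<psi> \<sigma>) ^ fibre_mult D A x (\<psi> \<sigma>)))"
      by (intro prod.cong refl) (simp add: mult1)
    also have "\<dots> = norm (fibre_norm D A B b e x)"
      unfolding fibre_norm_def im[symmetric] by (simp add: prod.reindex[OF inj'] flip: prod_norm)
    also have "(\<Prod>\<sigma>\<in>R x. c' * norm \<sigma> ^ m) = c' ^ p * norm (x - a) ^ m"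
      using prod_norm_roots[OF p x(2), of m] by (simp add: prod.distrib cardR R_def[symmetric])
    finally show ?case .
  qed
  then show ?thesis using c'(1) by (intro exI[of _ "c' ^ p"]) auto
qed


lemma bieval_scale: "bieval D (\<lambda>i j. A i j / c) x y = bieval D A x y / c"
  by (simp add: bieval_def sum_divide_distrib)

text \<open>Otherwise a disc would be mapped injectively into the fibre over \<open>a\<close>, which
  is finite.\<close>

lemma local_param_not_const:
  assumes lp: "local_param (bizeros D A) (a, b) V \<gamma>" and nz: "bieval D A a y \<noteq> 0"
  shows "\<not> (\<forall>\<^sub>F t in nhds 0. fst (\<gamma> t) = a)"
proof
  assume *: "\<forall>\<^sub>F t in nhds 0. fst (\<gamma> t) = a"
  from lp have V: "open V" "0 \<in> V" "openin (top_of_set (bizeros D A)) (\<gamma> ` V)"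
    and "\<exists>g. homeomorphism V (\<gamma> ` V) \<gamma> g" by (auto simp: local_param_def)
  then have inj: "inj_on \<gamma> V" by (metis homeomorphism_apply1 inj_onI)
  have "\<forall>\<^sub>F t in nhds 0. t \<in> V \<and> fst (\<gamma> t) = a"
    using eventually_nhds_in_open[OF V(1,2)] * by eventually_elim auto
  then obtain r where r: "r > 0" "\<And>t. dist t 0 < r \<Longrightarrow> t \<in> V \<and> fst (\<gamma> t) = a"
    by (auto simp: eventually_nhds_metric)
  have sub: "ball 0 r \<subseteq> V" using r by (auto simp: dist_commute)
  have "\<gamma> ` ball 0 r \<subseteq> {a} \<times> {w. bieval D A a w = 0}"
  proof
    fix v assume "v \<in> \<gamma> ` ball 0 r"
    then obtain t where t: "t \<in> ball 0 r" "v = \<gamma> t" by blast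
    then have "fst v = a" "v \<in> bizeros D A"
      using r(2)[of t] openin_imp_subset[OF V(3)] sub by (auto simp: dist_commute)
    then show "v \<in> {a} \<times> {w. bieval D A a w = 0}" by (auto simp: bizeros_def mem_Times_iff)
  qed
  moreover have "finite ({a} \<times> {w. bieval D A a w = 0})" using finite_bieval_zeros[OF nz] by auto
  ultimately have "finite (\<gamma> ` ball 0 r)" using finite_subset by blast
  then have "finite (ball (0::complex) r)" using inj_on_subset[OF inj sub] finite_imageD by blast
  then show False using r(1) uncountable_ball countable_finite by blast
qed

text \<open>The norms on the approximating curves are bounded by 1 and have zeros of total order at
  least the sum of the \<open>m j\<close> near \<open>a\<close>. The Schwarz bound survives the
  limit and makes the limit norm vanish at \<open>a\<close> to at least that order, while its lower
  bound permits at most \<open>m0\<close>.\<close>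

lemma intersection_semicontinuity_aux:
  fixes m :: "'j \<Rightarrow> nat"
  assumes A: "coeffs_tendsto A A'" and B: "coeffs_tendsto B B'"
    and br: "branch (bizeros D A') a b p \<eta> \<psi>"
    and simple: "\<forall>\<^sub>F \<sigma> in at 0. bieval D (bdy D A') (a + \<sigma> ^ p) (\<psi> \<sigma>) \<noteq> 0"
    and ord: "c > 0" "\<forall>\<^sub>F \<sigma> in nhds 0. c * norm \<sigma> ^ m0 \<le> norm (bieval D B' (a + \<sigma> ^ p) (\<psi> \<sigma>))"
    and J: "finite J" and inj: "\<And>n. inj_on (z n) J" and lim: "\<And>j. j \<in> J \<Longrightarrow> (\<lambda>n. z n j) \<longlonglongrightarrow> (a, b)"
    and lp: "\<And>n j. j \<in> J \<Longrightarrow> local_param (bizeros D (A n)) (z n j) (V n j) (\<gamma> n j)"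
    and ordn: "\<And>n j. j \<in> J \<Longrightarrow> \<forall>\<^sub>F t in nhds 0.
       norm (bieval_at D (B n) (\<gamma> n j t)) \<le> C n j * norm t ^ m j"
  shows "(\<Sum>j\<in>J. m j) \<le> m0"
proof -
  have p: "p > 0" and inj\<psi>: "inj_on (\<lambda>\<sigma>. (a + \<sigma> ^ p, \<psi> \<sigma>)) (ball 0 \<eta>)" using br by (auto simp: branch_def)
  obtain d e where d: "d > 0" and e: "e > 0"
    and nz: "\<And>x y. x \<in> cball a d \<Longrightarrow> y \<in> sphere b e \<Longrightarrow> bieval D A' x y \<noteq> 0"
    and roots: "\<And>x y. x \<in> cball a d \<Longrightarrow> y \<in> cball b e \<Longrightarrow> bieval D A' x y = 0 \<Longrightarrow>
       \<exists>\<sigma>\<in>ball 0 \<eta>. x = a + \<sigma> ^ p \<and> y = \<psi> \<sigma>"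
    using branch_isolating_box[OF br open_UNIV UNIV_I] by metis
  \<comment> \<open>\<open>M\<close> bounds the limit and almost all \<open>B n\<close> on the
    closed box. Dividing by \<open>M\<close> produces the bound 1 required by
    \<open>fibre_norm_bound\<close> and \<open>schwarz_bound\<close> and leaves orders
    unchanged.\<close>
  obtain M where M: "M > 0" "\<And>x y. x \<in> cball a d \<Longrightarrow> y \<in> cball b e \<Longrightarrow> norm (bieval D B' x y) \<le> M"
    and evM: "\<forall>\<^sub>F n in sequentially. \<forall>z\<in>cball a d \<times> cball b e. norm (bieval_at D (B n) z) \<le> M"
  proof -
    have "compact (cball a d \<times> cball b e)" by (intro compact_Times) auto
    then have "bounded ((\<lambda>z. bieval_at D B' z) ` (cball a d \<times> cball b e))"
      by (intro compact_imp_bounded compact_continuous_image continuous_intros)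
    then obtain M0 where "\<forall>v\<in>(\<lambda>z. bieval_at D B' z) ` (cball a d \<times> cball b e). norm v \<le> M0"
      unfolding bounded_iff by blast
    then have M0: "\<And>z. z \<in> cball a d \<times> cball b e \<Longrightarrow> norm (bieval_at D B' z) \<le> M0" by blast
    define R where "R = norm a + d + norm b + e"
    have "norm (fst z) \<le> R" "norm (snd z) \<le> R" if "z \<in> cball a d \<times> cball b e" for z
    proof -
      have "dist a (fst z) \<le> d" "dist b (snd z) \<le> e" using that by (auto simp: mem_Times_iff)
      then have "norm (fst z) \<le> norm a + d" "norm (snd z) \<le> norm b + e"
        using norm_triangle_ineq2[of "fst z" a] norm_triangle_ineq2[of "snd z" b]
        by (auto simp: dist_norm norm_minus_commute)
      moreover have "norm a \<ge> 0" "norm b \<ge> 0" by auto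
      ultimately show "norm (fst z) \<le> R" "norm (snd z) \<le> R" using d e unfolding R_def by linarith+
    qed
    then have "uniform_limit (cball a d \<times> cball b e) (\<lambda>n z. bieval_at D (B n) z)
        (\<lambda>z. bieval_at D B' z) sequentially"
      using B by (intro uniform_limit_bieval) auto
    then have "\<forall>\<^sub>F n in sequentially. \<forall>z\<in>cball a d \<times> cball b e.
        dist (bieval_at D (B n) z) (bieval_at D B' z) < 1"
      by (rule uniform_limitD) simp
    then have ev: "\<forall>\<^sub>F n in sequentially. \<forall>z\<in>cball a d \<times> cball b e. norm (bieval_at D (B n) z) \<le> max M0 0 + 1"
    proof eventually_elim
      case (elim n)
      show ?case
      proof
        fix z assume "z \<in> cball a d \<times> cball b e"
        with elim M0 have "dist (bieval_at D (B n) z) (bieval_at D B' z) < 1"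
          "norm (bieval_at D B' z) \<le> M0" by blast+
        then show "norm (bieval_at D (B n) z) \<le> max M0 0 + 1"
          using norm_triangle_ineq2[of "bieval_at D (B n) z" "bieval_at D B' z"]
          by (auto simp: dist_norm)
      qed
    qed
    show thesis
    proof (rule that[OF _ _ ev])
      fix x y assume "x \<in> cball a d" "y \<in> cball b e"
      then show "norm (bieval D B' x y) \<le> max M0 0 + 1" using M0[of "(x, y)"] by auto
    qed auto
  qed
  define Bs where "Bs n i j = B n i j / of_real M" for n i j
  define Bs' where "Bs' i j = B' i j / of_real M" for i j
  have Bs: "bieval D (Bs n) x y = bieval D (B n) x y / of_real M" for n x y
    unfolding Bs_def by (rule bieval_scale)
  have Bs': "bieval D Bs' x y = bieval D B' x y / of_real M" for x y
    unfolding Bs'_def by (rule bieval_scale)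
  have Bslim: "coeffs_tendsto Bs Bs'"
    using B M(1) unfolding Bs_def Bs'_def by (auto intro!: tendsto_intros)
  define N where "N n = fibre_norm D (A n) (Bs n) b e" for n
  define N' where "N' = fibre_norm D A' Bs' b e"
  have "\<exists>k>0. (\<forall>z\<in>cball a d \<times> sphere b e. k \<le> norm (bieval_at D A' z)) \<and>
    (\<forall>\<^sub>F n in sequentially. \<forall>z\<in>cball a d \<times> sphere b e. k \<le> norm (bieval_at D (A n) z))"
    by (rule eventually_bieval_nonzero[OF A])
       (use nz in \<open>auto intro!: compact_Times continuous_intros\<close>)
  then obtain k where k: "k > 0"
    "\<forall>\<^sub>F n in sequentially. \<forall>z\<in>cball a d \<times> sphere b e. k \<le> norm (bieval_at D (A n) z)" by blast
  have evnz: "\<forall>\<^sub>F n in sequentially. \<forall>x\<in>cball a d. \<forall>y\<in>sphere b e. bieval D (A n) x y \<noteq> 0"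
    using k(2) by eventually_elim (use k(1) in force)
  \<comment> \<open>The radius \<open>d / 4\<close> is the one allowed for zeros in
    \<open>schwarz_bound\<close>.\<close>
  have evz: "\<forall>\<^sub>F n in sequentially. \<forall>j\<in>J. z n j \<in> ball a (d / 4) \<times> ball b e"
    using J lim d e
    by (intro eventually_ball_finite ballI topological_tendstoD[OF lim] open_Times) auto
  have bound: "\<forall>\<^sub>F n in sequentially. \<forall>x\<in>ball a (d / 2). norm (N n x) \<le> (\<Prod>j\<in>J. (4 / d * norm (x - fst (z n j))) ^ m j)"
    using evnz evz evM
  proof eventually_elim
    case (elim n)
    have nzn: "\<forall>x\<in>ball a d. \<forall>y\<in>sphere b e. bieval D (A n) x y \<noteq> 0" using elim(1) by auto
    have le1: "norm (bieval D (Bs n) x y) \<le> 1" if "x \<in> ball a d" "y \<in> ball b e" for x y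
      using elim(3) that M(1) by (auto simp: Bs norm_divide)
    define X where "X = (fst \<circ> z n) ` J"
    \<comment> \<open>Different points \<open>z n j\<close> may have the same first coordinate
      \<open>\<xi>\<close>; they are grouped, and the zero at \<open>\<xi>\<close> is given the sum
      of their orders.\<close>
    define J\<xi> where "J\<xi> \<xi> = {j\<in>J. (fst \<circ> z n) j = \<xi>}" for \<xi>
    have le1N: "norm (N n x) \<le> 1" if "x \<in> ball a d" for x
      using fibre_norm_bound[OF e, of b D "A n" x "Bs n" "{}"] nzn le1 that by (simp add: N_def)
    have Xsub: "X \<subseteq> ball a (d / 4)" using elim(2) by (auto simp: X_def mem_Times_iff)
    have zeros: "\<exists>K. \<forall>\<^sub>F x in at \<xi>. norm (N n x) \<le> K * norm (x - \<xi>) ^ (\<Sum>j\<in>J\<xi> \<xi>. m j)" if "\<xi> \<in> X" for \<xi>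
    proof -
      have \<xi>: "\<xi> \<in> ball a d" using that Xsub d by (auto simp: subset_iff)
      have "\<exists>q \<eta>' \<psi>' C'. branch (bizeros D (A n)) \<xi> (snd (z n j)) q \<eta>' \<psi>' \<and>
          (\<forall>\<^sub>F \<sigma> in nhds 0. norm (bieval D (Bs n) (\<xi> + \<sigma> ^ q) (\<psi>' \<sigma>)) \<le> C' * norm \<sigma> ^ m j)"
        if j: "j \<in> J\<xi> \<xi>" for j
      proof -
        have jJ: "j \<in> J" and zj: "z n j = (\<xi>, snd (z n j))" using j by (auto simp: J\<xi>_def prod_eq_iff)
        have lp': "local_param (bizeros D (A n)) (\<xi>, snd (z n j)) (V n j) (\<gamma> n j)"
          using lp[OF jJ, of n] zj by simp
        have "b + of_real e \<in> sphere b e" using e by (simp add: dist_norm)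
        then have "bieval D (A n) \<xi> (b + of_real e) \<noteq> 0" using nzn \<xi> by blast
        \<comment> \<open>The fibre over \<open>\<xi>\<close> is not contained in the curve, since
          the curve misses the circle; so the first coordinate is nonconstant along the branch at
          \<open>z n j\<close> as well.\<close>
        from local_param_imp_branch[OF lp' local_param_not_const[OF lp' this]]
        obtain q \<eta>' \<psi>' \<theta> cc where q: "branch (bizeros D (A n)) \<xi> (snd (z n j)) q \<eta>' \<psi>'" "cc > 0"
          "\<And>\<sigma>. \<sigma> \<in> ball 0 \<eta>' \<Longrightarrow> \<theta> \<sigma> \<in> V n j \<and> \<gamma> n j (\<theta> \<sigma>) = (\<xi> + \<sigma> ^ q, \<psi>' \<sigma>)"
          "\<And>\<sigma>. \<sigma> \<in> ball 0 \<eta>' \<Longrightarrow> norm (\<theta> \<sigma>) \<le> cc * norm \<sigma> \<and> norm \<sigma> \<le> cc * norm (\<theta> \<sigma>)"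
          "continuous_on (ball 0 \<eta>') \<theta>" by metis
        have \<eta>': "\<eta>' > 0" using q(1) by (simp add: branch_def)
        have "\<theta> 0 = 0" using q(4)[of 0] \<eta>' by simp
        moreover have "isCont \<theta> 0" using q(5) \<eta>' by (simp add: continuous_on_eq_continuous_at)
        ultimately have "filterlim \<theta> (nhds 0) (nhds 0)"
          by (metis isCont_def tendsto_at_iff_tendsto_nhds)
        from filterlim_iff[THEN iffD1, OF this, rule_format, OF ordn[OF jJ, of n]]
        have ev1: "\<forall>\<^sub>F \<sigma> in nhds 0. norm (bieval_at D (B n) (\<gamma> n j (\<theta> \<sigma>)))
          \<le> C n j * norm (\<theta> \<sigma>) ^ m j" .
        have "\<forall>\<^sub>F \<sigma> in nhds 0. \<sigma> \<in> ball 0 \<eta>'" using \<eta>' by (intro eventually_nhds_in_open) auto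
        with ev1 have "\<forall>\<^sub>F \<sigma> in nhds 0. norm (bieval D (Bs n) (\<xi> + \<sigma> ^ q) (\<psi>' \<sigma>)) \<le> \<bar>C n j\<bar> * cc ^ m j / M * norm \<sigma> ^ m j"
        proof eventually_elim
          case (elim \<sigma>)
          have "norm (bieval D (B n) (\<xi> + \<sigma> ^ q) (\<psi>' \<sigma>)) \<le> C n j * norm (\<theta> \<sigma>) ^ m j"
            using elim(1) q(3)[OF elim(2)] by simp
          also have "\<dots> \<le> \<bar>C n j\<bar> * norm (\<theta> \<sigma>) ^ m j" by (intro mult_right_mono) auto
          also have "\<dots> \<le> \<bar>C n j\<bar> * (cc * norm \<sigma>) ^ m j"
            using q(4)[OF elim(2)] by (intro mult_left_mono power_mono) auto
          finally have "norm (bieval D (B n) (\<xi> + \<sigma> ^ q) (\<psi>' \<sigma>)) / M \<le> \<bar>C n j\<bar> * (cc * norm \<sigma>) ^ m j / M"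
            using M(1) by (intro divide_right_mono) auto
          then show ?case using M(1) by (simp add: Bs norm_divide power_mult_distrib mult_ac)
        qed
        then show ?thesis using q(1) by blast
      qed
      then have "\<forall>j\<in>J\<xi> \<xi>. \<exists>X. case X of (q, \<eta>', \<psi>', C') \<Rightarrow> branch (bizeros D (A n)) \<xi> (snd (z n j)) q \<eta>' \<psi>' \<and>
          (\<forall>\<^sub>F \<sigma> in nhds 0. norm (bieval D (Bs n) (\<xi> + \<sigma> ^ q) (\<psi>' \<sigma>)) \<le> C' * norm \<sigma> ^ m j)"
        by fast
      from bchoice[OF this] obtain X where X: "\<forall>j\<in>J\<xi> \<xi>. case X j of (q, \<eta>', \<psi>', C') \<Rightarrow>
          branch (bizeros D (A n)) \<xi> (snd (z n j)) q \<eta>' \<psi>' \<and>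
          (\<forall>\<^sub>F \<sigma> in nhds 0. norm (bieval D (Bs n) (\<xi> + \<sigma> ^ q) (\<psi>' \<sigma>)) \<le> C' * norm \<sigma> ^ m j)" by blast
      define q \<eta>' \<psi>' C' where "q j = fst (X j)" and "\<eta>' j = fst (snd (X j))"
        and "\<psi>' j = fst (snd (snd (X j)))" and "C' j = snd (snd (snd (X j)))" for j
      have q: "branch (bizeros D (A n)) \<xi> (snd (z n j)) (q j) (\<eta>' j) (\<psi>' j)"
        "\<forall>\<^sub>F \<sigma> in nhds 0. norm (bieval D (Bs n) (\<xi> + \<sigma> ^ q j) (\<psi>' j \<sigma>)) \<le> C' j * norm \<sigma> ^ m j"
        if "j \<in> J\<xi> \<xi>" for j
        using bspec[OF X that] by (simp_all add: q_def \<eta>'_def \<psi>'_def C'_def case_prod_beta)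
      show ?thesis unfolding N_def
      proof (rule fibre_norm_upper[OF e nzn le1 \<xi> _ _ _ q])
        show "finite (J\<xi> \<xi>)" using J by (simp add: J\<xi>_def)
        show "inj_on (\<lambda>j. snd (z n j)) (J\<xi> \<xi>)"
        proof (rule inj_onI)
          fix i j assume ij: "i \<in> J\<xi> \<xi>" "j \<in> J\<xi> \<xi>" "snd (z n i) = snd (z n j)"
          then have "z n i = z n j" by (auto simp: J\<xi>_def prod_eq_iff)
          then show "i = j" using inj[of n] ij by (auto simp: J\<xi>_def dest: inj_onD)
        qed
        show "snd (z n j) \<in> ball b e" if "j \<in> J\<xi> \<xi>" for j
          using elim(2) that by (auto simp: J\<xi>_def mem_Times_iff)
      qed auto
    qed
    show ?case
    proof
      fix x assume x: "x \<in> ball a (d / 2)"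
      have "norm (N n x) \<le> (\<Prod>\<xi>\<in>X. (4 / d * norm (x - \<xi>)) ^ (\<Sum>j\<in>J\<xi> \<xi>. m j))"
      proof (rule schwarz_bound[OF _ Xsub _ le1N zeros x])
        show "finite X" using J by (simp add: X_def)
        show "N n holomorphic_on ball a d" unfolding N_def by (rule holomorphic_on_fibre_norm[OF e nzn])
      qed
      also have "\<dots> = (\<Prod>\<xi>\<in>X. \<Prod>j\<in>J\<xi> \<xi>. (4 / d * norm (x - fst (z n j))) ^ m j)"
        unfolding power_sum by (intro prod.cong refl) (auto simp: J\<xi>_def)
      also have "\<dots> = (\<Prod>j\<in>J. (4 / d * norm (x - fst (z n j))) ^ m j)"
        unfolding X_def J\<xi>_def by (rule prod.image_gen[OF J, symmetric])
      finally show "norm (N n x) \<le> (\<Prod>j\<in>J. (4 / d * norm (x - fst (z n j))) ^ m j)" .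
    qed
  qed
  define S where "S = (\<Sum>j\<in>J. m j)"
  have upper: "norm (N' x) \<le> (4 / d) ^ S * norm (x - a) ^ S" if x: "x \<in> ball a (d / 2)" for x
  proof -
    have xd: "x \<in> cball a d" using x d by auto
    have "(\<lambda>n. N n x) \<longlonglongrightarrow> N' x"
      unfolding N_def N'_def
    proof (rule tendsto_fibre_norm[OF e A Bslim])
      show "\<forall>y\<in>sphere b e. bieval D A' x y \<noteq> 0" using nz xd by blast
      show "\<forall>\<^sub>F n in sequentially. \<forall>y\<in>sphere b e. bieval D (A n) x y \<noteq> 0"
        using evnz by eventually_elim (use xd in blast)
    qed
    then have 1: "(\<lambda>n. norm (N n x)) \<longlonglongrightarrow> norm (N' x)" by (rule tendsto_norm)
    have "(\<lambda>n. fst (z n j)) \<longlonglongrightarrow> a" if "j \<in> J" for j using tendsto_fst[OF lim[OF that]] by simp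
    then have 2: "(\<lambda>n. \<Prod>j\<in>J. (4 / d * norm (x - fst (z n j))) ^ m j) \<longlonglongrightarrow> (\<Prod>j\<in>J. (4 / d * norm (x - a)) ^ m j)"
      by (intro tendsto_intros)
    \<comment> \<open>The constants \<open>C n j\<close>, which may be unbounded in
      \<open>n\<close>, have disappeared from \<open>bound\<close>, so the inequality passes to the
      limit.\<close>
    have "norm (N' x) \<le> (\<Prod>j\<in>J. (4 / d * norm (x - a)) ^ m j)"
      by (rule tendsto_le[OF _ 2 1]) (use bound x in \<open>auto elim: eventually_mono\<close>)
    also have "\<dots> = (4 / d * norm (x - a)) ^ S" by (simp add: S_def power_sum)
    finally show ?thesis by (simp only: power_mult_distrib)
  qed
  have "\<exists>K>0. \<forall>\<^sub>F x in at a. K * norm (x - a) ^ m0 \<le> norm (N' x)"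
    unfolding N'_def
  proof (rule fibre_norm_lower[OF e d _ _ p inj\<psi> simple])
    show "c / M > 0" using ord(1) M(1) by simp
    show "\<forall>\<^sub>F \<sigma> in nhds 0. c / M * norm \<sigma> ^ m0 \<le> norm (bieval D Bs' (a + \<sigma> ^ p) (\<psi> \<sigma>))"
      using ord(2) by eventually_elim (use M(1) in \<open>auto simp: Bs' norm_divide intro: divide_right_mono\<close>)
    show "\<exists>\<sigma>\<in>ball 0 \<eta>. x = a + \<sigma> ^ p \<and> y = \<psi> \<sigma>"
      if "x \<in> ball a d" "y \<in> ball b e" "bieval D A' x y = 0" for x y
      using roots[of x y] that by auto
  qed (use nz in auto)
  then obtain K where K: "K > 0" "\<forall>\<^sub>F x in at a. K * norm (x - a) ^ m0 \<le> norm (N' x)" by blast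
  show ?thesis
  proof (rule ccontr)
    assume "\<not> ?thesis"
    \<comment> \<open>If the sum exceeded \<open>m0\<close>, dividing both bounds by
      \<open>norm (x - a) ^ m0\<close> and letting \<open>x\<close> tend to \<open>a\<close> would
      give \<open>K \<le> 0\<close>.\<close>
    then obtain s where s: "S = m0 + s" "s > 0" by (auto simp: S_def not_le less_iff_Suc_add)
    have "\<forall>\<^sub>F x in at a. x \<in> ball a (d / 2) - {a}" using d by (intro eventually_at_in_open) auto
    with K(2) have "\<forall>\<^sub>F x in at a. K \<le> (4 / d) ^ S * norm (x - a) ^ s"
    proof eventually_elim
      case (elim x)
      note elim(1)
      also have "norm (N' x) \<le> (4 / d) ^ S * norm (x - a) ^ S" using upper elim(2) by blast
      also have "\<dots> = ((4 / d) ^ S * norm (x - a) ^ s) * norm (x - a) ^ m0"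
        by (simp add: s(1) power_add)
      finally have "K * norm (x - a) ^ m0 \<le> ((4 / d) ^ S * norm (x - a) ^ s) * norm (x - a) ^ m0" .
      moreover have "norm (x - a) ^ m0 > 0" using elim by simp
      ultimately show ?case using mult_right_le_imp_le by blast
    qed
    moreover have "((\<lambda>x. (4 / d) ^ S * norm (x - a) ^ s) \<longlongrightarrow> (4 / d) ^ S * norm (a - a) ^ s) (at a)"
      by (intro tendsto_intros)
    ultimately have "K \<le> (4 / d) ^ S * norm (a - a) ^ s"
      using tendsto_lowerbound[OF _ _ trivial_limit_at] by blast
    then show False using K(1) s(2) by (simp add: power_0_left)
  qed
qed


section \<open>Exchange of the coordinates and reduction to a Puiseux parameter\<close>

lemma bizeros_swap: "bizeros D (\<lambda>i j. A j i) = prod.swap ` bizeros D A"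
proof -
  have "bieval D (\<lambda>i j. A j i) x y = bieval D A y x" for x y by (rule bieval_swap)
  then show ?thesis unfolding bizeros_def by force
qed

lemma local_param_swap:
  assumes "local_param C z V \<gamma>"
  shows "local_param (prod.swap ` C) (prod.swap z) V (prod.swap \<circ> \<gamma>)"
proof -
  have cs: "continuous_on X prod.swap" for X :: "(complex \<times> complex) set"
    by (rule continuous_on_swap)
  have hs: "homeomorphism X (prod.swap ` X) prod.swap prod.swap" for X :: "(complex \<times> complex) set"
    by (rule homeomorphismI) (auto simp: cs)
  from assms obtain g where g: "homeomorphism V (\<gamma> ` V) \<gamma> g" by (auto simp: local_param_def)
  from homeomorphism_compose[OF g hs]
  have "homeomorphism V ((prod.swap \<circ> \<gamma>) ` V) (prod.swap \<circ> \<gamma>) (g \<circ> prod.swap)"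
    by (simp add: image_comp)
  moreover have "openin (top_of_set (prod.swap ` C)) ((prod.swap \<circ> \<gamma>) ` V)"
    using homeomorphism_imp_open_map[OF hs[of C], of "\<gamma> ` V"] assms by (simp add: local_param_def image_comp)
  moreover have "fst \<circ> (prod.swap \<circ> \<gamma>) = snd \<circ> \<gamma>" "snd \<circ> (prod.swap \<circ> \<gamma>) = fst \<circ> \<gamma>" by auto
  ultimately show ?thesis using assms unfolding local_param_def by auto
qed

lemma smooth_point_swap:
  assumes "smooth_point C z"
  shows "smooth_point (prod.swap ` C) (prod.swap z)"
proof -
  from assms obtain V \<gamma> where *: "local_param C z V \<gamma>" "(deriv (fst \<circ> \<gamma>) 0, deriv (snd \<circ> \<gamma>) 0) \<noteq> (0, 0)"
    by (auto simp: smooth_point_def)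
  moreover have "fst \<circ> (prod.swap \<circ> \<gamma>) = snd \<circ> \<gamma>" "snd \<circ> (prod.swap \<circ> \<gamma>) = fst \<circ> \<gamma>" by auto
  ultimately show ?thesis unfolding smooth_point_def using local_param_swap[OF *(1)] by fastforce
qed

lemma local_param_not_constant:
  assumes "local_param C z V \<gamma>"
  shows "\<not> (\<forall>\<^sub>F t in nhds 0. \<gamma> t = z)"
proof
  assume *: "\<forall>\<^sub>F t in nhds 0. \<gamma> t = z"
  from assms have V: "open V" "0 \<in> V" and "\<exists>g. homeomorphism V (\<gamma> ` V) \<gamma> g"
    by (auto simp: local_param_def)
  then have inj: "inj_on \<gamma> V" by (metis homeomorphism_apply1 inj_onI)
  have "\<forall>\<^sub>F t in nhds 0. t \<in> V \<and> \<gamma> t = z"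
    using eventually_nhds_in_open[OF V] * by eventually_elim auto
  then obtain r where r: "r > 0" "\<And>t. dist t 0 < r \<Longrightarrow> t \<in> V \<and> \<gamma> t = z"
    by (auto simp: eventually_nhds_metric)
  have "of_real (r / 2) \<in> V \<and> \<gamma> (of_real (r / 2)) = z" "0 \<in> V \<and> \<gamma> 0 = z"
    using r by (intro r(2); simp)+
  then have "complex_of_real (r / 2) = 0" using inj by (metis inj_onD)
  then show False using r(1) by simp
qed

text \<open>Derivative of the equation of the curve along the branch. Where
  \<open>\<sigma> \<noteq> 0\<close> or \<open>p = 1\<close> the factor
  \<open>of_nat p * \<sigma> ^ (p - 1)\<close> is nonzero, so if the derivative in \<open>y\<close>
  vanishes then so does the whole gradient.\<close>

lemma branch_deriv_relation:
  assumes br: "branch (bizeros D A) a b p \<eta> \<psi>" and \<sigma>: "\<sigma> \<in> ball 0 \<eta>"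
  shows "bieval D (bdx D A) (a + \<sigma> ^ p) (\<psi> \<sigma>) * (of_nat p * \<sigma> ^ (p - 1))
    + bieval D (bdy D A) (a + \<sigma> ^ p) (\<psi> \<sigma>) * deriv \<psi> \<sigma> = 0"
proof -
  have "\<psi> holomorphic_on ball 0 \<eta>" using br by (simp add: branch_def)
  then have d: "(\<psi> has_field_derivative deriv \<psi> \<sigma>) (at \<sigma>)"
    using \<sigma> by (intro holomorphic_derivI) auto
  have "((\<lambda>t. bieval D A (a + t ^ p) (\<psi> t)) has_field_derivative
      (bieval D (bdx D A) (a + \<sigma> ^ p) (\<psi> \<sigma>) * (of_nat p * \<sigma> ^ (p - 1))
       + bieval D (bdy D A) (a + \<sigma> ^ p) (\<psi> \<sigma>) * deriv \<psi> \<sigma>)) (at \<sigma>)"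
    by (rule bieval_chain) (auto intro!: derivative_eq_intros d)
  moreover have "((\<lambda>t. bieval D A (a + t ^ p) (\<psi> t)) has_field_derivative 0) (at \<sigma>)"
  proof (rule has_field_derivative_transform_within_open[of "\<lambda>_. 0" 0 \<sigma> "ball 0 \<eta>"])
    fix t :: complex assume "t \<in> ball 0 \<eta>"
    from branch_in[OF br this] show "0 = bieval D A (a + t ^ p) (\<psi> t)" by (simp add: bizeros_def)
  qed (use \<sigma> in auto)
  ultimately show ?thesis using DERIV_unique by blast
qed

text \<open>Passage to the Puiseux parameter at \<open>z0\<close>. The order of \<open>B'\<close> is
  kept because \<open>\<theta> \<sigma>\<close> and \<open>\<sigma>\<close> are comparable, and the
  nonvanishing gradient turns into simplicity of the roots by
  \<open>branch_deriv_relation\<close>.\<close>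

lemma intersection_semicontinuity_fst:
  fixes m :: "'j \<Rightarrow> nat"
  assumes A: "coeffs_tendsto A A'" and B: "coeffs_tendsto B B'"
    and lp0: "local_param (bizeros D A') z0 V0 \<gamma>0"
    and nonconst: "\<not> (\<forall>\<^sub>F t in nhds 0. fst (\<gamma>0 t) = fst z0)"
    and grad: "\<forall>\<^sub>F t in at 0. bieval_at D (bdx D A') (\<gamma>0 t) \<noteq> 0 \<or>
                 bieval_at D (bdy D A') (\<gamma>0 t) \<noteq> 0"
    and ord: "c > 0" "\<forall>\<^sub>F t in nhds 0. c * norm t ^ m0 \<le> norm (bieval_at D B' (\<gamma>0 t))"
    and J: "finite J" and inj: "\<And>n. inj_on (z n) J" and lim: "\<And>j. j \<in> J \<Longrightarrow> (\<lambda>n. z n j) \<longlonglongrightarrow> z0"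
    and lp: "\<And>n j. j \<in> J \<Longrightarrow> local_param (bizeros D (A n)) (z n j) (V n j) (\<gamma> n j)"
    and ordn: "\<And>n j. j \<in> J \<Longrightarrow> \<forall>\<^sub>F t in nhds 0.
       norm (bieval_at D (B n) (\<gamma> n j t)) \<le> C n j * norm t ^ m j"
  shows "(\<Sum>j\<in>J. m j) \<le> m0"
proof -
  obtain a b where z0: "z0 = (a, b)" by (cases z0)
  have nc: "\<not> (\<forall>\<^sub>F t in nhds 0. fst (\<gamma>0 t) = a)" using nonconst by (simp add: z0)
  from local_param_imp_branch[OF lp0[unfolded z0] nc]
  obtain p \<eta> \<psi> \<theta> cc where br: "branch (bizeros D A') a b p \<eta> \<psi>" and cc: "cc > 0"
    and \<theta>: "\<And>\<sigma>. \<sigma> \<in> ball 0 \<eta> \<Longrightarrow> \<theta> \<sigma> \<in> V0 \<and> \<gamma>0 (\<theta> \<sigma>) = (a + \<sigma> ^ p, \<psi> \<sigma>)"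
    "\<And>\<sigma>. \<sigma> \<in> ball 0 \<eta> \<Longrightarrow> norm (\<theta> \<sigma>) \<le> cc * norm \<sigma> \<and> norm \<sigma> \<le> cc * norm (\<theta> \<sigma>)"
    and cont: "continuous_on (ball 0 \<eta>) \<theta>"
    by metis
  have \<eta>: "\<eta> > 0" "p > 0" using br by (auto simp: branch_def)
  have "\<theta> 0 = 0" using \<theta>(2)[of 0] \<eta> by simp
  moreover have "isCont \<theta> 0" using cont \<eta> by (simp add: continuous_on_eq_continuous_at)
  ultimately have lim\<theta>: "filterlim \<theta> (nhds 0) (nhds 0)"
    by (metis isCont_def tendsto_at_iff_tendsto_nhds)
  have in\<eta>: "\<forall>\<^sub>F \<sigma> in nhds 0. \<sigma> \<in> ball (0::complex) \<eta>"
    using \<eta> by (intro eventually_nhds_in_open) auto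
  have "\<forall>\<^sub>F \<sigma> in nhds 0. \<theta> \<sigma> \<noteq> 0 \<longrightarrow> bieval_at D (bdx D A') (\<gamma>0 (\<theta> \<sigma>)) \<noteq> 0 \<or>
                 bieval_at D (bdy D A') (\<gamma>0 (\<theta> \<sigma>)) \<noteq> 0"
    using filterlim_iff[THEN iffD1, OF lim\<theta>, rule_format, OF grad[unfolded eventually_at_filter]]
    by (auto elim: eventually_mono)
  with in\<eta> have "\<forall>\<^sub>F \<sigma> in nhds 0. \<sigma> \<noteq> 0 \<longrightarrow> bieval D (bdy D A') (a + \<sigma> ^ p) (\<psi> \<sigma>) \<noteq> 0"
  proof eventually_elim
    case (elim \<sigma>)
    show ?case
    proof (intro impI notI)
      assume "\<sigma> \<noteq> 0" and 0: "bieval D (bdy D A') (a + \<sigma> ^ p) (\<psi> \<sigma>) = 0"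
      then have "bieval D (bdx D A') (a + \<sigma> ^ p) (\<psi> \<sigma>) = 0"
        using branch_deriv_relation[OF br elim(1)] \<eta>(2) by simp
      moreover have "\<theta> \<sigma> \<noteq> 0" using \<theta>(2)[OF elim(1)] \<open>\<sigma> \<noteq> 0\<close> by auto
      ultimately show False using elim 0 \<theta>(1)[OF elim(1)] by simp
    qed
  qed
  then have simple: "\<forall>\<^sub>F \<sigma> in at 0. bieval D (bdy D A') (a + \<sigma> ^ p) (\<psi> \<sigma>) \<noteq> 0"
    by (simp add: eventually_at_filter)
  have "\<forall>\<^sub>F \<sigma> in nhds 0. c * norm (\<theta> \<sigma>) ^ m0 \<le> norm (bieval_at D B' (\<gamma>0 (\<theta> \<sigma>)))"
    using filterlim_iff[THEN iffD1, OF lim\<theta>, rule_format, OF ord(2)] .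
  with in\<eta> have ord': "\<forall>\<^sub>F \<sigma> in nhds 0. c / cc ^ m0 * norm \<sigma> ^ m0 \<le> norm (bieval D B' (a + \<sigma> ^ p) (\<psi> \<sigma>))"
  proof eventually_elim
    case (elim \<sigma>)
    have "norm \<sigma> ^ m0 \<le> (cc * norm (\<theta> \<sigma>)) ^ m0" using \<theta>(2)[OF elim(1)] by (intro power_mono) auto
    then have "c / cc ^ m0 * norm \<sigma> ^ m0 \<le> c / cc ^ m0 * (cc * norm (\<theta> \<sigma>)) ^ m0"
      using cc ord(1) by (intro mult_left_mono) auto
    also have "\<dots> = c * norm (\<theta> \<sigma>) ^ m0" using cc by (simp add: power_mult_distrib)
    finally show ?case using elim(2) \<theta>(1)[OF elim(1)] by simp
  qed
  have "c / cc ^ m0 > 0" using cc ord(1) by simp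
  from intersection_semicontinuity_aux[OF A B br simple this ord' J inj lim[unfolded z0] lp ordn]
  show ?thesis by blast
qed

text \<open>Projection to \<open>x\<close> fails when the first coordinate is constant on the branch
  at \<open>z0\<close>. The coordinates are then exchanged by transposing all arrays; the second
  coordinate cannot be constant too, since the parametrization is injective.\<close>

lemma intersection_semicontinuity:
  fixes m :: "'j \<Rightarrow> nat"
  assumes A: "coeffs_tendsto A A'" and B: "coeffs_tendsto B B'"
    and lp0: "local_param (bizeros D A') z0 V0 \<gamma>0"
    and grad: "\<forall>\<^sub>F t in at 0. bieval_at D (bdx D A') (\<gamma>0 t) \<noteq> 0 \<or>
                 bieval_at D (bdy D A') (\<gamma>0 t) \<noteq> 0"
    and ord: "c > 0" "\<forall>\<^sub>F t in nhds 0. c * norm t ^ m0 \<le> norm (bieval_at D B' (\<gamma>0 t))"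
    and J: "finite J" and inj: "\<And>n. inj_on (z n) J" and lim: "\<And>j. j \<in> J \<Longrightarrow> (\<lambda>n. z n j) \<longlonglongrightarrow> z0"
    and lp: "\<And>n j. j \<in> J \<Longrightarrow> local_param (bizeros D (A n)) (z n j) (V n j) (\<gamma> n j)"
    and ordn: "\<And>n j. j \<in> J \<Longrightarrow> \<forall>\<^sub>F t in nhds 0.
       norm (bieval_at D (B n) (\<gamma> n j t)) \<le> C n j * norm t ^ m j"
  shows "(\<Sum>j\<in>J. m j) \<le> m0"
proof (cases "\<forall>\<^sub>F t in nhds 0. fst (\<gamma>0 t) = fst z0")
  case False
  from intersection_semicontinuity_fst[OF A B lp0 False grad ord J inj lim lp ordn] show ?thesis .
next
  case True
  have sw: "bieval D (\<lambda>i j. X j i) y x = bieval D X x y" for X x y by (rule bieval_swap)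
  let ?s = "prod.swap :: complex \<times> complex \<Rightarrow> complex \<times> complex"
  show ?thesis
  proof (rule intersection_semicontinuity_fst[where A = "\<lambda>n i j. A n j i" and A' = "\<lambda>i j. A' j i" and D = D
        and B = "\<lambda>n i j. B n j i" and B' = "\<lambda>i j. B' j i" and ?z0.0 = "?s z0" and ?\<gamma>0.0 = "?s \<circ> \<gamma>0"
        and z = "\<lambda>n j. ?s (z n j)" and \<gamma> = "\<lambda>n j. ?s \<circ> \<gamma> n j" and V = V and ?V0.0 = V0 and c = c and C = C])
    show "\<forall>i j. (\<lambda>n. A n j i) \<longlonglongrightarrow> A' j i" "\<forall>i j. (\<lambda>n. B n j i) \<longlonglongrightarrow> B' j i" using A B by auto
    show "local_param (bizeros D (\<lambda>i j. A' j i)) (?s z0) V0 (?s \<circ> \<gamma>0)"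
      unfolding bizeros_swap[of D A'] by (rule local_param_swap[OF lp0])
    show "local_param (bizeros D (\<lambda>i ja. A n ja i)) (?s (z n j)) (V n j) (?s \<circ> \<gamma> n j)" if "j \<in> J" for n j
      unfolding bizeros_swap[of D "A n"] by (rule local_param_swap[OF lp[OF that]])
    show "\<not> (\<forall>\<^sub>F t in nhds 0. fst ((?s \<circ> \<gamma>0) t) = fst (?s z0))"
    proof
      assume "\<forall>\<^sub>F t in nhds 0. fst ((?s \<circ> \<gamma>0) t) = fst (?s z0)"
      with True have "\<forall>\<^sub>F t in nhds 0. \<gamma>0 t = z0" by eventually_elim (auto simp: prod_eq_iff)
      then show False using local_param_not_constant[OF lp0] by simp
    qed
    show "\<forall>\<^sub>F t in at 0. bieval D (bdx D (\<lambda>i j. A' j i)) (fst ((?s \<circ> \<gamma>0) t)) (snd ((?s \<circ> \<gamma>0) t)) \<noteq> 0 \<or>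
        bieval D (bdy D (\<lambda>i j. A' j i)) (fst ((?s \<circ> \<gamma>0) t)) (snd ((?s \<circ> \<gamma>0) t)) \<noteq> 0"
      unfolding bdx_swap[of D A'] bdy_swap[of D A'] using grad
      by eventually_elim (auto simp: sw[of "bdx D A'"] sw[of "bdy D A'"])
    show "\<forall>\<^sub>F t in nhds 0. c * norm t ^ m0 \<le> norm (bieval D (\<lambda>i j. B' j i) (fst ((?s \<circ> \<gamma>0) t)) (snd ((?s \<circ> \<gamma>0) t)))"
      using ord(2) by eventually_elim (simp add: sw[of B'])
    show "\<forall>\<^sub>F t in nhds 0. norm (bieval D (\<lambda>i ja. B n ja i) (fst ((?s \<circ> \<gamma> n j) t)) (snd ((?s \<circ> \<gamma> n j) t)))
        \<le> C n j * norm t ^ m j" if "j \<in> J" for n j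
      using ordn[OF that, of n] by eventually_elim (simp add: sw[of "B n"])
    show "inj_on (\<lambda>j. ?s (z n j)) J" for n
    proof (rule inj_onI)
      fix i j assume ij: "i \<in> J" "j \<in> J" "?s (z n i) = ?s (z n j)"
      then have "z n i = z n j" by (metis swap_swap)
      with ij inj[of n] show "i = j" by (meson inj_onD)
    qed
    show "(\<lambda>n. ?s (z n j)) \<longlonglongrightarrow> ?s z0" if "j \<in> J" for j
      using tendsto_Pair[OF tendsto_snd[OF lim[OF that]] tendsto_fst[OF lim[OF that]]] by (simp add: prod.swap_def)
  qed (use ord J in auto)
qed

section \<open>Smooth points and gradients\<close>

text \<open>The implicit function is the first power sum of the roots of a fibre with one simple root.\<close>

lemma smooth_point_of_bdy:
  assumes z: "bieval D A a b = 0" and dy: "bieval D (bdy D A) a b \<noteq> 0"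
  shows "smooth_point (bizeros D A) (a, b)"
proof -
  obtain y0 where y0: "bieval D A a y0 \<noteq> 0"
  proof -
    have "\<not> (\<forall>y. bieval D A a y = 0)"
    proof
      assume "\<forall>y. bieval D A a y = 0"
      then have "bieval D A a = (\<lambda>_. 0)" by auto
      then have "(bieval D A a has_field_derivative 0) (at b)" by simp
      then show False using DERIV_unique[OF has_field_derivative_bieval_y[of D A a b UNIV]] dy by auto
    qed
    then show thesis using that by blast
  qed
  obtain e0 where e0: "e0 > 0" "\<And>y. bieval D A a y = 0 \<Longrightarrow> y \<noteq> b \<Longrightarrow> e0 \<le> dist b y"
    using finite_set_avoid[OF finite_bieval_zeros[OF y0], of b] by auto
  \<comment> \<open>Half the distance from \<open>b\<close> to the other roots over
    \<open>a\<close>, so that \<open>b\<close> is the only one in the closed disc.\<close>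
  define e where "e = e0 / 2"
  have e: "e > 0" "\<And>y. bieval D A a y = 0 \<Longrightarrow> y \<in> cball b e \<Longrightarrow> y = b"
    using e0 by (force simp: e_def)+
  have op: "open {z. bieval_at D A z \<noteq> 0}" by (intro open_Collect_neq continuous_intros)
  have "{a} \<times> sphere b e \<subseteq> {z. bieval_at D A z \<noteq> 0}"
    using e(2) e(1) by fastforce
  from Elementary_Topology.tube_lemma[OF compact_sphere op this]
  obtain X0 where X0: "a \<in> X0" "open X0" "X0 \<times> sphere b e \<subseteq> {z. bieval_at D A z \<noteq> 0}"
    by blast
  obtain d where d: "d > 0" "ball a d \<subseteq> X0" using X0 openE by blast
  have nz: "\<forall>x\<in>ball a d. \<forall>y\<in>sphere b e. bieval D A x y \<noteq> 0" using X0(3) d(2) by fastforce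
  have "b \<in> ball b e" using e by simp
  then have roots_a: "fibre_roots D A b e a = {b}" using z e(2) by (auto simp: fibre_roots_def)
  have "fibre_mult D A a b = 1" using fibre_mult_eq_1_iff[OF y0 z] dy by simp
  then have "fibre_degree D A b e a = 1" by (simp add: fibre_degree_def roots_a)
  then have deg: "fibre_degree D A b e x = 1" if "x \<in> ball a d" for x
    using fibre_degree_constant[OF e(1) nz that, of a] d(1) by simp
  \<comment> \<open>For \<open>D = 0\<close> the array of the derivative would be zero. The monomial
    \<open>y\<close>, with index \<open>j = 1\<close>, therefore lies within the degree bound, as
    needed for \<open>Y\<close>.\<close>
  have "D > 0" using dy by (cases D) (auto simp: bieval_def bdy_def)
  define Y where "Y = (\<lambda>i j. if i = (0::nat) \<and> j = (1::nat) then 1 else (0::complex))"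
  have Y: "bieval D Y x y = y" for x y
  proof -
    have "bieval D Y x y = (\<Sum>i\<le>D. \<Sum>j\<le>D. if j = 1 then (if i = 0 then y else 0) else 0)"
      unfolding bieval_def Y_def by (intro sum.cong refl) auto
    also have "\<dots> = y" using \<open>D > 0\<close> by (simp add: sum.delta)
    finally show ?thesis .
  qed
  define g where "g = (\<lambda>x. power_sum D A b e (\<lambda>y. bieval D Y x y ^ 1) x)"
  have holg: "g holomorphic_on ball a d" unfolding g_def by (rule holomorphic_on_power_sum[OF e(1) nz])
  \<comment> \<open>Total multiplicity 1 leaves exactly one root, of multiplicity 1, and the power
    sum of the coordinate \<open>y\<close> is then this root.\<close>
  have roots: "fibre_roots D A b e x = {g x}" if x: "x \<in> ball a d" for x
  proof -
    have nzx: "\<forall>y\<in>sphere b e. bieval D A x y \<noteq> 0" using nz x by blast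
    have "b + of_real e \<in> sphere b e" using e(1) by (simp add: dist_norm)
    then have nz0: "bieval D A x (b + of_real e) \<noteq> 0" using nzx by blast
    have fin: "finite (fibre_roots D A b e x)" by (rule finite_fibre_roots[OF e(1) nzx])
    have pos: "1 \<le> fibre_mult D A x w" if "w \<in> fibre_roots D A b e x" for w
      using fibre_mult_eq(2)[OF nz0, of w] that by (simp add: fibre_roots_def)
    have "card (fibre_roots D A b e x) = (\<Sum>w\<in>fibre_roots D A b e x. 1)" by simp
    also have "\<dots> \<le> fibre_degree D A b e x" unfolding fibre_degree_def by (intro sum_mono pos)
    finally have "card (fibre_roots D A b e x) \<le> 1" using deg[OF x] by simp
    moreover have "fibre_roots D A b e x \<noteq> {}" using deg[OF x] by (auto simp: fibre_degree_def)
    ultimately have "card (fibre_roots D A b e x) = 1" using fin by (simp add: card_gt_0_iff le_antisym Suc_le_eq)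
    then obtain w where w: "fibre_roots D A b e x = {w}" using card_1_singletonE by blast
    then have "fibre_mult D A x w = 1" using deg[OF x] by (simp add: fibre_degree_def)
    then have "g x = w" by (simp add: g_def power_sum_def w Y)
    then show ?thesis using w by simp
  qed
  define \<gamma> where "\<gamma> t = (a + t, g (a + t))" for t
  have im: "\<gamma> ` ball 0 d = bizeros D A \<inter> (ball a d \<times> ball b e)"
  proof (intro equalityI subsetI)
    fix v assume "v \<in> \<gamma> ` ball 0 d"
    then obtain t where t: "norm t < d" "v = (a + t, g (a + t))" by (auto simp: \<gamma>_def)
    then have at: "a + t \<in> ball a d" by (simp add: dist_norm)
    then have "g (a + t) \<in> fibre_roots D A b e (a + t)" using roots by blast
    then show "v \<in> bizeros D A \<inter> (ball a d \<times> ball b e)" using t at by (simp add: fibre_roots_def bizeros_def)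
  next
    fix v assume v: "v \<in> bizeros D A \<inter> (ball a d \<times> ball b e)"
    then have "snd v \<in> fibre_roots D A b e (fst v)" "fst v \<in> ball a d"
      by (auto simp: fibre_roots_def bizeros_def)
    then have "snd v = g (fst v)" using roots by blast
    then have "v = \<gamma> (fst v - a)" by (simp add: \<gamma>_def prod_eq_iff)
    moreover have "fst v - a \<in> ball 0 d" using \<open>fst v \<in> ball a d\<close> by (simp add: dist_norm norm_minus_commute)
    ultimately show "v \<in> \<gamma> ` ball 0 d" by blast
  qed
  have hol1: "(fst \<circ> \<gamma>) holomorphic_on ball 0 d"
    unfolding \<gamma>_def comp_def fst_conv by (intro holomorphic_intros)
  have "(g \<circ> (\<lambda>t. a + t)) holomorphic_on ball 0 d"
    by (rule holomorphic_on_compose_gen[OF _ holg]) (auto intro!: holomorphic_intros simp: dist_norm)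
  then have hol2: "(snd \<circ> \<gamma>) holomorphic_on ball 0 d" by (simp add: \<gamma>_def comp_def)
  have cont: "continuous_on (ball 0 d) \<gamma>"
    using continuous_on_Pair[OF holomorphic_on_imp_continuous_on[OF hol1] holomorphic_on_imp_continuous_on[OF hol2]]
    by (simp add: comp_def)
  have "homeomorphism (ball 0 d) (\<gamma> ` ball 0 d) \<gamma> (\<lambda>v. fst v - a)"
  proof (rule homeomorphismI[OF cont])
    show "continuous_on (\<gamma> ` ball 0 d) (\<lambda>v. fst v - a)" by (intro continuous_intros)
  qed (auto simp: \<gamma>_def)
  moreover have "openin (top_of_set (bizeros D A)) (\<gamma> ` ball 0 d)"
    unfolding im by (intro openin_open_Int open_Times) auto
  moreover have "\<gamma> 0 = (a, b)"
    using roots[of a] roots_a d(1) by (simp add: \<gamma>_def)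
  ultimately have "local_param (bizeros D A) (a, b) (ball 0 d) \<gamma>"
    unfolding local_param_def using hol1 hol2 d(1) by auto
  moreover have "deriv (fst \<circ> \<gamma>) 0 = 1"
    by (rule DERIV_imp_deriv) (auto simp: \<gamma>_def comp_def intro!: derivative_eq_intros)
  ultimately show ?thesis unfolding smooth_point_def by force
qed

lemma smooth_point_of_gradient:
  assumes z: "bieval D A a b = 0" and g: "bieval D (bdx D A) a b \<noteq> 0 \<or> bieval D (bdy D A) a b \<noteq> 0"
  shows "smooth_point (bizeros D A) (a, b)"
proof (cases "bieval D (bdy D A) a b = 0")
  case True
  have "smooth_point (bizeros D (\<lambda>i j. A j i)) (b, a)"
  proof (rule smooth_point_of_bdy)
    show "bieval D (\<lambda>i j. A j i) b a = 0" using z bieval_swap[of D A b a] by simp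
    show "bieval D (bdy D (\<lambda>i j. A j i)) b a \<noteq> 0"
      unfolding bdy_swap[of D A] using g True bieval_swap[of D "bdx D A" b a] by simp
  qed
  from smooth_point_swap[OF this] show ?thesis
    unfolding bizeros_swap[of D A] by (simp add: image_comp)
qed (use smooth_point_of_bdy z in blast)

text \<open>Over the graph of a smooth branch the fibre has a single root, whose multiplicity is therefore
  constant; it exceeds \<open>1\<close> exactly where the gradient vanishes.\<close>

lemma gradient_zero_locally_fst:
  assumes lp: "local_param (bizeros D A) (a, b) V \<gamma>" and d1: "deriv (fst \<circ> \<gamma>) 0 \<noteq> 0"
    and dy: "bieval D (bdy D A) a b = 0"
  shows "\<exists>T. open T \<and> (a, b) \<in> T \<and> (\<forall>(x, y)\<in>bizeros D A \<inter> T.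
    bieval D (bdx D A) x y = 0 \<and> bieval D (bdy D A) x y = 0)"
proof -
  have "\<not> (\<forall>\<^sub>F t in nhds 0. fst (\<gamma> t) = a)"
  proof
    assume "\<forall>\<^sub>F t in nhds 0. fst (\<gamma> t) = a"
    then have "\<forall>\<^sub>F t in nhds 0. (fst \<circ> \<gamma>) t = a" by simp
    then have "deriv (fst \<circ> \<gamma>) 0 = deriv (\<lambda>_. a) 0" by (rule deriv_cong_ev) simp
    then show False using d1 by simp
  qed
  from local_param_imp_branch[OF lp this] d1
  obtain \<eta> \<psi> where br: "branch (bizeros D A) a b 1 \<eta> \<psi>" by metis
  obtain d e where d: "d > 0" and e: "e > 0"
    and nz: "\<And>x y. x \<in> cball a d \<Longrightarrow> y \<in> sphere b e \<Longrightarrow> bieval D A x y \<noteq> 0"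
    and roots: "\<And>x y. x \<in> cball a d \<Longrightarrow> y \<in> cball b e \<Longrightarrow> bieval D A x y = 0 \<Longrightarrow>
       \<exists>\<sigma>\<in>ball 0 \<eta>. x = a + \<sigma> ^ 1 \<and> y = \<psi> \<sigma>"
    using branch_isolating_box[OF br open_UNIV UNIV_I] by metis
  have nz': "\<forall>x\<in>ball a d. \<forall>y\<in>sphere b e. bieval D A x y \<noteq> 0" using nz by auto
  have bz: "bieval D A a b = 0"
    using branch_in[OF br, of 0] br by (auto simp: branch_def bizeros_def)
  have b_in: "b \<in> ball b e" using e by simp
  have single: "fibre_roots D A b e x = {y} \<and> x - a \<in> ball 0 \<eta> \<and> y = \<psi> (x - a)"
    if "x \<in> ball a d" "y \<in> ball b e" "bieval D A x y = 0" for x y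
  proof -
    have *: "x - a \<in> ball 0 \<eta> \<and> w = \<psi> (x - a)" if w: "w \<in> ball b e" "bieval D A x w = 0" for w
      using roots[of x w] \<open>x \<in> ball a d\<close> w by auto
    from *[of y] *[of _] that show ?thesis by (auto simp: fibre_roots_def)
  qed
  have spt: "bieval D A x (b + of_real e) \<noteq> 0" if "x \<in> ball a d" for x
    using nz[of x "b + of_real e"] that e by (auto simp: dist_norm)
  \<comment> \<open>Since \<open>b\<close> is the only root over \<open>a\<close> but not a simple
    one, the root count differs from 1, first at \<open>a\<close> and then, being constant, over the
    whole disc.\<close>
  have "fibre_mult D A a b \<noteq> 1" using fibre_mult_eq_1_iff[OF spt bz] d dy by auto
  moreover have "fibre_roots D A b e a = {b}"
  proof -
    have "a \<in> ball a d" using d by simp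
    from single[OF this b_in bz] show ?thesis by blast
  qed
  ultimately have dega: "fibre_degree D A b e a \<noteq> 1" by (simp add: fibre_degree_def)
  have "bieval D (bdx D A) x y = 0 \<and> bieval D (bdy D A) x y = 0"
    if "x \<in> ball a d" "y \<in> ball b e" "bieval D A x y = 0" for x y
  proof -
    note s = single[OF that]
    have "fibre_degree D A b e x = fibre_degree D A b e a"
      by (rule fibre_degree_constant[OF e nz']) (use that d in auto)
    then have "fibre_mult D A x y \<noteq> 1" using dega s by (simp add: fibre_degree_def)
    then have 0: "bieval D (bdy D A) x y = 0" using fibre_mult_eq_1_iff[OF spt[OF that(1)] that(3)] by blast
    have "x - a \<in> ball 0 \<eta>" using s by blast
    from branch_deriv_relation[OF br this] have "bieval D (bdx D A) x y = 0" using s 0 by simp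
    with 0 show ?thesis by blast
  qed
  then show ?thesis using d e
    by (intro exI[of _ "ball a d \<times> ball b e"]) (auto simp: bizeros_def intro!: open_Times)
qed

text \<open>At a smooth point one of the two coordinates has nonzero derivative along the curve; it
  is made the first one, if necessary by exchanging coordinates.\<close>

lemma gradient_zero_locally:
  assumes sm: "smooth_point (bizeros D A) (a, b)"
    and dx: "bieval D (bdx D A) a b = 0" and dy: "bieval D (bdy D A) a b = 0"
  shows "\<exists>T. open T \<and> (a, b) \<in> T \<and> (\<forall>(x, y)\<in>bizeros D A \<inter> T.
    bieval D (bdx D A) x y = 0 \<and> bieval D (bdy D A) x y = 0)"
proof -
  from sm obtain V \<gamma> where lp: "local_param (bizeros D A) (a, b) V \<gamma>"
    and d: "deriv (fst \<circ> \<gamma>) 0 \<noteq> 0 \<or> deriv (snd \<circ> \<gamma>) 0 \<noteq> 0" by (auto simp: smooth_point_def)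
  show ?thesis
  proof (cases "deriv (fst \<circ> \<gamma>) 0 = 0")
    case True
    have lp': "local_param (bizeros D (\<lambda>i j. A j i)) (b, a) V (prod.swap \<circ> \<gamma>)"
      using local_param_swap[OF lp] unfolding bizeros_swap[of D A] by simp
    have "fst \<circ> (prod.swap \<circ> \<gamma>) = snd \<circ> \<gamma>" by auto
    then have d': "deriv (fst \<circ> (prod.swap \<circ> \<gamma>)) 0 \<noteq> 0" using d True by simp
    have sx: "bieval D (bdx D (\<lambda>i j. A j i)) y x = bieval D (bdy D A) x y" for x y
      unfolding bdx_swap[of D A] by (rule bieval_swap)
    have sy: "bieval D (bdy D (\<lambda>i j. A j i)) y x = bieval D (bdx D A) x y" for x y
      unfolding bdy_swap[of D A] by (rule bieval_swap)
    from gradient_zero_locally_fst[OF lp' d'] dx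
    obtain T where T: "open T" "(b, a) \<in> T" "\<forall>(y, x)\<in>bizeros D (\<lambda>i j. A j i) \<inter> T.
      bieval D (bdx D (\<lambda>i j. A j i)) y x = 0 \<and> bieval D (bdy D (\<lambda>i j. A j i)) y x = 0"
      unfolding sx sy by blast
    have "open (prod.swap -` T)" by (intro open_vimage T continuous_on_swap)
    moreover have "(a, b) \<in> prod.swap -` T" using T by simp
    moreover have "\<forall>(x, y)\<in>bizeros D A \<inter> prod.swap -` T. bieval D (bdx D A) x y = 0 \<and> bieval D (bdy D A) x y = 0"
    proof -
      have "bieval D (bdx D A) x y = 0 \<and> bieval D (bdy D A) x y = 0"
        if "(x, y) \<in> bizeros D A" "(y, x) \<in> T" for x y
      proof -
        have "(y, x) \<in> bizeros D (\<lambda>i j. A j i) \<inter> T" using that unfolding bizeros_swap[of D A] by force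
        from bspec[OF T(3) this] show ?thesis unfolding case_prod_conv sx sy by blast
      qed
      then show ?thesis by auto
    qed
    ultimately show ?thesis by blast
  qed (use gradient_zero_locally_fst[OF lp _ dy] in blast)
qed


section \<open>Deformations and small balls\<close>

definition bicoeff :: "bipoly \<Rightarrow> nat \<Rightarrow> nat \<Rightarrow> complex" where
  "bicoeff P i j = Polynomial.coeff (Polynomial.coeff P j) i"

lemma poly_eq_sum_atMost:
  fixes p :: "'a::comm_semiring_1 poly"
  assumes "\<And>i. i > D \<Longrightarrow> Polynomial.coeff p i = 0"
  shows "poly p x = (\<Sum>i\<le>D. Polynomial.coeff p i * x ^ i)"
proof -
  have "Polynomial.degree p \<le> D" using assms by (intro degree_le) auto
  then have "(\<Sum>i\<le>Polynomial.degree p. Polynomial.coeff p i * x ^ i) = (\<Sum>i\<le>D. Polynomial.coeff p i * x ^ i)"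
    by (intro sum.mono_neutral_left) (auto simp: coeff_eq_0)
  then show ?thesis by (simp add: poly_altdef)
qed

lemma eval2_eq_bieval:
  assumes "\<And>i j. i > D \<or> j > D \<Longrightarrow> bicoeff P i j = 0"
  shows "eval2 P z = bieval_at D (bicoeff P) z"
proof -
  have 1: "Polynomial.coeff P j = 0" if "j > D" for j
    using assms that by (intro poly_eqI) (auto simp: bicoeff_def)
  have 2: "poly (Polynomial.coeff P j) x = (\<Sum>i\<le>D. bicoeff P i j * x ^ i)" for j x
    unfolding bicoeff_def by (rule poly_eq_sum_atMost) (use assms in \<open>auto simp: bicoeff_def\<close>)
  have "eval2 P z = poly (\<Sum>j\<le>D. Polynomial.coeff P j * [:snd z:] ^ j) (fst z)"
    unfolding eval2_def by (subst poly_eq_sum_atMost[of D P]) (use 1 in auto)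
  also have "\<dots> = (\<Sum>j\<le>D. (\<Sum>i\<le>D. bicoeff P i j * fst z ^ i) * snd z ^ j)"
    by (simp add: poly_sum 2)
  finally show ?thesis by (simp add: bieval_alt)
qed

lemma zero_set_eq_bizeros:
  assumes "\<And>i j. i > D \<or> j > D \<Longrightarrow> bicoeff P i j = 0"
  shows "zero_set P = bizeros D (bicoeff P)"
  unfolding zero_set_def bizeros_def using eval2_eq_bieval[OF assms] by auto

lemma gradient_eq:
  assumes "\<And>i j. i > D \<or> j > D \<Longrightarrow> bicoeff P i j = 0"
  shows "gradient P z = (bieval D (bdx D (bicoeff P)) (fst z) (snd z), bieval D (bdy D (bicoeff P)) (fst z) (snd z))"
proof -
  have x: "bicoeff (map_poly pderiv P) i j = bdx D (bicoeff P) i j" for i j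
    using assms[of "Suc i" j] by (simp add: bicoeff_def bdx_def coeff_map_poly coeff_pderiv)
  have y: "bicoeff (pderiv P) i j = bdy D (bicoeff P) i j" for i j
    using assms[of i "Suc j"]
    by (simp add: bicoeff_def bdy_def coeff_pderiv of_nat_poly del: of_nat_Suc)
  have "eval2 (map_poly pderiv P) z = bieval D (bicoeff (map_poly pderiv P)) (fst z) (snd z)"
    by (rule eval2_eq_bieval) (use assms in \<open>auto simp: x bdx_def\<close>)
  moreover have "eval2 (pderiv P) z = bieval D (bicoeff (pderiv P)) (fst z) (snd z)"
    by (rule eval2_eq_bieval) (use assms in \<open>auto simp: y bdy_def\<close>)
  moreover have "bicoeff (map_poly pderiv P) = bdx D (bicoeff P)" "bicoeff (pderiv P) = bdy D (bicoeff P)"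
    by (auto simp: fun_eq_iff x y)
  ultimately show ?thesis by (simp add: gradient_def)
qed

lemma finite_bicoeff: "finite {(i, j). bicoeff P i j \<noteq> 0}"
proof (rule finite_subset)
  show "{(i, j). bicoeff P i j \<noteq> 0} \<subseteq>
     (\<Union>j\<le>Polynomial.degree P. {..Polynomial.degree (Polynomial.coeff P j)} \<times> {j})"
    by (force simp: bicoeff_def intro: le_degree)
qed auto

text \<open>Exhaustion by closed discs of radius \<open>1 - 1 / (n + 1)\<close>; the countability of
  zero sets is applied to the open unit disc in this form.\<close>

lemma fsigma_unit_ball: "fsigma (ball (0::complex) 1)"
proof -
  have "ball (0::complex) 1 = (\<Union>n. cball 0 (1 - inverse (real (Suc n))))"
  proof (intro equalityI subsetI)
    fix x :: complex assume "x \<in> ball 0 1"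
    then obtain n where "inverse (real (Suc n)) < 1 - norm x" using reals_Archimedean[of "1 - norm x"] by auto
    then have "x \<in> cball 0 (1 - inverse (real (Suc n)))" by simp
    then show "x \<in> (\<Union>n. cball 0 (1 - inverse (real (Suc n))))" by blast
  next
    fix x :: complex assume "x \<in> (\<Union>n. cball 0 (1 - inverse (real (Suc n))))"
    then obtain n where "norm x \<le> 1 - inverse (real (Suc n))" by auto
    moreover have "inverse (real (Suc n)) > 0" by simp
    ultimately show "x \<in> ball 0 1" unfolding mem_ball_0 by linarith
  qed
  then show ?thesis by (simp only: fsigma.intros closed_cball)
qed

text \<open>The coefficients that do not vanish identically have countable zero sets, so for some \<open>s\<close> none of
  them vanishes; as \<open>F s\<close> is a polynomial there are finitely many.\<close>

lemma deformation_bounded_degree: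
  assumes "deformation F"
  shows "\<exists>D. \<forall>s\<in>ball 0 1. \<forall>i j. i > D \<or> j > D \<longrightarrow> bicoeff (F s) i j = 0"
proof -
  have hol: "(\<lambda>s. bicoeff (F s) i j) holomorphic_on ball 0 1" for i j
    using assms by (simp add: deformation_def bicoeff_def)
  define NZ where "NZ = {(i, j). \<exists>s\<in>ball 0 1. bicoeff (F s) i j \<noteq> 0}"
  define Z where "Z ij = {s\<in>ball 0 1. bicoeff (F s) (fst ij) (snd ij) = 0}" for ij
  have "countable (Z ij)" if ij: "ij \<in> NZ" for ij
  proof -
    obtain s where s: "s \<in> ball 0 1" "bicoeff (F s) (fst ij) (snd ij) \<noteq> 0" using ij by (auto simp: NZ_def)
    show ?thesis
    proof (cases "(\<lambda>s. bicoeff (F s) (fst ij) (snd ij)) constant_on ball 0 1")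
      case True
      then have "Z ij = {}" using s unfolding constant_on_def Z_def by fastforce
      then show ?thesis by simp
    next
      case False
      then show ?thesis unfolding Z_def
        by (intro holomorphic_countable_zeros hol) (auto intro: fsigma_unit_ball)
    qed
  qed
  then have "countable (\<Union>ij\<in>NZ. Z ij)" by (intro countable_UN) auto
  moreover have "uncountable (ball (0::complex) 1)" by (rule uncountable_ball) simp
  ultimately obtain s where s: "s \<in> ball 0 1" "s \<notin> (\<Union>ij\<in>NZ. Z ij)"
    using countable_subset by (metis subsetI)
  then have "NZ \<subseteq> {(i, j). bicoeff (F s) i j \<noteq> 0}" by (force simp: Z_def)
  then have fin: "finite NZ" using finite_bicoeff finite_subset by blast
  define D where "D = Max (insert 0 (fst ` NZ \<union> snd ` NZ))"
  have "i \<le> D \<and> j \<le> D" if "(i, j) \<in> NZ" for i j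
    using fin that unfolding D_def by (intro conjI Max_ge) (auto intro: rev_image_eqI)
  then show ?thesis by (intro exI[of _ D]) (force simp: NZ_def)
qed

text \<open>The homeomorphism \<open>h\<close> fixes the apex and maps the straight cone onto the
  curve, so the punctured curve is the continuous image of the connected set
  \<open>{0<..1} \<times> L\<close>. Letting the cone parameter tend to 0 gives points of it
  arbitrarily close to \<open>z\<close>.\<close>

lemma connected_punctured_small_ball:
  assumes "small_radius C z r"
  shows "connected (C \<inter> cball z r - {z})"
    and "e > 0 \<Longrightarrow> C \<inter> cball z r - {z} \<noteq> {} \<Longrightarrow> C \<inter> cball z r \<inter> ball z e - {z} \<noteq> {}"
proof -
  define L where "L = C \<inter> sphere z r"
  from assms have r: "r > 0" and L: "connected L" by (auto simp: small_radius_def is_knot_def L_def)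
  from assms obtain h g where h: "homeomorphism (cball z r) (cball z r) h g" "h z = z"
    "h ` straight_cone z L = C \<inter> cball z r" by (auto simp: small_radius_def L_def)
  have injh: "inj_on h (cball z r)" by (intro inj_on_inverseI[of _ g] homeomorphism_apply1[OF h(1)])
  have dist_re: "dist z (rescale z t p) = \<bar>t\<bar> * r" if "p \<in> L" for t p
    using that by (simp add: rescale_def L_def dist_norm norm_minus_commute)
  have in_ball: "rescale z t p \<in> cball z r" if "p \<in> L" "t \<in> {0..1}" for t p
    using that dist_re[of p t] r mult_left_le_one_le[of r t] by auto
  have eq: "C \<inter> cball z r - {z} = (\<lambda>(t, p). h (rescale z t p)) ` ({0<..1} \<times> L)"
  proof (intro equalityI subsetI)
    fix w assume w: "w \<in> C \<inter> cball z r - {z}"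
    then obtain t p where tp: "t \<in> {0..1}" "p \<in> L" "w = h (rescale z t p)"
      unfolding h(3)[symmetric] straight_cone_def by auto
    moreover have "t \<noteq> 0" using w tp h(2) by (auto simp: rescale_def)
    ultimately show "w \<in> (\<lambda>(t, p). h (rescale z t p)) ` ({0<..1} \<times> L)"
      by (intro image_eqI[of _ _ "(t, p)"]) auto
  next
    fix w assume "w \<in> (\<lambda>(t, p). h (rescale z t p)) ` ({0<..1} \<times> L)"
    then obtain t p where tp: "0 < t" "t \<le> 1" "p \<in> L" "w = h (rescale z t p)" by auto
    have "rescale z t p \<in> straight_cone z L" 
      unfolding straight_cone_def mem_Collect_eq by (intro exI[of _ t] exI[of _ p]) (use tp in auto)
    then have "w \<in> C \<inter> cball z r" using tp(4) h(3) by blast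
    moreover have "w \<noteq> z"
    proof
      assume "w = z"
      then have "h (rescale z t p) = h z" using tp(4) h(2) by simp
      then have "rescale z t p = z" using injh in_ball[OF tp(3), of t] tp r by (auto dest: inj_onD)
      then show False using dist_re[OF tp(3), of t] tp(1) r by simp
    qed
    ultimately show "w \<in> C \<inter> cball z r - {z}" by blast
  qed
  have cont: "continuous_on ({0..1} \<times> L) (\<lambda>(t, p). h (rescale z t p))"
    unfolding case_prod_beta
  proof (rule continuous_on_compose2[OF homeomorphism_cont1[OF h(1)]])
    show "continuous_on ({0..1} \<times> L) (\<lambda>x. rescale z (fst x) (snd x))"
      unfolding rescale_def by (intro continuous_intros)
  qed (use in_ball in auto)
  show "connected (C \<inter> cball z r - {z})"
    unfolding eq
    by (intro connected_continuous_image continuous_on_subset[OF cont] connected_Times L) auto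
  assume e: "e > 0" and "C \<inter> cball z r - {z} \<noteq> {}"
  then obtain p where p: "p \<in> L" unfolding eq by auto
  have "continuous_on {0..1} (\<lambda>t. (\<lambda>(t, p). h (rescale z t p)) (t, p))"
    by (rule continuous_on_compose2[OF cont]) (use p in \<open>auto intro!: continuous_intros\<close>)
  then have "((\<lambda>t. h (rescale z t p)) \<longlongrightarrow> h (rescale z 0 p)) (at 0 within {0..1})"
    by (simp add: continuous_on_def)
  then have "\<forall>\<^sub>F t in at 0 within {0..1}. dist (h (rescale z t p)) z < e"
    using e h(2) by (intro tendstoD) (auto simp: rescale_def)
  then obtain \<delta> where \<delta>: "\<delta> > 0"
    "\<And>t. t \<in> {0..1} \<Longrightarrow> t \<noteq> 0 \<Longrightarrow> dist t 0 < \<delta> \<Longrightarrow> dist (h (rescale z t p)) z < e"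
    by (auto simp: eventually_at)
  define t where "t = min 1 (\<delta> / 2)"
  have t: "t \<in> {0<..1}" "dist t 0 < \<delta>" using \<delta>(1) by (auto simp: t_def)
  then have "h (rescale z t p) \<in> ball z e" using \<delta>(2)[of t] by (auto simp: dist_commute)
  moreover have "h (rescale z t p) \<in> C \<inter> cball z r - {z}" unfolding eq using t(1) p by force
  ultimately show "C \<inter> cball z r \<inter> ball z e - {z} \<noteq> {}" by blast
qed

text \<open>\<open>F\<close> could be non-reduced along a smooth part of the curve far from \<open>z0\<close>. This is excluded by
  connectedness of the punctured cone.\<close>

lemma gradient_nonzero_small_ball:
  assumes sr: "small_radius (bizeros D A) z0 r"
    and e: "e > 0" "\<forall>p\<in>ball z0 e - {z0}. bieval_at D (bdx D A) p \<noteq> 0 \<or> bieval_at D (bdy D A) p \<noteq> 0"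
    and p: "p \<in> bizeros D A \<inter> cball z0 r - {z0}"
  shows "bieval_at D (bdx D A) p \<noteq> 0 \<or> bieval_at D (bdy D A) p \<noteq> 0"
proof -
  define X where "X = bizeros D A \<inter> cball z0 r - {z0}"
  define G where "G = {p\<in>X. bieval_at D (bdx D A) p = 0 \<and> bieval_at D (bdy D A) p = 0}"
  have smooth: "smooth_point (bizeros D A) q" if "q \<in> X" for q
    using sr that by (auto simp: small_radius_def X_def)
  have conn: "connected X" unfolding X_def by (rule connected_punctured_small_ball[OF sr])
  \<comment> \<open>All points of \<open>X\<close> are smooth, and at a smooth point a vanishing
    gradient vanishes on the curve nearby.\<close>
  have "openin (top_of_set X) G"
    unfolding openin_subopen[of _ G]
  proof
    fix q assume q: "q \<in> G"
    then have "smooth_point (bizeros D A) (fst q, snd q)" using smooth by (auto simp: G_def)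
    from gradient_zero_locally[OF this] q
    obtain T where T: "open T" "(fst q, snd q) \<in> T" "\<forall>(x, y)\<in>bizeros D A \<inter> T.
      bieval D (bdx D A) x y = 0 \<and> bieval D (bdy D A) x y = 0" by (auto simp: G_def)
    then have "X \<inter> T \<subseteq> G" by (force simp: G_def X_def)
    moreover have "q \<in> X \<inter> T" using q T(2) by (auto simp: G_def)
    moreover have "openin (top_of_set X) (X \<inter> T)" using T(1) by (rule openin_open_Int)
    ultimately show "\<exists>T. openin (top_of_set X) T \<and> q \<in> T \<and> T \<subseteq> G" by blast
  qed
  moreover have "closedin (top_of_set X) G"
  proof -
    have "closed {p. bieval_at D (bdx D A) p = 0 \<and> bieval_at D (bdy D A) p = 0}"
      by (intro closed_Collect_conj closed_Collect_eq continuous_intros)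
    from closedin_closed_Int[OF this, of X] show ?thesis
      by (rule back_subst) (auto simp: G_def)
  qed
  ultimately have "G = {} \<or> G = X" using conn connected_clopen by blast
  \<comment> \<open>The punctured curve contains points within distance \<open>e\<close> of
    \<open>z0\<close>, where the gradient is nonzero.\<close>
  moreover have "G \<noteq> X"
  proof
    assume "G = X"
    obtain q where "q \<in> bizeros D A \<inter> cball z0 r \<inter> ball z0 e - {z0}"
      using connected_punctured_small_ball(2)[OF sr e(1)] p by blast
    then have "q \<in> X" "q \<in> ball z0 e - {z0}" by (auto simp: X_def)
    then show False using e(2) \<open>G = X\<close> by (auto simp: G_def)
  qed
  ultimately have "p \<notin> G" by blast
  then show ?thesis using p unfolding G_def X_def by blast
qed

text \<open>The limit lies on the limit curve and in the ball. If it were not \<open>z0\<close>, the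
  gradient there would be nonzero, hence also at \<open>z n\<close> for large \<open>n\<close>, and
  \<open>z n\<close> would be a smooth point.\<close>

lemma singular_points_tendsto:
  assumes A: "coeffs_tendsto A A'"
    and grad: "\<And>p. p \<in> bizeros D A' \<inter> cball z0 r - {z0} \<Longrightarrow>
      bieval_at D (bdx D A') p \<noteq> 0 \<or> bieval_at D (bdy D A') p \<noteq> 0"
    and z: "\<And>n. z n \<in> cball z0 r" "\<And>n. z n \<in> singular_points (bizeros D (A n))"
    and lim: "z \<longlonglongrightarrow> w"
  shows "w = z0"
proof (rule ccontr)
  assume "w \<noteq> z0"
  have w: "w \<in> cball z0 r" using closed_sequentially[OF closed_cball z(1) lim] .
  have fl: "(\<lambda>n. fst (z n)) \<longlonglongrightarrow> fst w" "(\<lambda>n. snd (z n)) \<longlonglongrightarrow> snd w"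
    using tendsto_fst[OF lim] tendsto_snd[OF lim] .
  have zz: "bieval_at D (A n) (z n) = 0" for n
    using z(2)[of n] by (simp add: singular_points_def bizeros_def)
  have "(\<lambda>n. bieval_at D (A n) (z n)) \<longlonglongrightarrow> bieval_at D A' w"
    using A by (intro tendsto_intros fl) auto
  then have "bieval_at D A' w = 0" using zz by (simp add: LIMSEQ_const_iff)
  then have "w \<in> bizeros D A' \<inter> cball z0 r - {z0}" using w \<open>w \<noteq> z0\<close> by (simp add: bizeros_def)
  note g = grad[OF this]
  have dA: "(\<lambda>n. bdx D (A n) i j) \<longlonglongrightarrow> bdx D A' i j" "(\<lambda>n. bdy D (A n) i j) \<longlonglongrightarrow> bdy D A' i j" for i j
    using A unfolding bdx_def bdy_def by (auto intro!: tendsto_intros)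
  have lx: "(\<lambda>n. bieval_at D (bdx D (A n)) (z n)) \<longlonglongrightarrow> bieval_at D (bdx D A') w"
    and ly: "(\<lambda>n. bieval_at D (bdy D (A n)) (z n)) \<longlonglongrightarrow> bieval_at D (bdy D A') w"
    by (intro tendsto_intros fl dA)+
  have "\<forall>\<^sub>F n in sequentially. bieval_at D (bdx D (A n)) (z n) \<noteq> 0 \<or>
      bieval_at D (bdy D (A n)) (z n) \<noteq> 0"
    using g
  proof
    assume "bieval_at D (bdx D A') w \<noteq> 0"
    from tendsto_imp_eventually_ne[OF lx this] show ?thesis by eventually_elim blast
  next
    assume "bieval_at D (bdy D A') w \<noteq> 0"
    from tendsto_imp_eventually_ne[OF ly this] show ?thesis by eventually_elim blast
  qed
  then obtain n where "bieval_at D (bdx D (A n)) (z n) \<noteq> 0 \<or>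
      bieval_at D (bdy D (A n)) (z n) \<noteq> 0"
    by (auto simp: eventually_sequentially)
  from smooth_point_of_gradient[OF zz this] show False using z(2)[of n] by (simp add: singular_points_def)
qed


section \<open>Orders of polynomials along a branch\<close>

lemma exists_shifted_coeffs:
  fixes c :: "nat \<Rightarrow> complex"
  shows "\<exists>c'. \<forall>x. (\<Sum>i\<le>D. c i * (x + a) ^ i) = (\<Sum>i\<le>D. c' i * x ^ i)"
proof -
  define p where "p = (\<Sum>i\<le>D. Polynomial.monom (c i) i)"
  define q where "q = pcompose p [:a, 1:]"
  have "Polynomial.degree p \<le> D" unfolding p_def
    by (intro degree_sum_le) (auto intro: order_trans[OF degree_monom_le])
  then have "Polynomial.degree q \<le> D" using degree_pcompose[of p "[:a, 1:]"] by (simp add: q_def)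
  then have "poly q x = (\<Sum>i\<le>D. Polynomial.coeff q i * x ^ i)" for x
    by (intro poly_eq_sum_atMost) (auto intro: coeff_eq_0)
  moreover have "poly q x = (\<Sum>i\<le>D. c i * (x + a) ^ i)" for x
    by (simp add: q_def p_def poly_pcompose poly_sum poly_monom add.commute)
  ultimately show ?thesis by (intro exI[of _ "Polynomial.coeff q"]) simp
qed

text \<open>Translation does not raise the degree in either variable, so coordinates may be centred
  at a point of the curve without changing \<open>D\<close>.\<close>

lemma exists_shifted_bieval: "\<exists>B. \<forall>x y. bieval D A (x + a) (y + b) = bieval D B x y"
proof -
  have "\<forall>j. \<exists>c'. \<forall>x. (\<Sum>i\<le>D. A i j * (x + a) ^ i) = (\<Sum>i\<le>D. c' i * x ^ i)"
    by (intro allI exists_shifted_coeffs)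
  from choice[OF this] obtain A1 where A1: "\<And>j x. (\<Sum>i\<le>D. A i j * (x + a) ^ i) = (\<Sum>i\<le>D. A1 j i * x ^ i)"
    by blast
  have "\<forall>i. \<exists>c'. \<forall>y. (\<Sum>j\<le>D. A1 j i * (y + b) ^ j) = (\<Sum>j\<le>D. c' j * y ^ j)"
    by (intro allI exists_shifted_coeffs)
  from choice[OF this] obtain A2 where A2: "\<And>i y. (\<Sum>j\<le>D. A1 j i * (y + b) ^ j) = (\<Sum>j\<le>D. A2 i j * y ^ j)"
    by blast
  have "bieval D A (x + a) (y + b) = bieval D A2 x y" for x y
  proof -
    have "bieval D A (x + a) (y + b) = (\<Sum>j\<le>D. (\<Sum>i\<le>D. A1 j i * x ^ i) * (y + b) ^ j)"
      by (simp add: bieval_alt A1)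
    also have "\<dots> = (\<Sum>j\<le>D. \<Sum>i\<le>D. A1 j i * x ^ i * (y + b) ^ j)" by (simp add: sum_distrib_right)
    also have "\<dots> = (\<Sum>i\<le>D. \<Sum>j\<le>D. A1 j i * x ^ i * (y + b) ^ j)" by (rule sum.swap)
    also have "\<dots> = (\<Sum>i\<le>D. x ^ i * (\<Sum>j\<le>D. A1 j i * (y + b) ^ j))" by (simp add: sum_distrib_left mult_ac)
    also have "\<dots> = (\<Sum>i\<le>D. x ^ i * (\<Sum>j\<le>D. A2 i j * y ^ j))" by (simp only: A2)
    also have "\<dots> = bieval D A2 x y" by (simp add: bieval_def sum_distrib_left mult_ac)
    finally show ?thesis .
  qed
  then show ?thesis by blast
qed

lemma fps_nth_power_mult_power_eq_0:
  fixes u v :: "complex fps"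
  assumes "fps_nth u 0 = 0" "fps_nth v 0 = 0" "i > k \<or> j > k"
  shows "fps_nth (u ^ i * v ^ j) k = 0"
  unfolding fps_mult_nth
proof (rule sum.neutral, rule ballI)
  fix l assume "l \<in> {0..k}"
  then show "fps_nth (u ^ i) l * fps_nth (v ^ j) (k - l) = 0"
    using assms(3) startsby_zero_power_prefix[OF assms(1), of i] startsby_zero_power_prefix[OF assms(2), of j]
    by auto
qed

definition fps_bieval :: "nat \<Rightarrow> (nat \<Rightarrow> nat \<Rightarrow> complex) \<Rightarrow> complex fps \<Rightarrow> complex fps \<Rightarrow> complex fps" where
  "fps_bieval D A u v = (\<Sum>i\<le>D. \<Sum>j\<le>D. fps_const (A i j) * (u ^ i * v ^ j))"

text \<open>\<open>u\<close> and \<open>v\<close> have no constant term, so monomials with an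
  exponent above \<open>D\<close> cannot affect coefficients up to \<open>t^D\<close>: a power
  series may be replaced by its truncation.\<close>

lemma fps_nth_subst2_eq:
  assumes uv: "fps_nth u 0 = 0" "fps_nth v 0 = 0" and "k \<le> D"
  shows "fps_nth (fps_subst2 f u v) k = fps_nth (fps_bieval D (\<lambda>i j. fps_nth (fps_nth f j) i) u v) k"
proof -
  note z = fps_nth_power_mult_power_eq_0[OF uv]
  have "fps_nth (fps_subst2 f u v) k = (\<Sum>j\<le>k. \<Sum>i\<le>k. fps_nth (fps_nth f j) i * fps_nth (u ^ i * v ^ j) k)"
    by (simp add: fps_subst2_def)
  also have "\<dots> = (\<Sum>j\<le>k. \<Sum>i\<le>D. fps_nth (fps_nth f j) i * fps_nth (u ^ i * v ^ j) k)"
    using \<open>k \<le> D\<close> z by (intro sum.cong refl sum.mono_neutral_left) auto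
  also have "\<dots> = (\<Sum>j\<le>D. \<Sum>i\<le>D. fps_nth (fps_nth f j) i * fps_nth (u ^ i * v ^ j) k)"
    using \<open>k \<le> D\<close> z by (intro sum.mono_neutral_left) auto
  also have "\<dots> = (\<Sum>i\<le>D. \<Sum>j\<le>D. fps_nth (fps_nth f j) i * fps_nth (u ^ i * v ^ j) k)"
    by (rule sum.swap)
  also have "\<dots> = fps_nth (fps_bieval D (\<lambda>i j. fps_nth (fps_nth f j) i) u v) k"
    by (simp add: fps_bieval_def fps_sum_nth)
  finally show ?thesis .
qed

text \<open>For a polynomial, padded with zeros to a power series, substitution is exact. For each
  coefficient \<open>k\<close> the truncation bound is raised to \<open>max k D\<close> and then
  lowered to \<open>D\<close>, where only zeros are lost.\<close>

lemma fps_subst2_finite: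
  assumes uv: "fps_nth u 0 = 0" "fps_nth v 0 = 0"
  shows "fps_subst2 (Abs_fps (\<lambda>j. Abs_fps (\<lambda>i. if i \<le> D \<and> j \<le> D then A i j else 0))) u v = fps_bieval D A u v"
proof (rule fps_ext)
  fix k
  define f where "f = Abs_fps (\<lambda>j. Abs_fps (\<lambda>i. if i \<le> D \<and> j \<le> D then A i j else 0))"
  define K where "K = max k D"
  have "fps_nth (fps_subst2 f u v) k = fps_nth (fps_bieval K (\<lambda>i j. fps_nth (fps_nth f j) i) u v) k"
    by (rule fps_nth_subst2_eq[OF uv]) (simp add: K_def)
  also have "fps_bieval K (\<lambda>i j. fps_nth (fps_nth f j) i) u v = fps_bieval D A u v"
  proof -
    have "fps_bieval K (\<lambda>i j. fps_nth (fps_nth f j) i) u v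
        = (\<Sum>i\<le>D. \<Sum>j\<le>K. fps_const (fps_nth (fps_nth f j) i) * (u ^ i * v ^ j))"
      unfolding fps_bieval_def by (rule sum.mono_neutral_right) (auto simp: f_def K_def)
    also have "\<dots> = (\<Sum>i\<le>D. \<Sum>j\<le>D. fps_const (fps_nth (fps_nth f j) i) * (u ^ i * v ^ j))"
      by (intro sum.cong refl sum.mono_neutral_right) (auto simp: f_def K_def)
    also have "\<dots> = fps_bieval D A u v"
      unfolding fps_bieval_def by (intro sum.cong refl) (auto simp: f_def)
    finally show ?thesis .
  qed
  finally show "fps_nth (fps_subst2 f u v) k = fps_nth (fps_bieval D A u v) k" .
qed

lemma local_param_expansions:
  assumes lp: "local_param C z V \<gamma>"
  defines "u \<equiv> fps_expansion (\<lambda>t. fst (\<gamma> t) - fst (\<gamma> 0)) 0" and "v \<equiv> fps_expansion (\<lambda>t. snd (\<gamma> t) - snd (\<gamma> 0)) 0"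
  shows "fps_nth u 0 = 0" "fps_nth v 0 = 0"
    "(\<lambda>t. bieval D A (fst (\<gamma> t) - fst z) (snd (\<gamma> t) - snd z)) has_fps_expansion fps_bieval D A u v"
proof -
  from lp have V: "open V" "0 \<in> V" "\<gamma> 0 = z" and hol: "(fst \<circ> \<gamma>) holomorphic_on V" "(snd \<circ> \<gamma>) holomorphic_on V"
    by (auto simp: local_param_def)
  have "(\<lambda>t. (fst \<circ> \<gamma>) t - fst (\<gamma> 0)) holomorphic_on V" "(\<lambda>t. (snd \<circ> \<gamma>) t - snd (\<gamma> 0)) holomorphic_on V"
    by (intro holomorphic_intros hol)+
  then have u: "(\<lambda>t. fst (\<gamma> t) - fst (\<gamma> 0)) has_fps_expansion u"
    and v: "(\<lambda>t. snd (\<gamma> t) - snd (\<gamma> 0)) has_fps_expansion v"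
    unfolding u_def v_def using V by (auto intro!: has_fps_expansion_fps_expansion simp: comp_def)
  show "fps_nth u 0 = 0" "fps_nth v 0 = 0"
    using has_fps_expansion_imp_0_eq_fps_nth_0[OF u] has_fps_expansion_imp_0_eq_fps_nth_0[OF v] by auto
  have "(\<lambda>t. \<Sum>i\<le>D. \<Sum>j\<le>D. A i j * ((fst (\<gamma> t) - fst (\<gamma> 0)) ^ i * (snd (\<gamma> t) - snd (\<gamma> 0)) ^ j))
      has_fps_expansion fps_bieval D A u v"
    unfolding fps_bieval_def
    by (intro has_fps_expansion_sum has_fps_expansion_cmult_left has_fps_expansion_mult has_fps_expansion_power u v)
  then show "(\<lambda>t. bieval D A (fst (\<gamma> t) - fst z) (snd (\<gamma> t) - snd z)) has_fps_expansion fps_bieval D A u v"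
    by (simp add: bieval_def V(3) mult.assoc)
qed

text \<open>The order of a polynomial along a branch is an element of the semigroup; the polynomial
  is first rewritten in coordinates centred at \<open>z\<close>.\<close>

lemma bieval_has_expansion:
  assumes lp: "local_param C z V \<gamma>"
  obtains H where "(\<lambda>t. bieval_at D B (\<gamma> t)) has_fps_expansion H"
    "H \<noteq> 0 \<Longrightarrow> subdegree H \<in> param_semigroup \<gamma>"
proof -
  obtain A where A: "\<And>x y. bieval D B (x + fst z) (y + snd z) = bieval D A x y"
    using exists_shifted_bieval[of D B "fst z" "snd z"] by blast
  define u v where "u = fps_expansion (\<lambda>t. fst (\<gamma> t) - fst (\<gamma> 0)) 0"
    and "v = fps_expansion (\<lambda>t. snd (\<gamma> t) - snd (\<gamma> 0)) 0"
  note e = local_param_expansions[OF lp, folded u_def v_def]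
  have "bieval_at D B (\<gamma> t) = bieval D A (fst (\<gamma> t) - fst z) (snd (\<gamma> t) - snd z)" for t
    using A[of "fst (\<gamma> t) - fst z" "snd (\<gamma> t) - snd z"] by simp
  then have "(\<lambda>t. bieval_at D B (\<gamma> t)) has_fps_expansion fps_bieval D A u v"
    using e(3) by simp
  moreover have "subdegree (fps_bieval D A u v) \<in> param_semigroup \<gamma>" if "fps_bieval D A u v \<noteq> 0"
    using that fps_subst2_finite[OF e(1,2), of D A, symmetric]
    unfolding param_semigroup_def Let_def u_def[symmetric] v_def[symmetric] by auto
  ultimately show thesis by (rule that)
qed

text \<open>A converse up to \<open>D\<close>: the power series witnessing \<open>\<tau>\<close> is
  truncated at \<open>D\<close>, which keeps the coefficients up to \<open>t^\<tau>\<close>, and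
  then translated back from \<open>z\<close>.\<close>

lemma exists_bieval_of_order:
  assumes lp: "local_param C z V \<gamma>" and "\<tau> \<in> param_semigroup \<gamma>" "\<tau> \<le> D"
  obtains B H where "(\<lambda>t. bieval_at D B (\<gamma> t)) has_fps_expansion H" "fps_nth H \<tau> \<noteq> 0"
    "\<And>k. k < \<tau> \<Longrightarrow> fps_nth H k = 0"
proof -
  define u v where "u = fps_expansion (\<lambda>t. fst (\<gamma> t) - fst (\<gamma> 0)) 0"
    and "v = fps_expansion (\<lambda>t. snd (\<gamma> t) - snd (\<gamma> 0)) 0"
  note e = local_param_expansions[OF lp, folded u_def v_def]
  from assms(2) obtain f where f: "fps_subst2 f u v \<noteq> 0" "\<tau> = subdegree (fps_subst2 f u v)"
    unfolding param_semigroup_def Let_def u_def v_def by auto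
  define A where "A = (\<lambda>i j. fps_nth (fps_nth f j) i)"
  have eq: "fps_nth (fps_bieval D A u v) k = fps_nth (fps_subst2 f u v) k" if "k \<le> D" for k
    using fps_nth_subst2_eq[OF e(1,2) that, of f] by (simp add: A_def)
  obtain B where B: "\<And>x y. bieval D A (x + (- fst z)) (y + (- snd z)) = bieval D B x y"
    using exists_shifted_bieval by metis
  have "(\<lambda>t. bieval_at D B (\<gamma> t)) has_fps_expansion fps_bieval D A u v"
    using e(3)[of D A] by (simp add: B[symmetric])
  moreover have "fps_nth (fps_bieval D A u v) \<tau> \<noteq> 0" using eq[OF \<open>\<tau> \<le> D\<close>] f by simp
  moreover have "fps_nth (fps_bieval D A u v) k = 0" if "k < \<tau>" for k
    using eq[of k] that \<open>\<tau> \<le> D\<close> f(2) nth_less_subdegree_zero by simp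
  ultimately show thesis by (rule that)
qed

lemma has_fps_expansion_factor:
  fixes g :: "complex \<Rightarrow> complex"
  assumes g: "g has_fps_expansion G" and G: "G \<noteq> 0" "m \<le> subdegree G"
  shows "\<forall>\<^sub>F t in nhds 0. g t = t ^ m * eval_fps (fps_shift m G) t"
    and "isCont (eval_fps (fps_shift m G)) 0" "eval_fps (fps_shift m G) 0 = fps_nth G m"
proof -
  have R: "fps_conv_radius G > 0" and ev: "\<forall>\<^sub>F t in nhds 0. eval_fps G t = g t"
    using g by (auto simp: has_fps_expansion_def)
  have "\<forall>\<^sub>F t in nhds 0. t \<in> eball 0 (fps_conv_radius G)"
    by (rule eventually_nhds_in_open) (use R in \<open>auto simp: zero_ereal_def\<close>)
  with ev show "\<forall>\<^sub>F t in nhds 0. g t = t ^ m * eval_fps (fps_shift m G) t"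
  proof eventually_elim
    case (elim t)
    then have t: "ereal (norm t) < fps_conv_radius G" by (simp add: in_eball_iff)
    show ?case
    proof (cases "t = 0")
      case False
      then show ?thesis using eval_fps_shift[OF G(2) t] elim by simp
    next
      case True
      have "g 0 = fps_nth G 0" by (rule has_fps_expansion_imp_0_eq_fps_nth_0[OF g])
      moreover have "fps_nth G 0 = 0" if "m > 0" using G(2) that by (intro nth_less_subdegree_zero) auto
      ultimately show ?thesis using True by (cases m) (auto simp: eval_fps_at_0)
    qed
  qed
  show "isCont (eval_fps (fps_shift m G)) 0"
    using R by (intro continuous_eval_fps) (simp add: zero_ereal_def)
  show "eval_fps (fps_shift m G) 0 = fps_nth G m" by (simp add: eval_fps_at_0)
qed

text \<open>This and the next statement turn orders of vanishing into growth bounds, the form in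
  which \<open>intersection_semicontinuity\<close> uses them. Zero coefficients below
  \<open>m\<close> allow the identically zero function too.\<close>

lemma has_fps_expansion_upper:
  fixes g :: "complex \<Rightarrow> complex"
  assumes g: "g has_fps_expansion G" and G: "\<And>k. k < m \<Longrightarrow> fps_nth G k = 0"
  shows "\<exists>C. \<forall>\<^sub>F t in nhds 0. norm (g t) \<le> C * norm t ^ m"
proof (cases "G = 0")
  case True
  then have "\<forall>\<^sub>F t in nhds 0. norm (g t) \<le> 0 * norm t ^ m"
    using g by (auto simp: has_fps_expansion_def elim: eventually_mono)
  then show ?thesis by blast
next
  case False
  have m: "m \<le> subdegree G" using False G by (intro subdegree_geI) auto
  note f = has_fps_expansion_factor[OF g False m]
  have "(eval_fps (fps_shift m G) \<longlongrightarrow> fps_nth G m) (nhds 0)"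
    using f(2,3) by (metis isCont_def tendsto_at_iff_tendsto_nhds)
  then have "\<forall>\<^sub>F t in nhds 0. dist (eval_fps (fps_shift m G) t) (fps_nth G m) < 1"
    by (rule tendstoD) simp
  with f(1) have "\<forall>\<^sub>F t in nhds 0. norm (g t) \<le> (norm (fps_nth G m) + 1) * norm t ^ m"
  proof eventually_elim
    case (elim t)
    have "norm (eval_fps (fps_shift m G) t) \<le> norm (fps_nth G m) + 1"
      using elim(2) norm_triangle_ineq2[of "eval_fps (fps_shift m G) t" "fps_nth G m"] by (simp add: dist_norm)
    then have "norm t ^ m * norm (eval_fps (fps_shift m G) t) \<le> norm t ^ m * (norm (fps_nth G m) + 1)"
      by (intro mult_left_mono) auto
    then show ?case using elim(1) by (simp add: norm_mult norm_power mult.commute)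
  qed
  then show ?thesis by blast
qed

lemma has_fps_expansion_lower:
  fixes g :: "complex \<Rightarrow> complex"
  assumes g: "g has_fps_expansion G" and G: "G \<noteq> 0"
  shows "\<exists>c>0. \<forall>\<^sub>F t in nhds 0. c * norm t ^ subdegree G \<le> norm (g t)"
proof -
  define m where "m = subdegree G"
  note f = has_fps_expansion_factor[OF g G order_refl, folded m_def]
  have nz: "fps_nth G m \<noteq> 0" using G by (simp add: m_def)
  have "(eval_fps (fps_shift m G) \<longlongrightarrow> fps_nth G m) (nhds 0)"
    using f(2,3) by (metis isCont_def tendsto_at_iff_tendsto_nhds)
  then have "\<forall>\<^sub>F t in nhds 0. dist (eval_fps (fps_shift m G) t) (fps_nth G m) < norm (fps_nth G m) / 2"
    by (rule tendstoD) (use nz in simp)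
  with f(1) have "\<forall>\<^sub>F t in nhds 0. norm (fps_nth G m) / 2 * norm t ^ m \<le> norm (g t)"
  proof eventually_elim
    case (elim t)
    have "norm (fps_nth G m) / 2 \<le> norm (eval_fps (fps_shift m G) t)"
      using elim(2) norm_triangle_ineq3[of "eval_fps (fps_shift m G) t" "fps_nth G m"] by (simp add: dist_norm)
    then have "norm t ^ m * (norm (fps_nth G m) / 2) \<le> norm t ^ m * norm (eval_fps (fps_shift m G) t)"
      by (intro mult_left_mono) auto
    then show ?case using elim(1) by (simp add: norm_mult norm_power mult.commute)
  qed
  then show ?thesis using nz unfolding m_def by (intro exI[of _ "norm (fps_nth G (subdegree G)) / 2"]) auto
qed

section \<open>Underdetermined linear systems and convergent subsequences\<close>

lemma exists_nontrivial_solution: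
  fixes M :: "'i \<Rightarrow> 't \<Rightarrow> complex"
  assumes "finite I" "finite T" "card I < card T"
  shows "\<exists>c. (\<exists>\<tau>\<in>T. c \<tau> \<noteq> 0) \<and> (\<forall>i\<in>I. (\<Sum>\<tau>\<in>T. c \<tau> * M i \<tau>) = 0)"
  using assms
proof (induction I arbitrary: T M rule: finite_induct)
  case empty
  then have "T \<noteq> {}" by auto
  then show ?case by (intro exI[of _ "\<lambda>_. 1"]) auto
next
  case (insert i I)
  show ?case
  proof (cases "\<exists>\<tau>\<in>T. M i \<tau> \<noteq> 0")
    case False
    then have "(\<Sum>\<tau>\<in>T. c \<tau> * M i \<tau>) = 0" for c by simp
    moreover have "card I < card T" using insert by simp
    ultimately show ?thesis using insert.IH[OF insert.prems(1), of M] by auto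
  next
    case True
    then obtain t where t: "t \<in> T" "M i t \<noteq> 0" by blast
    have "card I < card (T - {t})" using insert t by simp
    from insert.IH[OF _ this, of "\<lambda>k \<tau>. M k \<tau> - M k t * M i \<tau> / M i t"] insert.prems(1)
    obtain c where c: "\<exists>\<tau>\<in>T - {t}. c \<tau> \<noteq> 0"
      "\<And>k. k \<in> I \<Longrightarrow> (\<Sum>\<tau>\<in>T - {t}. c \<tau> * (M k \<tau> - M k t * M i \<tau> / M i t)) = 0" by auto
    \<comment> \<open>Elimination of the unknown at \<open>t\<close>: its value is forced by
      equation \<open>i\<close>, and the modified coefficients in the induction hypothesis are what
      remains of the other equations.\<close>
    define c' where "c' = c(t := - (\<Sum>\<tau>\<in>T - {t}. c \<tau> * M i \<tau>) / M i t)"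
    have sum: "(\<Sum>\<tau>\<in>T. c' \<tau> * M k \<tau>) = (\<Sum>\<tau>\<in>T - {t}. c \<tau> * M k \<tau>)
        - (\<Sum>\<tau>\<in>T - {t}. c \<tau> * M i \<tau>) / M i t * M k t" for k
      using sum.remove[OF insert.prems(1) t(1), of "\<lambda>\<tau>. c' \<tau> * M k \<tau>"] by (simp add: c'_def)
    have "(\<Sum>\<tau>\<in>T. c' \<tau> * M i \<tau>) = 0" unfolding sum using t(2) by simp
    moreover have "(\<Sum>\<tau>\<in>T. c' \<tau> * M k \<tau>) = 0" if "k \<in> I" for k
      unfolding sum using c(2)[OF that]
      by (simp add: right_diff_distrib sum_subtractf sum_distrib_left sum_divide_distrib sum_distrib_right mult_ac)
    moreover have "\<exists>\<tau>\<in>T. c' \<tau> \<noteq> 0" using c(1) by (auto simp: c'_def)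
    ultimately show ?thesis by blast
  qed
qed

text \<open>Bolzano-Weierstrass for one index after another, each time passing to a subsequence of
  the one already found.\<close>

lemma finite_family_convergent_subseq:
  fixes x :: "nat \<Rightarrow> 'i \<Rightarrow> 'a::heine_borel"
  assumes "finite I" "\<And>i. i \<in> I \<Longrightarrow> bounded (range (\<lambda>n. x n i))"
  shows "\<exists>r l. strict_mono (r :: nat \<Rightarrow> nat) \<and> (\<forall>i\<in>I. (\<lambda>n. x (r n) i) \<longlonglongrightarrow> l i)"
  using assms
proof (induction I rule: finite_induct)
  case empty
  show ?case by (intro exI[of _ id]) (auto simp: strict_mono_def)
next
  case (insert i I)
  then obtain r l where r: "strict_mono (r :: nat \<Rightarrow> nat)" "\<And>i. i \<in> I \<Longrightarrow> (\<lambda>n. x (r n) i) \<longlonglongrightarrow> l i" by auto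
  have "bounded (range (\<lambda>n. x (r n) i))"
    by (rule bounded_subset[OF insert.prems[of i]]) auto
  then obtain li s where s: "strict_mono (s :: nat \<Rightarrow> nat)" "((\<lambda>n. x (r n) i) \<circ> s) \<longlonglongrightarrow> li"
    using bounded_imp_convergent_subsequence by blast
  have "(\<lambda>n. x ((r \<circ> s) n) k) \<longlonglongrightarrow> (l(i := li)) k" if "k \<in> insert i I" for k
  proof (cases "k = i")
    case True
    then show ?thesis using s(2) by (simp add: comp_def)
  next
    case False
    then show ?thesis using LIMSEQ_subseq_LIMSEQ[OF r(2)[of k] s(1)] that by (simp add: comp_def)
  qed
  then show ?case using strict_mono_o[OF r(1) s(1)] by blast
qed


abbreviation bicomb :: "'t set \<Rightarrow> ('t \<Rightarrow> complex) \<Rightarrow> ('t \<Rightarrow> nat \<Rightarrow> nat \<Rightarrow> complex) \<Rightarrow> nat \<Rightarrow> nat \<Rightarrow> complex" where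
  "bicomb T c B \<equiv> \<lambda>i l. \<Sum>\<tau>\<in>T. c \<tau> * B \<tau> i l"

lemma bieval_sum:
  "bieval D (bicomb T c B) x y = (\<Sum>\<tau>\<in>T. c \<tau> * bieval D (B \<tau>) x y)"
proof -
  have "bieval D (bicomb T c B) x y
      = (\<Sum>i\<le>D. \<Sum>l\<le>D. \<Sum>\<tau>\<in>T. c \<tau> * (B \<tau> i l * x ^ i * y ^ l))"
    by (simp add: bieval_def sum_distrib_right mult.assoc)
  also have "\<dots> = (\<Sum>i\<le>D. \<Sum>\<tau>\<in>T. \<Sum>l\<le>D. c \<tau> * (B \<tau> i l * x ^ i * y ^ l))"
    by (rule sum.cong[OF refl]) (rule sum.swap)
  also have "\<dots> = (\<Sum>\<tau>\<in>T. \<Sum>i\<le>D. \<Sum>l\<le>D. c \<tau> * (B \<tau> i l * x ^ i * y ^ l))"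
    by (rule sum.swap)
  finally show ?thesis by (simp add: bieval_def sum_distrib_left)
qed

lemma has_fps_expansion_combination:
  assumes "\<And>\<tau>. \<tau> \<in> T \<Longrightarrow> (\<lambda>t. bieval D (B \<tau>) (f t) (g t)) has_fps_expansion G \<tau>"
  shows "(\<lambda>t. bieval D (bicomb T c B) (f t) (g t)) has_fps_expansion
    (\<Sum>\<tau>\<in>T. fps_const (c \<tau>) * G \<tau>)"
  unfolding bieval_sum by (intro has_fps_expansion_sum has_fps_expansion_cmult_left assms)

text \<open>There are fewer conditions than unknowns because coefficients are prescribed only at
  semigroup elements below \<open>k j\<close>. This already forces order at least
  \<open>k j\<close>, since the order of the combination is itself in the semigroup.\<close>

lemma exists_combination_of_high_order:
  fixes T :: "'t set" and k :: "'j \<Rightarrow> nat"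
  assumes lp: "\<And>j. j \<in> J \<Longrightarrow> local_param C (z j) (V j) (\<gamma> j)" and fin: "finite J" "finite T"
    and card: "(\<Sum>j\<in>J. card (param_semigroup (\<gamma> j) \<inter> {0..<k j})) < card T"
  obtains c where "(\<Sum>\<tau>\<in>T. norm (c \<tau>)) = 1"
    "\<And>j. j \<in> J \<Longrightarrow> \<exists>K. \<forall>\<^sub>F t in nhds 0.
       norm (bieval_at D (bicomb T c B) (\<gamma> j t)) \<le> K * norm t ^ k j"
proof -
  define I where "I = (SIGMA j:J. param_semigroup (\<gamma> j) \<inter> {0..<k j})"
  have finI: "finite I" using fin by (auto simp: I_def)
  have cardI: "card I < card T" using card fin by (simp add: I_def card_SigmaI)
  define G where "G j \<tau> = fps_expansion (\<lambda>t. bieval_at D (B \<tau>) (\<gamma> j t)) 0" for j \<tau>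
  have G: "(\<lambda>t. bieval_at D (B \<tau>) (\<gamma> j t)) has_fps_expansion G j \<tau>" if "j \<in> J" for j \<tau>
    unfolding G_def
  proof (rule has_fps_expansion_fps_expansion)
    show "open (V j)" "0 \<in> V j" using lp[OF that] by (auto simp: local_param_def)
    have "(fst \<circ> \<gamma> j) holomorphic_on V j" "(snd \<circ> \<gamma> j) holomorphic_on V j"
      using lp[OF that] by (auto simp: local_param_def)
    then show "(\<lambda>t. bieval_at D (B \<tau>) (\<gamma> j t)) holomorphic_on V j"
      using holomorphic_on_bieval by (fastforce simp: comp_def)
  qed
  obtain c0 where c0: "\<exists>\<tau>\<in>T. c0 \<tau> \<noteq> 0"
    "\<forall>i\<in>I. (\<Sum>\<tau>\<in>T. c0 \<tau> * fps_nth (G (fst i) \<tau>) (snd i)) = 0"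
    using exists_nontrivial_solution[OF finI fin(2) cardI, of "\<lambda>i \<tau>. fps_nth (G (fst i) \<tau>) (snd i)"] by blast
  define w where "w = (\<Sum>\<tau>\<in>T. norm (c0 \<tau>))"
  have w: "w > 0"
  proof -
    obtain \<tau> where "\<tau> \<in> T" "c0 \<tau> \<noteq> 0" using c0(1) by blast
    then show ?thesis unfolding w_def using fin(2) by (intro sum_pos2[of T \<tau>]) auto
  qed
  \<comment> \<open>Normalization to total norm 1, so that a limit of such coefficient vectors
    exists along a subsequence and is not zero.\<close>
  define c where "c \<tau> = c0 \<tau> / of_real w" for \<tau>
  have 1: "(\<Sum>\<tau>\<in>T. norm (c \<tau>)) = 1"
  proof -
    have "(\<Sum>\<tau>\<in>T. norm (c \<tau>)) = (\<Sum>\<tau>\<in>T. norm (c0 \<tau>)) / w"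
      using w by (simp add: c_def norm_divide sum_divide_distrib)
    then show ?thesis using w by (simp add: w_def)
  qed
  have 2: "\<exists>K. \<forall>\<^sub>F t in nhds 0.
       norm (bieval_at D (bicomb T c B) (\<gamma> j t)) \<le> K * norm t ^ k j"
    if j: "j \<in> J" for j
  proof -
    define E where "E = (\<Sum>\<tau>\<in>T. fps_const (c \<tau>) * G j \<tau>)"
    have E: "(\<lambda>t. bieval_at D (bicomb T c B) (\<gamma> j t)) has_fps_expansion E"
      unfolding E_def by (rule has_fps_expansion_combination) (rule G[OF j])
    obtain H where H: "(\<lambda>t. bieval_at D (bicomb T c B) (\<gamma> j t)) has_fps_expansion H"
      "H \<noteq> 0 \<Longrightarrow> subdegree H \<in> param_semigroup (\<gamma> j)"
      using bieval_has_expansion[OF lp[OF j], of D "\<lambda>i l. \<Sum>\<tau>\<in>T. c \<tau> * B \<tau> i l"] by blast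
    have "E = H" by (rule fps_expansion_unique_complex[OF E H(1)])
    have nthE: "fps_nth E l = (\<Sum>\<tau>\<in>T. c0 \<tau> * fps_nth (G j \<tau>) l) / of_real w" for l
      by (simp add: E_def fps_sum_nth c_def sum_divide_distrib)
    \<comment> \<open>A nonzero coefficient below \<open>k j\<close> would put
      \<open>subdegree E\<close> below \<open>k j\<close> and in the semigroup, so the leading
      coefficient would be among those prescribed to vanish.\<close>
    have "fps_nth E l = 0" if l: "l < k j" for l
    proof (rule ccontr)
      assume *: "fps_nth E l \<noteq> 0"
      then have "E \<noteq> 0" by auto
      have "subdegree E \<le> l" using * by (rule subdegree_leI)
      then have "(j, subdegree E) \<in> I"
        using H(2) \<open>E = H\<close> \<open>E \<noteq> 0\<close> l j by (auto simp: I_def)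
      then have "fps_nth E (subdegree E) = 0" unfolding nthE using c0(2) by force
      then show False using \<open>E \<noteq> 0\<close> by simp
    qed
    then show ?thesis by (intro has_fps_expansion_upper[OF E])
  qed
  show thesis using that[OF 1 2] .
qed

section \<open>The semigroup inequality, by contradiction along a sequence of parameters tending to
  0\<close>

theorem theorem2p16:
  fixes F :: "complex \<Rightarrow> bipoly"
    and z\<^sub>0 :: "complex \<times> complex"
    and r \<rho> :: real
    and n :: nat
    and S :: "nat \<Rightarrow> nat set"
  assumes n: "n \<ge> 1"
    and cusp: "cuspidal_point (zero_set (F 0)) z\<^sub>0"
    and grad: "\<exists>e>0. \<forall>p\<in>ball z\<^sub>0 e - {z\<^sub>0}. gradient (F 0) p \<noteq> (0, 0)"
    and deform: "deformation F"
    and r: "small_radius (zero_set (F 0)) z\<^sub>0 r"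
    and \<rho>: "0 < \<rho>" "\<rho> \<le> 1"
    and isotopic: "\<forall>s. cmod s < \<rho> \<longrightarrow>
      isotopic_in (sphere z\<^sub>0 r) (zero_set (F 0) \<inter> sphere z\<^sub>0 r) (zero_set (F s) \<inter> sphere z\<^sub>0 r)"
    and delta: "delta_constant F z\<^sub>0 r \<rho>"
    and S0: "has_semigroup (zero_set (F 0)) z\<^sub>0 (S 0)"
    and general_fiber: "\<exists>\<epsilon>>0. \<forall>s. 0 < cmod s \<and> cmod s < \<epsilon> \<longrightarrow>
      (\<exists>z :: nat \<Rightarrow> complex \<times> complex. inj_on z {1..n} \<and>
        (\<forall>j\<in>{1..n}. z j \<in> cball z\<^sub>0 r \<and> z j \<in> singular_points (zero_set (F s)) \<and>
           cuspidal_point (zero_set (F s)) (z j) \<and> has_semigroup (zero_set (F s)) (z j) (S j)))"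
  shows "\<forall>(m :: nat) (k :: nat \<Rightarrow> nat). (\<Sum>j=1..n. k j) = m \<longrightarrow>
    card (S 0 \<inter> {0..<m}) \<le> (\<Sum>j=1..n. card (S j \<inter> {0..<k j}))"
proof (intro allI impI)
  fix m :: nat and k :: "nat \<Rightarrow> nat" assume km: "(\<Sum>j=1..n. k j) = m"
  obtain D0 where D0: "\<forall>s\<in>ball 0 1. \<forall>i j. i > D0 \<or> j > D0 \<longrightarrow> bicoeff (F s) i j = 0"
    using deformation_bounded_degree[OF deform] by blast
  \<comment> \<open>\<open>D0\<close> bounds the degrees of all \<open>F s\<close>, and
    \<open>m\<close> makes room for polynomials of every order \<open>\<tau> < m\<close> on the
    branch at \<open>z\<^sub>0\<close>.\<close>
  define D where "D = max D0 m"
  define A where "A s = bicoeff (F s)" for s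
  have deg: "\<And>i j. i > D \<or> j > D \<Longrightarrow> bicoeff (F s) i j = 0" if "s \<in> ball 0 1" for s
    using D0 that by (auto simp: D_def)
  have zs: "zero_set (F s) = bizeros D (A s)" if "s \<in> ball 0 1" for s
    unfolding A_def by (rule zero_set_eq_bizeros[OF deg[OF that]])
  have zs0: "zero_set (F 0) = bizeros D (A 0)" by (rule zs) simp
  have grad_eq: "gradient (F 0) p = (bieval_at D (bdx D (A 0)) p, bieval_at D (bdy D (A 0)) p)" for p
    unfolding A_def by (rule gradient_eq[OF deg]) simp_all
  obtain e where e: "e > 0" "\<forall>p\<in>ball z\<^sub>0 e - {z\<^sub>0}. bieval_at D (bdx D (A 0)) p \<noteq> 0 \<or>
      bieval_at D (bdy D (A 0)) p \<noteq> 0"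
    using grad unfolding grad_eq by auto
  obtain V0 \<gamma>0 where lp0: "local_param (bizeros D (A 0)) z\<^sub>0 V0 \<gamma>0" and S0': "S 0 = param_semigroup \<gamma>0"
    using S0 unfolding has_semigroup_def zs0 by blast
  define T where "T = S 0 \<inter> {0..<m}"
  have finT: "finite T" by (simp add: T_def)
  show "card (S 0 \<inter> {0..<m}) \<le> (\<Sum>j=1..n. card (S j \<inter> {0..<k j}))"
  proof (rule ccontr)
    assume "\<not> ?thesis"
    then have card: "(\<Sum>j=1..n. card (S j \<inter> {0..<k j})) < card T" by (simp add: T_def)
    have "\<forall>\<tau>\<in>T. \<exists>X. (\<lambda>t. bieval_at D (fst X) (\<gamma>0 t)) has_fps_expansion (snd X) \<and>
        fps_nth (snd X) \<tau> \<noteq> 0 \<and> (\<forall>l<\<tau>. fps_nth (snd X) l = 0)"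
    proof
      fix \<tau> assume "\<tau> \<in> T"
      then have "\<tau> \<in> param_semigroup \<gamma>0" "\<tau> \<le> D" by (auto simp: T_def S0' D_def)
      from exists_bieval_of_order[OF lp0 this] obtain B H where
        "(\<lambda>t. bieval_at D B (\<gamma>0 t)) has_fps_expansion H" "fps_nth H \<tau> \<noteq> 0"
        "\<And>l. l < \<tau> \<Longrightarrow> fps_nth H l = 0" by blast
      then show "\<exists>X. (\<lambda>t. bieval_at D (fst X) (\<gamma>0 t)) has_fps_expansion (snd X) \<and>
        fps_nth (snd X) \<tau> \<noteq> 0 \<and> (\<forall>l<\<tau>. fps_nth (snd X) l = 0)"
        by (intro exI[of _ "(B, H)"]) auto
    qed
    from bchoice[OF this] obtain X where
      X: "\<forall>\<tau>\<in>T. (\<lambda>t. bieval D (fst (X \<tau>)) (fst (\<gamma>0 t)) (snd (\<gamma>0 t))) has_fps_expansion (snd (X \<tau>)) \<and>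
        fps_nth (snd (X \<tau>)) \<tau> \<noteq> 0 \<and> (\<forall>l<\<tau>. fps_nth (snd (X \<tau>)) l = 0)" by blast
    define B H where "B \<tau> = fst (X \<tau>)" and "H \<tau> = snd (X \<tau>)" for \<tau>
    have H: "(\<lambda>t. bieval_at D (B \<tau>) (\<gamma>0 t)) has_fps_expansion H \<tau>" "fps_nth (H \<tau>) \<tau> \<noteq> 0"
      "\<And>l. l < \<tau> \<Longrightarrow> fps_nth (H \<tau>) l = 0" if "\<tau> \<in> T" for \<tau>
      using X that by (auto simp: B_def H_def)
    obtain \<epsilon> where \<epsilon>: "\<epsilon> > 0" and fib: "\<And>s. 0 < cmod s \<and> cmod s < \<epsilon> \<Longrightarrow>
      (\<exists>z :: nat \<Rightarrow> complex \<times> complex. inj_on z {1..n} \<and>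
        (\<forall>j\<in>{1..n}. z j \<in> cball z\<^sub>0 r \<and> z j \<in> singular_points (zero_set (F s)) \<and>
           cuspidal_point (zero_set (F s)) (z j) \<and> has_semigroup (zero_set (F s)) (z j) (S j)))"
      using general_fiber by blast
    \<comment> \<open>Nonzero parameters tending to 0. The double successor keeps the factor
      strictly below 1, hence \<open>s N\<close> inside both the unit disc and the range given by
      \<open>\<epsilon>\<close>.\<close>
    define s where "s N = complex_of_real (min \<epsilon> 1 * inverse (real (Suc (Suc N))))" for N
    have s: "0 < cmod (s N)" "cmod (s N) < \<epsilon>" "s N \<in> ball 0 1" for N
    proof -
      have i: "0 < inverse (real (Suc (Suc N)))" "inverse (real (Suc (Suc N))) < 1"
        by (auto simp: field_simps)
      have "0 < min \<epsilon> 1" using \<epsilon> by simp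
      then have "0 < min \<epsilon> 1 * inverse (real (Suc (Suc N)))" "min \<epsilon> 1 * inverse (real (Suc (Suc N))) < min \<epsilon> 1"
        using i mult_strict_left_mono[of "inverse (real (Suc (Suc N)))" 1 "min \<epsilon> 1"]
        by (simp_all only: mult_1_right mult_pos_pos)
      moreover have "cmod (s N) = min \<epsilon> 1 * inverse (real (Suc (Suc N)))"
        using calculation(1) unfolding s_def norm_of_real by (rule abs_of_pos)
      ultimately show "0 < cmod (s N)" "cmod (s N) < \<epsilon>" "s N \<in> ball 0 1" by auto
    qed
    have "(\<lambda>N. min \<epsilon> 1 * inverse (real (Suc (Suc N)))) \<longlonglongrightarrow> min \<epsilon> 1 * 0"
      by (rule tendsto_mult[OF tendsto_const LIMSEQ_Suc[OF LIMSEQ_inverse_real_of_nat]])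
    then have "s \<longlonglongrightarrow> complex_of_real (min \<epsilon> 1 * 0)" unfolding s_def by (rule tendsto_of_real)
    then have s_lim: "s \<longlonglongrightarrow> 0" by simp
    \<comment> \<open>All data attached to one parameter are bundled into a tuple, so that a single
      application of choice selects them for every \<open>N\<close>.\<close>
    define P where "P N X \<longleftrightarrow> (case X of (z, V, \<gamma>, c, K) \<Rightarrow> inj_on z {1..n} \<and>
      (\<forall>j\<in>{1..n}. z j \<in> cball z\<^sub>0 r \<and> z j \<in> singular_points (bizeros D (A (s N))) \<and>
        local_param (bizeros D (A (s N))) (z j) (V j) (\<gamma> j) \<and>
        (\<forall>\<^sub>F t in nhds 0. norm (bieval_at D (bicomb T c B) (\<gamma> j t))
           \<le> K j * norm t ^ k j)) \<and>
      (\<Sum>\<tau>\<in>T. norm (c \<tau>)) = 1)"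
      for N and X :: "(nat \<Rightarrow> complex \<times> complex) \<times> (nat \<Rightarrow> complex set) \<times> (nat \<Rightarrow> complex \<Rightarrow> complex \<times> complex)
        \<times> (nat \<Rightarrow> complex) \<times> (nat \<Rightarrow> real)"
    have "\<forall>N. \<exists>X. P N X"
    proof
      fix N
      let ?C = "bizeros D (A (s N))"
      obtain z where z: "inj_on z {1..n}" "\<forall>j\<in>{1..n}. z j \<in> cball z\<^sub>0 r \<and> z j \<in> singular_points ?C \<and>
          has_semigroup ?C (z j) (S j)"
        using fib[of "s N"] s[of N] unfolding zs[OF s(3)] by blast
      have "\<forall>j\<in>{1..n}. \<exists>Y. local_param ?C (z j) (fst Y) (snd Y) \<and> S j = param_semigroup (snd Y)"
        using z(2) unfolding has_semigroup_def by fastforce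
      from bchoice[OF this] obtain Y where
        Y: "\<forall>j\<in>{1..n}. local_param ?C (z j) (fst (Y j)) (snd (Y j)) \<and> S j = param_semigroup (snd (Y j))" by blast
      define V \<gamma> where "V j = fst (Y j)" and "\<gamma> j = snd (Y j)" for j
      have lp: "local_param ?C (z j) (V j) (\<gamma> j)" and Sj: "S j = param_semigroup (\<gamma> j)" if "j \<in> {1..n}" for j
        using Y that by (auto simp: V_def \<gamma>_def)
      have "(\<Sum>j\<in>{1..n}. card (param_semigroup (\<gamma> j) \<inter> {0..<k j})) < card T"
        using card Sj by simp
      from exists_combination_of_high_order[OF lp _ finT this, of D B] obtain c where c: "(\<Sum>\<tau>\<in>T. norm (c \<tau>)) = 1"
        "\<And>j. j \<in> {1..n} \<Longrightarrow> \<exists>K. \<forall>\<^sub>F t in nhds 0.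
           norm (bieval_at D (bicomb T c B) (\<gamma> j t)) \<le> K * norm t ^ k j"
        by auto
      from c(2) have "\<forall>j\<in>{1..n}. \<exists>K. \<forall>\<^sub>F t in nhds 0.
           norm (bieval_at D (bicomb T c B) (\<gamma> j t)) \<le> K * norm t ^ k j" by blast
      from bchoice[OF this] obtain K where "\<forall>j\<in>{1..n}. \<forall>\<^sub>F t in nhds 0.
           norm (bieval_at D (bicomb T c B) (\<gamma> j t)) \<le> K j * norm t ^ k j" by blast
      then have "P N (z, V, \<gamma>, c, K)" unfolding P_def case_prod_conv using z lp c(1) by blast
      then show "\<exists>X. P N X" by blast
    qed
    from choice[OF this] obtain X where X: "\<And>N. P N (X N)" by blast
    define z V \<gamma> c K where "z N = fst (X N)" and "V N = fst (snd (X N))" and "\<gamma> N = fst (snd (snd (X N)))"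
      and "c N = fst (snd (snd (snd (X N))))" and "K N = snd (snd (snd (snd (X N))))" for N
    have PX: "P N (z N, V N, \<gamma> N, c N, K N)" for N using X[of N] by (simp add: z_def V_def \<gamma>_def c_def K_def)
    have inj: "inj_on (z N) {1..n}" and c1: "(\<Sum>\<tau>\<in>T. norm (c N \<tau>)) = 1" for N
      using PX[of N] unfolding P_def case_prod_conv by blast+
    have z: "z N j \<in> cball z\<^sub>0 r" "z N j \<in> singular_points (bizeros D (A (s N)))"
      "local_param (bizeros D (A (s N))) (z N j) (V N j) (\<gamma> N j)"
      "\<forall>\<^sub>F t in nhds 0. norm (bieval_at D (bicomb T (c N) B) (\<gamma> N j t))
           \<le> K N j * norm t ^ k j" if "j \<in> {1..n}" for N j
      using PX[of N] that unfolding P_def case_prod_conv by blast+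
    have "bounded (range (\<lambda>N. z N j))" if "j \<in> {1..n}" for j
      by (rule bounded_subset[OF bounded_cball[of z\<^sub>0 r]]) (use z(1)[OF that] in auto)
    then have "\<exists>r1 l1. strict_mono (r1 :: nat \<Rightarrow> nat) \<and> (\<forall>j\<in>{1..n}. (\<lambda>N. z (r1 N) j) \<longlonglongrightarrow> l1 j)"
      by (intro finite_family_convergent_subseq) auto
    then obtain r1 l1 where
      r1: "strict_mono (r1 :: nat \<Rightarrow> nat)" "\<And>j. j \<in> {1..n} \<Longrightarrow> (\<lambda>N. z (r1 N) j) \<longlonglongrightarrow> l1 j" by blast
    have "norm (c N \<tau>) \<le> 1" if "\<tau> \<in> T" for N \<tau>
      unfolding c1[of N, symmetric] by (rule member_le_sum) (use that finT in auto)
    then have "bounded (range (\<lambda>N. c (r1 N) \<tau>))" if "\<tau> \<in> T" for \<tau>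
      using that by (auto simp: bounded_iff)
    then have "\<exists>r2 c'. strict_mono (r2 :: nat \<Rightarrow> nat) \<and> (\<forall>\<tau>\<in>T. (\<lambda>N. c (r1 (r2 N)) \<tau>) \<longlonglongrightarrow> c' \<tau>)"
      by (intro finite_family_convergent_subseq[where x = "\<lambda>N. c (r1 N)"] finT)
    then obtain r2 c' where
      r2: "strict_mono (r2 :: nat \<Rightarrow> nat)" "\<And>\<tau>. \<tau> \<in> T \<Longrightarrow> (\<lambda>N. c (r1 (r2 N)) \<tau>) \<longlonglongrightarrow> c' \<tau>" by blast
    define q where "q N = r1 (r2 N)" for N
    have q: "strict_mono q" using strict_mono_o[OF r1(1) r2(1)] by (simp add: q_def[abs_def] comp_def)
    have zl: "(\<lambda>N. z (q N) j) \<longlonglongrightarrow> l1 j" if "j \<in> {1..n}" for j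
      using LIMSEQ_subseq_LIMSEQ[OF r1(2)[OF that] r2(1)] by (simp add: comp_def q_def)
    have A_lim: "\<forall>i j. (\<lambda>N. A (s (q N)) i j) \<longlonglongrightarrow> A 0 i j"
    proof (intro allI)
      fix i j
      have "(\<lambda>s. A s i j) holomorphic_on ball 0 1"
        using deform by (simp add: deformation_def A_def bicoeff_def)
      then have "isCont (\<lambda>s. A s i j) 0"
        using continuous_on_eq_continuous_at[OF open_ball] holomorphic_on_imp_continuous_on
        by (metis centre_in_ball zero_less_one)
      moreover have "(\<lambda>N. s (q N)) \<longlonglongrightarrow> 0" using LIMSEQ_subseq_LIMSEQ[OF s_lim q] by (simp add: comp_def)
      ultimately show "(\<lambda>N. A (s (q N)) i j) \<longlonglongrightarrow> A 0 i j" by (rule isCont_tendsto_compose)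
    qed
    have l1: "l1 j = z\<^sub>0" if "j \<in> {1..n}" for j
      by (rule singular_points_tendsto[OF A_lim gradient_nonzero_small_ball[OF r[unfolded zs0] e] z(1)[OF that] z(2)[OF that] zl[OF that]])
    have B_lim: "\<forall>i l. (\<lambda>N. \<Sum>\<tau>\<in>T. c (q N) \<tau> * B \<tau> i l) \<longlonglongrightarrow> (\<Sum>\<tau>\<in>T. c' \<tau> * B \<tau> i l)"
      using r2(2) by (auto simp: q_def intro!: tendsto_intros)
    \<comment> \<open>The normalization passes to the limit, so the limiting combination is
      nontrivial.\<close>
    have "(\<lambda>N. \<Sum>\<tau>\<in>T. norm (c (q N) \<tau>)) \<longlonglongrightarrow> (\<Sum>\<tau>\<in>T. norm (c' \<tau>))"
      using r2(2) by (auto simp: q_def intro!: tendsto_intros)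
    then have c'1: "(\<Sum>\<tau>\<in>T. norm (c' \<tau>)) = 1" by (simp add: c1 LIMSEQ_const_iff)
    define H' where "H' = (\<Sum>\<tau>\<in>T. fps_const (c' \<tau>) * H \<tau>)"
    have H': "(\<lambda>t. bieval_at D (bicomb T c' B) (\<gamma>0 t)) has_fps_expansion H'"
      unfolding H'_def by (rule has_fps_expansion_combination) (rule H(1))
    \<comment> \<open>The series \<open>H \<tau>\<close> have pairwise different orders
      \<open>\<tau>\<close>, so at the least \<open>\<tau>\<close> with
      \<open>c' \<tau> \<noteq> 0\<close> nothing can cancel the leading term.\<close>
    obtain t where t: "t \<in> T" "fps_nth H' t \<noteq> 0"
    proof -
      define T' where "T' = {\<tau>\<in>T. c' \<tau> \<noteq> 0}"
      have "T' \<noteq> {}"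
      proof
        assume "T' = {}"
        then have "(\<Sum>\<tau>\<in>T. norm (c' \<tau>)) = 0" by (intro sum.neutral) (auto simp: T'_def)
        then show False using c'1 by simp
      qed
      moreover have finT': "finite T'" using finT by (simp add: T'_def)
      ultimately have t: "Min T' \<in> T'" by (rule Min_in[rotated])
      have "fps_nth H' (Min T') = (\<Sum>\<tau>\<in>T. c' \<tau> * fps_nth (H \<tau>) (Min T'))"
        by (simp add: H'_def fps_sum_nth)
      also have "\<dots> = (\<Sum>\<tau>\<in>{Min T'}. c' \<tau> * fps_nth (H \<tau>) (Min T'))"
      proof (rule sum.mono_neutral_right[OF finT])
        show "{Min T'} \<subseteq> T" using t by (auto simp: T'_def)
        show "\<forall>\<tau>\<in>T - {Min T'}. c' \<tau> * fps_nth (H \<tau>) (Min T') = 0"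
        proof
          fix \<tau> assume \<tau>: "\<tau> \<in> T - {Min T'}"
          show "c' \<tau> * fps_nth (H \<tau>) (Min T') = 0"
          proof (cases "c' \<tau> = 0")
            case False
            then have "Min T' \<le> \<tau>" using \<tau> finT' by (intro Min_le) (auto simp: T'_def)
            then have "Min T' < \<tau>" using \<tau> by auto
            then show ?thesis using H(3)[of \<tau>] \<tau> by simp
          qed simp
        qed
      qed
      finally have "fps_nth H' (Min T') \<noteq> 0" using t H(2)[of "Min T'"] by (auto simp: T'_def)
      then show thesis using that[of "Min T'"] t by (auto simp: T'_def)
    qed
    have "H' \<noteq> 0" using t(2) by auto
    from has_fps_expansion_lower[OF H' this] obtain c0 where c0: "c0 > 0"
      "\<forall>\<^sub>F t in nhds 0. c0 * norm t ^ subdegree H'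
        \<le> norm (bieval_at D (bicomb T c' B) (\<gamma>0 t))" by blast
    have "subdegree H' \<le> t" using t(2) by (rule subdegree_leI)
    then have less: "subdegree H' < m" using t(1) by (simp add: T_def)
    \<comment> \<open>The parametrization is injective, so for small \<open>t \<noteq> 0\<close> the
      point \<open>\<gamma>0 t\<close> is close to \<open>z\<^sub>0\<close> but different from it,
      where the gradient is nonzero by \<open>e\<close>.\<close>
    have grad0: "\<forall>\<^sub>F t in at 0. bieval_at D (bdx D (A 0)) (\<gamma>0 t) \<noteq> 0 \<or>
                 bieval_at D (bdy D (A 0)) (\<gamma>0 t) \<noteq> 0"
    proof -
      from lp0 obtain g where V0: "open V0" "0 \<in> V0" "\<gamma>0 0 = z\<^sub>0" and g: "homeomorphism V0 (\<gamma>0 ` V0) \<gamma>0 g"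
        by (auto simp: local_param_def)
      have "isCont \<gamma>0 0"
        using homeomorphism_cont1[OF g] V0(1,2) continuous_on_eq_continuous_at by blast
      then have "(\<gamma>0 \<longlongrightarrow> z\<^sub>0) (at 0)" using V0(3) by (simp add: isCont_def)
      then have "\<forall>\<^sub>F t in at 0. dist (\<gamma>0 t) z\<^sub>0 < e" using e(1) by (rule tendstoD)
      moreover have "\<forall>\<^sub>F t in at 0. t \<in> V0 - {0}" using V0(1,2) by (rule eventually_at_in_open)
      ultimately show ?thesis
      proof eventually_elim
        case (elim t)
        have "\<gamma>0 t \<noteq> z\<^sub>0"
        proof
          assume "\<gamma>0 t = z\<^sub>0"
          then have "g (\<gamma>0 t) = g (\<gamma>0 0)" using V0(3) by simp
          then have "t = 0" using homeomorphism_apply1[OF g] elim(2) V0(2) by simp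
          then show False using elim(2) by simp
        qed
        then have "\<gamma>0 t \<in> ball z\<^sub>0 e - {z\<^sub>0}" using elim(1) by (simp add: dist_commute)
        then show ?case using e(2) by blast
      qed
    qed
    have "(\<Sum>j\<in>{1..n}. k j) \<le> subdegree H'"
    proof (rule intersection_semicontinuity[OF A_lim B_lim lp0 grad0 c0])
      show "inj_on (z (q N)) {1..n}" for N by (rule inj)
      show "(\<lambda>N. z (q N) j) \<longlonglongrightarrow> z\<^sub>0" if "j \<in> {1..n}" for j using zl[OF that] l1[OF that] by simp
      show "local_param (bizeros D (A (s (q N)))) (z (q N) j) (V (q N) j) (\<gamma> (q N) j)" if "j \<in> {1..n}" for N j
        by (rule z(3)[OF that])
      show "\<forall>\<^sub>F t in nhds 0. norm (bieval_at D (bicomb T (c (q N)) B) (\<gamma> (q N) j t))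
           \<le> K (q N) j * norm t ^ k j" if "j \<in> {1..n}" for N j
        by (rule z(4)[OF that])
    qed simp
    then show False using less km by simp
  qed
qed

end
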